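(* Let $p_0,q_0,p,q\in[1,\infty)$ be such that $$\frac d{p_0}+\frac1{q_0}=1,\qquad\frac dp+\frac1q=1,\qquad p>q_0d.$$ Let $Q$ be a bounded domain in $\mathbb R^{d+1}$ and let $u\in W^{1,2}_{(q,p)}(Q)\cap C(\bar Q)$ be such that $u\le0$ on $\partial'Q$ and $$\partial_tu+b^iD_iu\ge0$$ in $Q$ (a.e.), where $b\in L_{(q_0,p_0)}(Q)$ is $\mathbb R^d$-valued. Then $u\le0$ in $Q$.
   Context: $d\ge2$. $\|f\|_{L_{(q,p)}}=\big(\int_{\mathbb R}(\int_{\mathbb R^d}|f|^pdx)^{q/p}dt\big)^{1/q}$ if $p>q$ and $=\big(\int_{\mathbb R^d}(\int_{\mathbb R}|f|^qdt)^{p/q}dx\big)^{1/p}$ if $q\ge p$; $\|f\|_{L_{(q,p)}(Q)}=\|fI_Q\|_{L_{(q,p)}}$. $W^{1,2}_{(q,p)}(Q)$: functions with $u$ and Sobolev derivatives $\partial_tu,Du,D^2u$ in $L_{(q,p)}(Q)$. The parabolic boundary $\partial'Q$ is the set of all $(t_0,x_0)\in\partial Q$ for which there are a continuous $\mathbb R^d$-valued function $x_t$ and $\epsilon>0$ with $x_{t_0}=x_0$ and $(t,x_t)\in Q$ for $t\in[t_0-\epsilon,t_0)$. *)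

theory Defs
  imports "HOL-Analysis.Analysis"
begin

text \<open>Real powers on \<open>[0, \<infinity>]\<close>, intended for exponents \<open>a > 0\<close> only.\<close>

definition ennreal_powr :: "ennreal \<Rightarrow> real \<Rightarrow> ennreal" where
  "ennreal_powr x a = (if x = \<infinity> then \<infinity> else ennreal (enn2real x powr a))"

text \<open>
  Points of space-time are pairs \<open>(t, x)\<close>. The order of integration depends on which of the two
  exponents is larger. All integrals are with respect to the (complete) Lebesgue measure: the
  slices of a Lebesgue measurable function are Lebesgue measurable almost everywhere.
\<close>

definition mixed_norm ::
  "real \<Rightarrow> real \<Rightarrow> (real \<times> 'a::euclidean_space \<Rightarrow> 'b::real_normed_vector) \<Rightarrow> ennreal" where
  "mixed_norm q p f =
     (if p > q
      then ennreal_powr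
             (\<integral>\<^sup>+t. ennreal_powr (\<integral>\<^sup>+x. ennreal (norm (f (t, x)) powr p) \<partial>lebesgue) (q / p) \<partial>lebesgue)
             (1 / q)
      else ennreal_powr
             (\<integral>\<^sup>+x. ennreal_powr (\<integral>\<^sup>+t. ennreal (norm (f (t, x)) powr q) \<partial>lebesgue) (p / q) \<partial>lebesgue)
             (1 / p))"

definition mixed_L ::
  "real \<Rightarrow> real \<Rightarrow> (real \<times> 'a::euclidean_space) set
    \<Rightarrow> (real \<times> 'a \<Rightarrow> 'b::real_normed_vector) set" where
  "mixed_L q p Q =
     {f. set_borel_measurable lebesgue Q f \<and>
         mixed_norm q p (\<lambda>z. indicator Q z *\<^sub>R f z) < \<infinity>}"

primrec C_k :: "nat \<Rightarrow> ('a::euclidean_space \<Rightarrow> real) \<Rightarrow> bool" where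
  "C_k 0 f \<longleftrightarrow> continuous_on UNIV f"
| "C_k (Suc n) f \<longleftrightarrow>
     (\<forall>x. f differentiable (at x)) \<and>
     (\<forall>e\<in>Basis. C_k n (\<lambda>x. frechet_derivative f (at x) e))"

definition test_functions :: "'a::euclidean_space set \<Rightarrow> ('a \<Rightarrow> real) set" where
  "test_functions Q =
     {\<phi>. (\<forall>n. C_k n \<phi>) \<and> compact (closure {z. \<phi> z \<noteq> 0}) \<and> closure {z. \<phi> z \<noteq> 0} \<subseteq> Q}"

definition locally_integrable :: "'a::euclidean_space set \<Rightarrow> ('a \<Rightarrow> real) \<Rightarrow> bool" where
  "locally_integrable Q f \<longleftrightarrow> (\<forall>K. compact K \<and> K \<subseteq> Q \<longrightarrow> f absolutely_integrable_on K)"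

text \<open>\<open>v\<close> is (a representative of) the Sobolev derivative of \<open>u\<close> in the direction \<open>e\<close> on \<open>Q\<close>.\<close>

definition weak_derivative ::
  "'a::euclidean_space set \<Rightarrow> 'a \<Rightarrow> ('a \<Rightarrow> real) \<Rightarrow> ('a \<Rightarrow> real) \<Rightarrow> bool" where
  "weak_derivative Q e u v \<longleftrightarrow>
     locally_integrable Q u \<and> locally_integrable Q v \<and>
     (\<forall>\<phi>\<in>test_functions Q.
        (LINT z:Q|lebesgue. u z * frechet_derivative \<phi> (at z) e) =
        - (LINT z:Q|lebesgue. v z * \<phi> z))"

definition weak_dt ::
  "(real \<times> (real ^ 'd)) set \<Rightarrow> (real \<times> (real ^ 'd) \<Rightarrow> real) \<Rightarrow> (real \<times> (real ^ 'd) \<Rightarrow> real) \<Rightarrow> bool" where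
  "weak_dt Q u ut \<longleftrightarrow> weak_derivative Q (1, 0) u ut"

definition weak_gradient ::
  "(real \<times> (real ^ 'd)) set \<Rightarrow> (real \<times> (real ^ 'd) \<Rightarrow> real) \<Rightarrow> (real \<times> (real ^ 'd) \<Rightarrow> real ^ 'd) \<Rightarrow> bool" where
  "weak_gradient Q u Du \<longleftrightarrow> (\<forall>i. weak_derivative Q (0, axis i 1) u (\<lambda>z. Du z $ i))"

definition W12 :: "real \<Rightarrow> real \<Rightarrow> (real \<times> (real ^ 'd)) set \<Rightarrow> (real \<times> (real ^ 'd) \<Rightarrow> real) set" where
  "W12 q p Q =
     {u. u \<in> mixed_L q p Q \<and>
         (\<exists>(ut :: real \<times> (real ^ 'd) \<Rightarrow> real)
           (Du :: real \<times> (real ^ 'd) \<Rightarrow> real ^ 'd)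
           (D2u :: real \<times> (real ^ 'd) \<Rightarrow> real ^ 'd ^ 'd).
            weak_dt Q u ut \<and> weak_gradient Q u Du \<and>
            (\<forall>i. weak_gradient Q (\<lambda>z. Du z $ i) (\<lambda>z. D2u z $ i)) \<and>
            ut \<in> mixed_L q p Q \<and> Du \<in> mixed_L q p Q \<and> D2u \<in> mixed_L q p Q)}"

text \<open>
  The curve approaches \<open>(t0, x0)\<close> from earlier times, as is appropriate for the
  (backward) operator \<open>\<partial>\<^sub>t + b \<bullet> D\<close>.
\<close>

definition parabolic_boundary ::
  "(real \<times> 'a::euclidean_space) set \<Rightarrow> (real \<times> 'a) set" where
  "parabolic_boundary Q =
     {(t0, x0). (t0, x0) \<in> frontier Q \<and>
        (\<exists>(x :: real \<Rightarrow> 'a) \<epsilon>. \<epsilon> > 0 \<and> continuous_on UNIV x \<and> x t0 = x0 \<and>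
           (\<forall>t\<in>{t0 - \<epsilon>..<t0}. (t, x t) \<in> Q))}"

end

theory Submission
  imports Defs "HOL-Real_Asymp.Real_Asymp"
begin

text \<open>
  If \<open>u\<close> is positive somewhere, there is a cylinder inside \<open>Q\<close> on whose top and side \<open>u\<close> is smaller by a
  fixed amount than at a point of its bottom. After mollification, consider the affine functions of
  \<open>x\<close> with slope at most \<open>\<delta>\<close> and values in the gap, and for each of them the last time at which \<open>u\<close>
  touches it. On the set \<open>\<Gamma>\<close> of the contact points, the map
  \<open>(t, x) \<mapsto> (u - Du \<bullet> (x - x0), Du)\<close> covers an interval times the ball of radius \<open>\<delta>\<close>, and its
  Jacobian is \<open>\<partial>\<^sub>tu det D\<^sup>2u\<close>, whence \<open>c \<delta>\<^sup>d \<le> \<integral>\<^sub>\<Gamma> \<bar>\<partial>\<^sub>tu\<bar> \<bar>D\<^sup>2u\<bar>\<^sup>d\<close>. On \<open>\<Gamma>\<close> one has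
  \<open>\<bar>\<partial>\<^sub>tu\<bar> \<le> \<delta> \<bar>b\<bar>\<close> up to a mollification error.

  The integral of \<open>\<bar>b\<bar> \<bar>D\<^sup>2u\<bar>\<^sup>d\<close> need not be finite, so \<open>\<bar>b\<bar>\<close> is cut at a level \<open>l(t)\<close>: the part below
  the level is absorbed by adding a function of \<open>t\<close> to \<open>u\<close>, and the level is chosen so that the part
  above it contributes \<open>\<delta>\<^sup>d l(t)\<close> at time \<open>t\<close>. Both costs are of order
  \<open>\<delta>\<^bsup>1 - q d / p0\<^esup>\<close> relative to the left-hand side, and \<open>p > q0 d\<close> says exactly that
  \<open>q d / p0 < 1\<close>; now let \<open>\<delta> \<rightarrow> 0\<close>. The mollification error is treated in the same way if \<open>p > q\<close>;
  if \<open>q \<ge> p\<close>, it is controlled because \<open>\<integral> \<bar>\<partial>\<^sub>tu\<bar> dt\<close> over \<open>\<Gamma>\<close> is at most the oscillation of \<open>u\<close> for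
  every fixed \<open>x\<close>.
\<close>

subsection \<open>Integral norms of \<open>[0, \<infinity>]\<close>-valued functions\<close>

text \<open>The obstacle is integrability in time. The hypotheses give \<open>q * d < p0\<close>, so
  1/q0 + d/q > 1 and Hoelder's inequality in \<open>t\<close> fails for the product of \<bar>b\<bar>
  and the d-th power of the Hessian, although at a fixed time it works in \<open>x\<close> because
  \<open>q \<le> p0\<close>. The level is l(t) = |b(t)| (|Hess u(t)| / \<delta>)^(q d / p0), with
  the \<open>p0\<close>-norm of b(t) and the \<open>p\<close>-norm of the Hessian in
  \<open>x\<close>. It lowers the power of the Hessian norm from d to q d / p0, which the
  \<open>q\<close>-norm in time can pay for, since \<open>q0\<close> and \<open>p0 / d\<close> are
  conjugate.

  The differential inequality is never mollified. It is used a.e. for \<open>u\<close> itself and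
  then compared with the mollified derivatives, so that no product of \<open>b\<close> with a
  gradient has to be regularised. The difference is an error that tends to 0 in the mixed norm of
  the time derivative. It enters with negative powers of \<delta>; hence \<delta> is fixed first and
  the mollification radius last.\<close>

lemma ennreal_powr_top [simp]: "ennreal_powr \<infinity> a = \<infinity>" "ennreal_powr top a = top"
  by (auto simp: ennreal_powr_def)

lemma ennreal_powr_ennreal: "0 \<le> x \<Longrightarrow> ennreal_powr (ennreal x) a = ennreal (x powr a)"
  by (simp add: ennreal_powr_def)

lemma ennreal_powr_0 [simp]: "ennreal_powr 0 a = 0"
  by (simp add: ennreal_powr_def)

lemma ennreal_powr_one [simp]: "ennreal_powr x 1 = x"
  by (cases x) (auto simp: ennreal_powr_ennreal)

lemma ennreal_one_powr [simp]: "ennreal_powr 1 a = 1"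
  using ennreal_powr_ennreal[of 1 a] by simp

lemma ennreal_powr_powr: "ennreal_powr (ennreal_powr x a) b = ennreal_powr x (a * b)"
  by (cases x) (auto simp: ennreal_powr_ennreal powr_powr)

lemma ennreal_powr_mult: "ennreal_powr (x * y) a = ennreal_powr x a * ennreal_powr y a"
proof (cases "x = \<infinity> \<or> y = \<infinity>")
  case True
  then show ?thesis
    by (cases x; cases y) (auto simp: ennreal_powr_ennreal ennreal_mult_top ennreal_top_mult)
next
  case False
  then show ?thesis
    by (cases x; cases y) (auto simp: ennreal_powr_ennreal ennreal_mult[symmetric] powr_mult)
qed

text \<open>Holds for exponents of any sign because 0 and \<infinity> are fixed points of
  \<open>ennreal_powr\<close> for every exponent, also for 0 and below.\<close>

lemma ennreal_powr_add: "ennreal_powr x (a + b) = ennreal_powr x a * ennreal_powr x b"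
  by (cases x) (auto simp: ennreal_powr_ennreal ennreal_mult[symmetric] powr_add)

lemma ennreal_powr_mono: "x \<le> y \<Longrightarrow> 0 \<le> a \<Longrightarrow> ennreal_powr x a \<le> ennreal_powr y a"
  by (cases x; cases y) (auto simp: ennreal_powr_ennreal top_unique intro!: ennreal_leI powr_mono2)

lemma ennreal_powr_le_iff: "0 < a \<Longrightarrow> ennreal_powr x a \<le> y \<longleftrightarrow> x \<le> ennreal_powr y (1 / a)"
  using ennreal_powr_mono[of x "ennreal_powr y (1 / a)" a] ennreal_powr_mono[of "ennreal_powr x a" y "1 / a"]
  by (auto simp: ennreal_powr_powr)

lemma ennreal_powr_SUP: "0 < a \<Longrightarrow> ennreal_powr (SUP i\<in>I. f i) a = (SUP i\<in>I. ennreal_powr (f i) a)"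
proof (rule antisym)
  assume a: "0 < a"
  have "(SUP i\<in>I. f i) \<le> ennreal_powr (SUP i\<in>I. ennreal_powr (f i) a) (1 / a)"
  proof (rule SUP_least)
    fix i assume "i \<in> I"
    then have "ennreal_powr (f i) a \<le> (SUP i\<in>I. ennreal_powr (f i) a)"
      by (rule SUP_upper)
    then show "f i \<le> ennreal_powr (SUP i\<in>I. ennreal_powr (f i) a) (1 / a)"
      using a by (rule ennreal_powr_le_iff[THEN iffD1, rotated])
  qed
  then show "ennreal_powr (SUP i\<in>I. f i) a \<le> (SUP i\<in>I. ennreal_powr (f i) a)"
    using a by (rule ennreal_powr_le_iff[THEN iffD2, rotated])
  show "(SUP i\<in>I. ennreal_powr (f i) a) \<le> ennreal_powr (SUP i\<in>I. f i) a"
    using a by (intro SUP_least ennreal_powr_mono SUP_upper) auto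
qed

lemma ennreal_powr_eq_0_iff [simp]: "ennreal_powr x a = 0 \<longleftrightarrow> x = 0"
  by (cases x) (auto simp: ennreal_powr_ennreal)

lemma ennreal_powr_eq_top_iff [simp]: "ennreal_powr x a = top \<longleftrightarrow> x = top"
  by (cases x) (auto simp: ennreal_powr_ennreal)

lemma ennreal_powr_less_top_iff [simp]: "ennreal_powr x a < top \<longleftrightarrow> x < top"
  by (simp add: less_top[symmetric])

lemma borel_measurable_ennreal_powr [measurable (raw)]:
  assumes [measurable]: "f \<in> borel_measurable M"
  shows "(\<lambda>x. ennreal_powr (f x) a) \<in> borel_measurable M"
  unfolding ennreal_powr_def by measurable

definition lp_norm :: "'a measure \<Rightarrow> real \<Rightarrow> ('a \<Rightarrow> ennreal) \<Rightarrow> ennreal" where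
  "lp_norm M p f = ennreal_powr (\<integral>\<^sup>+x. ennreal_powr (f x) p \<partial>M) (1 / p)"

lemma ennreal_powr_lp_norm: "p \<noteq> 0 \<Longrightarrow> ennreal_powr (lp_norm M p f) p = (\<integral>\<^sup>+x. ennreal_powr (f x) p \<partial>M)"
  by (simp add: lp_norm_def ennreal_powr_powr)

lemma lp_norm_one: "lp_norm M 1 f = (\<integral>\<^sup>+x. f x \<partial>M)"
  by (simp add: lp_norm_def)

lemma lp_norm_mono_AE: "0 < p \<Longrightarrow> AE x in M. f x \<le> g x \<Longrightarrow> lp_norm M p f \<le> lp_norm M p g"
  unfolding lp_norm_def
  by (intro ennreal_powr_mono nn_integral_mono_AE) (auto intro: ennreal_powr_mono elim!: eventually_mono)

lemma lp_norm_mono: "0 < p \<Longrightarrow> (\<And>x. f x \<le> g x) \<Longrightarrow> lp_norm M p f \<le> lp_norm M p g"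
  by (rule lp_norm_mono_AE) auto

lemma lp_norm_cong_AE: "AE x in M. f x = g x \<Longrightarrow> lp_norm M p f = lp_norm M p g"
  unfolding lp_norm_def by (intro arg_cong2[where f = ennreal_powr] nn_integral_cong_AE refl) auto

lemma lp_norm_cmult:
  assumes [measurable]: "f \<in> borel_measurable M" and "0 < p"
  shows "lp_norm M p (\<lambda>x. c * f x) = c * lp_norm M p f"
  using \<open>0 < p\<close> by (simp add: lp_norm_def ennreal_powr_mult nn_integral_cmult ennreal_powr_powr)

lemma lp_norm_powr: "0 < r \<Longrightarrow> 0 < p \<Longrightarrow> lp_norm M p (\<lambda>x. ennreal_powr (f x) r) = ennreal_powr (lp_norm M (p * r) f) r"
  by (simp add: lp_norm_def ennreal_powr_powr mult.commute)

lemma lp_norm_eq_0: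
  assumes [measurable]: "f \<in> borel_measurable M"
  shows "lp_norm M p f = 0 \<longleftrightarrow> (AE x in M. f x = 0)"
  by (simp add: lp_norm_def nn_integral_0_iff_AE)

text \<open>Young's inequality for x/A and y/B, multiplied by A B. With A and B the norms of two
  functions, integrating the right-hand side gives A B (1/p + 1/q), which is Hoelder's
  inequality.\<close>

lemma ennreal_Young:
  fixes x y :: ennreal
  assumes "1 < p" "1 < q" "1 / p + 1 / q = 1" "0 < A" "0 < B"
  shows "x * y \<le> ennreal (A * B / (p * A powr p)) * ennreal_powr x p + ennreal (A * B / (q * B powr q)) * ennreal_powr y q"
proof (cases "x = \<infinity> \<or> y = \<infinity>")
  case True
  then show ?thesis
    using assms by (auto simp: ennreal_mult_top ennreal_top_mult)
next
  case False
  then obtain a b where ab: "x = ennreal a" "0 \<le> a" "y = ennreal b" "0 \<le> b"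
    by (cases x; cases y) auto
  have "a / A * (b / B) \<le> (a / A) powr p / p + (b / B) powr q / q"
    using assms ab by (intro Youngs_inequality) auto
  then have "A * B * (a / A * (b / B)) \<le> A * B * ((a / A) powr p / p + (b / B) powr q / q)"
    using assms by (intro mult_left_mono) auto
  then have "a * b \<le> A * B / (p * A powr p) * a powr p + A * B / (q * B powr q) * b powr q"
    using assms ab by (simp add: powr_divide algebra_simps)
  then show ?thesis
    using assms ab by (simp add: ennreal_powr_ennreal flip: ennreal_mult ennreal_plus)
qed

lemma nn_integral_Holder:
  assumes [measurable]: "f \<in> borel_measurable M" "g \<in> borel_measurable M"
    and pq: "1 < p" "1 < q" "1 / p + 1 / q = 1"
  shows "(\<integral>\<^sup>+x. f x * g x \<partial>M) \<le> lp_norm M p f * lp_norm M q g"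
proof (cases "lp_norm M p f = 0 \<or> lp_norm M q g = 0")
  case True
  then have "AE x in M. f x * g x = 0"
    by (auto simp: lp_norm_eq_0)
  then have "(\<integral>\<^sup>+x. f x * g x \<partial>M) = 0"
    by (simp add: nn_integral_0_iff_AE)
  then show ?thesis by simp
next
  case nz: False
  show ?thesis
  proof (cases "lp_norm M p f = \<infinity> \<or> lp_norm M q g = \<infinity>")
    case True
    then show ?thesis using nz by (auto simp: ennreal_mult_top ennreal_top_mult)
  next
    case False
    then obtain A B where AB: "lp_norm M p f = ennreal A" "0 \<le> A" "lp_norm M q g = ennreal B" "0 \<le> B"
      by (cases "lp_norm M p f"; cases "lp_norm M q g") auto
    then have AB0: "0 < A" "0 < B" using nz by (auto simp: less_le)
    have fp: "(\<integral>\<^sup>+x. ennreal_powr (f x) p \<partial>M) = ennreal (A powr p)"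
      using ennreal_powr_lp_norm[of p M f] AB pq by (simp add: ennreal_powr_ennreal)
    have gq: "(\<integral>\<^sup>+x. ennreal_powr (g x) q \<partial>M) = ennreal (B powr q)"
      using ennreal_powr_lp_norm[of q M g] AB pq by (simp add: ennreal_powr_ennreal)
    have "(\<integral>\<^sup>+x. f x * g x \<partial>M) \<le> (\<integral>\<^sup>+x. ennreal (A * B / (p * A powr p)) * ennreal_powr (f x) p +
        ennreal (A * B / (q * B powr q)) * ennreal_powr (g x) q \<partial>M)"
      by (intro nn_integral_mono ennreal_Young pq AB0)
    also have "\<dots> = ennreal (A * B / (p * A powr p)) * ennreal (A powr p) + ennreal (A * B / (q * B powr q)) * ennreal (B powr q)"
      by (simp add: nn_integral_add nn_integral_cmult fp gq)
    also have "\<dots> = ennreal (A * B / p + A * B / q)"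
      using AB0 pq by (simp flip: ennreal_mult ennreal_plus)
    also have "A * B / p + A * B / q = A * B"
      using pq(3) by (metis distrib_left mult.right_neutral times_divide_eq_right)
    also have "ennreal (A * B) = lp_norm M p f * lp_norm M q g"
      using AB by (simp add: ennreal_mult)
    finally show ?thesis .
  qed
qed

text \<open>The power of \<open>J\<close> on the right is cancelled, which is legitimate because
  \<open>J\<close> is finite. This ends the duality proof of Minkowski's inequality below.\<close>

lemma le_of_le_mult_powr:
  assumes "J \<le> A * ennreal_powr J (1 - 1 / r)" "J < \<infinity>" "0 < r"
  shows "ennreal_powr J (1 / r) \<le> A"
proof (cases "J = 0")
  case False
  have "ennreal_powr J (1 / r) * ennreal_powr J (1 - 1 / r) = J"
    by (simp flip: ennreal_powr_add)
  then have "ennreal_powr J (1 / r) * ennreal_powr J (1 - 1 / r) \<le> A * ennreal_powr J (1 - 1 / r)"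
    using assms(1) by simp
  then show ?thesis
    using False assms(2)
    by (metis ennreal_mult_le_mult_iff ennreal_powr_eq_0_iff ennreal_powr_eq_top_iff infinity_ennreal_def less_irrefl mult.commute)
qed simp

lemma lp_norm_SUP:
  assumes [measurable]: "\<And>n. f n \<in> borel_measurable M" and "incseq f" "0 < p"
  shows "lp_norm M p (\<lambda>x. SUP n::nat. f n x) = (SUP n. lp_norm M p (f n))"
proof -
  have "(\<integral>\<^sup>+x. ennreal_powr (SUP n. f n x) p \<partial>M) = (\<integral>\<^sup>+x. (SUP n. ennreal_powr (f n x) p) \<partial>M)"
    using \<open>0 < p\<close> by (simp add: ennreal_powr_SUP)
  also have "\<dots> = (SUP n. \<integral>\<^sup>+x. ennreal_powr (f n x) p \<partial>M)"
    using assms by (intro nn_integral_monotone_convergence_SUP)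
      (auto simp: incseq_def le_fun_def intro!: ennreal_powr_mono)
  finally show ?thesis
    using \<open>0 < p\<close> by (simp add: lp_norm_def ennreal_powr_SUP)
qed

lemma borel_measurable_lp_norm [measurable (raw)]:
  assumes "sigma_finite_measure N" and [measurable]: "case_prod F \<in> borel_measurable (M \<Otimes>\<^sub>M N)"
  shows "(\<lambda>x. lp_norm N p (F x)) \<in> borel_measurable M"
proof -
  interpret sigma_finite_measure N by fact
  show ?thesis unfolding lp_norm_def by measurable
qed

text \<open>With S(y) the inner integral, one writes S^r = S S^(r-1), exchanges the integrals and
  applies Hoelder's inequality for fixed x. The power of the integral of S^r that appears on the
  right can be cancelled only if it is finite, so S is replaced by truncations \<open>T n\<close>,
  bounded by n and supported on sets of finite measure, that increase to S.\<close>

lemma Minkowski_integral: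
  fixes M :: "'a measure" and N :: "'b measure"
  assumes M: "sigma_finite_measure M" and N: "sigma_finite_measure N"
    and F[measurable]: "case_prod F \<in> borel_measurable (M \<Otimes>\<^sub>M N)" and r: "1 \<le> r"
  shows "lp_norm N r (\<lambda>y. \<integral>\<^sup>+x. F x y \<partial>M) \<le> (\<integral>\<^sup>+x. lp_norm N r (F x) \<partial>M)"
proof -
  interpret M: sigma_finite_measure M by fact
  interpret N: sigma_finite_measure N by fact
  interpret P: pair_sigma_finite M N by standard
  show ?thesis
  proof (cases "r = 1")
    case True
    then show ?thesis
      using P.Fubini'[OF F] by (simp add: lp_norm_one)
  next
    case False
    with r have r: "1 < r" by simp
    define r' where "r' = r / (r - 1)"
    have r': "1 < r'" "1 / r + 1 / r' = 1" "(r - 1) * r' = r" "1 / r' = 1 - 1 / r"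
      using r by (auto simp: r'_def field_simps)
    define S where "S y = (\<integral>\<^sup>+x. F x y \<partial>M)" for y
    have S[measurable]: "S \<in> borel_measurable N"
      unfolding S_def by measurable
    obtain Y :: "nat \<Rightarrow> 'b set" where Y: "range Y \<subseteq> sets N" "(\<Union>i. Y i) = space N"
      "\<And>i. emeasure N (Y i) \<noteq> \<infinity>" "incseq Y"
      by (rule N.sigma_finite_incseq) (rule that)
    then have Y'[measurable]: "Y n \<in> sets N" for n by (metis range_subsetD)
    define T where "T n y = min (S y) (of_nat n) * indicator (Y n) y" for n y
    have T[measurable]: "T n \<in> borel_measurable N" for n
      unfolding T_def by measurable
    have incT: "incseq T"
    proof (intro incseq_SucI le_funI)
      fix n y
      have "min (S y) (of_nat n) \<le> min (S y) (of_nat (Suc n))"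
        by (rule min.mono[OF order.refl of_nat_mono]) simp
      moreover have "indicator (Y n) y \<le> (indicator (Y (Suc n)) y :: ennreal)"
        using incseq_SucD[OF \<open>incseq Y\<close>] by (auto simp: indicator_def)
      ultimately show "T n y \<le> T (Suc n) y"
        unfolding T_def by (rule mult_mono) auto
    qed
    have supT: "(SUP n. T n y) = S y" if y: "y \<in> space N" for y
    proof (rule antisym)
      show "(SUP n. T n y) \<le> S y"
        by (rule SUP_least) (auto simp: T_def indicator_def)
      obtain m where m: "y \<in> Y m" using y Y(2) by blast
      have Tm: "T (max m n) y = min (S y) (of_nat (max m n))" for n
        using m incseqD[OF \<open>incseq Y\<close>, of m "max m n"] by (auto simp: T_def indicator_def)
      have *: "min (S y) (of_nat n) \<le> (SUP n. T n y)" for n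
      proof -
        have "min (S y) (of_nat n) \<le> min (S y) (of_nat (max m n))"
          by (rule min.mono[OF order.refl of_nat_mono]) simp
        also have "\<dots> = T (max m n) y" by (rule Tm[symmetric])
        also have "\<dots> \<le> (SUP n. T n y)" by (rule SUP_upper) simp
        finally show ?thesis .
      qed
      have "S y = (SUP n. min (S y) (of_nat n))"
        using inf_SUP[of "S y" "of_nat :: nat \<Rightarrow> ennreal" UNIV]
        unfolding ennreal_SUP_of_nat_eq_top inf_top_right by (simp add: inf_min)
      also have "\<dots> \<le> (SUP n. T n y)"
        using * by (intro SUP_least)
      finally show "S y \<le> (SUP n. T n y)" .
    qed
    define A where "A = (\<integral>\<^sup>+x. lp_norm N r (F x) \<partial>M)"
    have "lp_norm N r (T n) \<le> A" for n
    proof -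
      define J where "J = (\<integral>\<^sup>+y. ennreal_powr (T n y) r \<partial>N)"
      have "J \<le> (\<integral>\<^sup>+y. ennreal_powr (of_nat n) r * indicator (Y n) y \<partial>N)"
        unfolding J_def using r
        by (intro nn_integral_mono) (auto simp: T_def indicator_def intro!: ennreal_powr_mono)
      also have "\<dots> = ennreal_powr (of_nat n) r * emeasure N (Y n)"
        by (rule nn_integral_cmult_indicator) (rule Y')
      also have "\<dots> < \<infinity>"
        using Y(3)[of n] of_nat_less_top[of n] by (simp add: ennreal_mult_eq_top_iff less_top[symmetric])
      finally have J: "J < \<infinity>" .
      have "J = (\<integral>\<^sup>+y. T n y * ennreal_powr (T n y) (r - 1) \<partial>N)"
        unfolding J_def by (intro nn_integral_cong) (use ennreal_powr_add[of _ 1 "r - 1"] in simp)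
      \<comment> \<open>Only one factor is enlarged to \<open>S\<close>, the one that is an integral
        over x; the power r - 1 keeps the truncation, so that the finite \<open>J\<close> comes back
        after Hoelder's inequality.\<close>
      also have "\<dots> \<le> (\<integral>\<^sup>+y. S y * ennreal_powr (T n y) (r - 1) \<partial>N)"
        by (intro nn_integral_mono mult_right_mono) (auto simp: T_def indicator_def)
      also have "\<dots> = (\<integral>\<^sup>+y. (\<integral>\<^sup>+x. F x y * ennreal_powr (T n y) (r - 1) \<partial>M) \<partial>N)"
        by (intro nn_integral_cong) (simp add: S_def nn_integral_multc)
      also have "\<dots> = (\<integral>\<^sup>+x. (\<integral>\<^sup>+y. F x y * ennreal_powr (T n y) (r - 1) \<partial>N) \<partial>M)"
        by (intro P.Fubini') measurable
      also have "\<dots> \<le> (\<integral>\<^sup>+x. lp_norm N r (F x) * lp_norm N r' (\<lambda>y. ennreal_powr (T n y) (r - 1)) \<partial>M)"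
        using r r' by (intro nn_integral_mono nn_integral_Holder) auto
      also have "\<dots> = A * lp_norm N r' (\<lambda>y. ennreal_powr (T n y) (r - 1))"
        by (simp add: A_def nn_integral_multc N.sigma_finite_measure_axioms)
      also have "lp_norm N r' (\<lambda>y. ennreal_powr (T n y) (r - 1)) = ennreal_powr J (1 - 1 / r)"
        unfolding lp_norm_def J_def by (simp add: ennreal_powr_powr r')
      finally have "ennreal_powr J (1 / r) \<le> A"
        using J r by (intro le_of_le_mult_powr) auto
      then show ?thesis by (simp add: lp_norm_def J_def)
    qed
    then have "(SUP n. lp_norm N r (T n)) \<le> A"
      by (intro SUP_least)
    then have "lp_norm N r (\<lambda>y. SUP n. T n y) \<le> A"
      using r incT by (subst lp_norm_SUP) auto
    also have "lp_norm N r (\<lambda>y. SUP n. T n y) = lp_norm N r S"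
      by (rule lp_norm_cong_AE) (simp add: supT)
    finally show ?thesis unfolding A_def S_def[abs_def] .
  qed
qed

text \<open>Minkowski's integral inequality over the counting measure of a two-point space.\<close>

lemma lp_norm_add_le:
  assumes N: "sigma_finite_measure N" and [measurable]: "f \<in> borel_measurable N" "g \<in> borel_measurable N"
    and r: "1 \<le> r"
  shows "lp_norm N r (\<lambda>y. f y + g y) \<le> lp_norm N r f + lp_norm N r g"
proof -
  define F where "F b = (if b then f else g)" for b
  have "case_prod F \<in> borel_measurable (count_space UNIV \<Otimes>\<^sub>M N)"
    by (rule measurable_pair_measure_countable1) (auto simp: F_def)
  then have "lp_norm N r (\<lambda>y. \<integral>\<^sup>+x. F x y \<partial>count_space UNIV) \<le> (\<integral>\<^sup>+x. lp_norm N r (F x) \<partial>count_space UNIV)"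
    using N r by (intro Minkowski_integral) (auto intro: sigma_finite_measure_count_space_finite)
  then show ?thesis
    by (simp add: nn_integral_count_space_finite UNIV_bool F_def add.commute)
qed

text \<open>Minkowski's integral inequality with exponent q/p, applied to the p-th power of
  \<open>F\<close>. It serves to bring time to the outermost position when the norm of the theorem
  has space there.\<close>

lemma lp_norm_Minkowski_swap:
  assumes M: "sigma_finite_measure M" and N: "sigma_finite_measure N"
    and F[measurable]: "case_prod F \<in> borel_measurable (M \<Otimes>\<^sub>M N)" and pq: "0 < p" "p \<le> q"
  shows "lp_norm N q (\<lambda>y. lp_norm M p (\<lambda>x. F x y)) \<le> lp_norm M p (\<lambda>x. lp_norm N q (\<lambda>y. F x y))"
proof -
  define G where "G x y = ennreal_powr (F x y) p" for x y
  have [measurable]: "case_prod G \<in> borel_measurable (M \<Otimes>\<^sub>M N)"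
    unfolding G_def by measurable
  have *: "ennreal_powr (lp_norm N (q / p) h) (1 / p) = lp_norm N q (\<lambda>y. ennreal_powr (h y) (1 / p))" for h
    using pq by (simp add: lp_norm_def ennreal_powr_powr)
  have **: "lp_norm N (q / p) (G x) = ennreal_powr (lp_norm N q (F x)) p" for x
    using pq by (simp add: lp_norm_def G_def ennreal_powr_powr)
  have "lp_norm N (q / p) (\<lambda>y. \<integral>\<^sup>+x. G x y \<partial>M) \<le> (\<integral>\<^sup>+x. lp_norm N (q / p) (G x) \<partial>M)"
    using M N pq by (intro Minkowski_integral) auto
  then have "ennreal_powr (lp_norm N (q / p) (\<lambda>y. \<integral>\<^sup>+x. G x y \<partial>M)) (1 / p) \<le>
     ennreal_powr (\<integral>\<^sup>+x. lp_norm N (q / p) (G x) \<partial>M) (1 / p)"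
    using pq by (intro ennreal_powr_mono) auto
  then show ?thesis
    unfolding * ** by (simp add: lp_norm_def[of M] G_def)
qed

subsection \<open>The Jacobian of the contact map\<close>

text \<open>
  The change of variables inequality of HOL-Analysis is available for \<open>real ^ 'n\<close> only, hence space-time
  \<open>real \<times> real ^ 'd\<close> is flattened over an index type with one more element. It is carved out of
  \<open>nat\<close> because the inequality asks for a well-ordered index type.
\<close>

typedef (overloaded) 'd ext = "{..CARD('d)} :: nat set" by auto

setup_lifting type_definition_ext

instantiation ext :: (type) wellorder
begin
lift_definition less_eq_ext :: "'a ext \<Rightarrow> 'a ext \<Rightarrow> bool" is "(\<le>)" .
lift_definition less_ext :: "'a ext \<Rightarrow> 'a ext \<Rightarrow> bool" is "(<)" .
instance
proof
  fix P and a :: "'a ext"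
  assume *: "\<And>x :: 'a ext. (\<And>y. y < x \<Longrightarrow> P y) \<Longrightarrow> P x"
  show "P a"
  proof (induction "Rep_ext a" arbitrary: a rule: less_induct)
    case less
    then show ?case using * by (metis less_ext.rep_eq)
  qed
qed (transfer; force)+
end

lemma UNIV_ext: "(UNIV :: 'a ext set) = Abs_ext ` {..CARD('a)}"
  using type_definition.Abs_image[OF type_definition_ext] by metis

instance ext :: (type) finite
  by standard (simp add: UNIV_ext)

lemma card_ext: "CARD('d ext) = CARD('d) + 1"
  using type_definition.card[OF type_definition_ext] by simp

lemma ext_option_bij: "\<exists>e :: 'd::finite option \<Rightarrow> 'd ext. bij e"
  using card_ext[where 'd='d] by (intro finite_same_card_bij) (auto simp: card_UNIV_option)

text \<open>\<open>None\<close> marks the time coordinate and \<open>Some i\<close> the i-th space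
  coordinate. What matters is bijectivity, hence the unspecified choice.\<close>

definition ext_index :: "'d::finite option \<Rightarrow> 'd ext" where
  "ext_index = (SOME e. bij e)"

lemma bij_ext_index: "bij (ext_index :: 'd::finite option \<Rightarrow> 'd ext)"
  unfolding ext_index_def using ext_option_bij by (rule someI_ex)

lemma ext_index_eq_iff [simp]: "ext_index a = ext_index b \<longleftrightarrow> a = b"
  using bij_ext_index by (auto simp: bij_def inj_def)

definition unflatten :: "real ^ 'd ext \<Rightarrow> real \<times> (real ^ 'd)" where
  "unflatten v = (v $ ext_index None, \<chi> i. v $ ext_index (Some i))"

definition flatten :: "real \<times> (real ^ 'd) \<Rightarrow> real ^ 'd ext" where
  "flatten z = (\<chi> k. case inv ext_index k of None \<Rightarrow> fst z | Some i \<Rightarrow> snd z $ i)"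

lemma flatten_nth [simp]:
  "flatten z $ ext_index None = fst z" "flatten z $ ext_index (Some i) = snd z $ i"
  by (auto simp: flatten_def inv_f_f[OF bij_is_inj[OF bij_ext_index]])

lemma unflatten_flatten [simp]: "unflatten (flatten z) = z"
  by (simp add: unflatten_def)

lemma ext_cases: obtains "k = ext_index None" | i where "k = ext_index (Some i)"
  using bij_ext_index by (metis bij_iff option.exhaust)

lemma linear_flatten: "linear flatten"
proof (rule linearI)
  fix x y :: "real \<times> (real ^ 'd)" and c :: real
  have "flatten (x + y) $ k = (flatten x + flatten y) $ k" for k
    by (cases k rule: ext_cases) auto
  moreover have "flatten (c *\<^sub>R x) $ k = (c *\<^sub>R flatten x) $ k" for k
    by (cases k rule: ext_cases) auto
  ultimately show "flatten (x + y) = flatten x + flatten y" "flatten (c *\<^sub>R x) = c *\<^sub>R flatten x"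
    by (auto simp: vec_eq_iff)
qed

lemma linear_unflatten: "linear unflatten"
  by (rule linearI) (auto simp: unflatten_def vec_eq_iff)

lemma bounded_linear_flatten: "bounded_linear flatten"
  using linear_flatten by (rule linear_conv_bounded_linear[THEN iffD1])

lemma bounded_linear_unflatten: "bounded_linear unflatten"
  using linear_unflatten by (rule linear_conv_bounded_linear[THEN iffD1])

lemma prod_Basis_cart: "(\<Prod>b\<in>Basis. (x :: real ^ 'n) \<bullet> b) = (\<Prod>i\<in>UNIV. x $ i)"
proof -
  have B: "(Basis :: (real ^ 'n) set) = (\<lambda>i. axis i 1) ` UNIV"
    by (auto simp: Basis_vec_def)
  have "inj (\<lambda>i::'n. axis i (1::real))"
    by (auto simp: inj_def axis_eq_axis)
  then show ?thesis
    unfolding B by (subst prod.reindex) (auto simp: inner_axis)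
qed

lemma prod_ext: "(\<Prod>k\<in>UNIV. f (k :: 'd::finite ext)) = f (ext_index None) * (\<Prod>i\<in>UNIV. f (ext_index (Some i)))"
proof -
  have "(\<Prod>k\<in>UNIV. f (k :: 'd ext)) = (\<Prod>a\<in>UNIV. f (ext_index a))"
    using bij_ext_index by (intro prod.reindex_bij_betw[symmetric])
  also have "\<dots> = f (ext_index None) * (\<Prod>i\<in>UNIV. f (ext_index (Some i)))"
    unfolding UNIV_option_conv by (subst prod.insert) (auto simp: prod.reindex)
  finally show ?thesis .
qed

text \<open>Flattening relabels coordinates, so the preimage of a box is a box with the same side
  lengths, and Lebesgue measure is determined by its values on boxes.\<close>

lemma distr_flatten: "distr lborel borel flatten = (lborel :: (real ^ 'd::finite ext) measure)"
proof (rule lborel_eqI[symmetric])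
  fix l u :: "real ^ 'd ext"
  assume le: "\<And>b. b \<in> Basis \<Longrightarrow> l \<bullet> b \<le> u \<bullet> b"
  have le': "l $ k \<le> u $ k" for k
    using le[of "axis k 1"] by (simp add: inner_axis axis_in_Basis_iff)
  have [measurable]: "flatten \<in> borel_measurable (borel :: (real \<times> (real ^ 'd)) measure)"
    using bounded_linear_flatten by (intro borel_measurable_continuous_onI linear_continuous_on)
  have "flatten -` box l u = box (fst (unflatten l)) (fst (unflatten u)) \<times>
      box (snd (unflatten l)) (snd (unflatten u))"
  proof -
    have "(\<forall>k. l $ k < flatten z $ k \<and> flatten z $ k < u $ k) \<longleftrightarrow>
       (l $ ext_index None < fst z \<and> fst z < u $ ext_index None) \<and>
       (\<forall>i. l $ ext_index (Some i) < snd z $ i \<and> snd z $ i < u $ ext_index (Some i))" for z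
      by (metis ext_cases flatten_nth)
    then show ?thesis
      by (auto simp: mem_box_cart unflatten_def)
  qed
  then have "emeasure (distr lborel borel flatten) (box l u) =
     emeasure (lborel \<Otimes>\<^sub>M lborel) (box (fst (unflatten l)) (fst (unflatten u)) \<times>
      box (snd (unflatten l)) (snd (unflatten u)))"
    by (subst emeasure_distr) (auto simp: lborel_prod)
  also have "\<dots> = emeasure lborel (box (fst (unflatten l)) (fst (unflatten u))) *
     emeasure lborel (box (snd (unflatten l)) (snd (unflatten u)))"
    by (intro lborel.emeasure_pair_measure_Times) auto
  also have "\<dots> = ennreal (u $ ext_index None - l $ ext_index None) *
     ennreal (\<Prod>i\<in>UNIV. u $ ext_index (Some i) - l $ ext_index (Some i))"
  proof -
    have "emeasure lborel (box (snd (unflatten l)) (snd (unflatten u))) =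
        ennreal (\<Prod>b\<in>Basis. (snd (unflatten u) - snd (unflatten l)) \<bullet> b)"
      using le' by (intro emeasure_lborel_box) (auto simp: unflatten_def Basis_vec_def inner_axis)
    then show ?thesis
      using le' by (simp add: unflatten_def prod_Basis_cart)
  qed
  also have "\<dots> = ennreal (\<Prod>b\<in>Basis. (u - l) \<bullet> b)"
    unfolding prod_Basis_cart prod_ext
    using le' by (subst ennreal_mult[symmetric]) (auto intro!: prod_nonneg)
  finally show "emeasure (distr lborel borel flatten) (box l u) = ennreal (\<Prod>b\<in>Basis. (u - l) \<bullet> b)" .
qed simp

lemma emeasure_flatten_image:
  fixes S :: "(real \<times> (real ^ 'd)) set"
  assumes "compact S"
  shows "emeasure lborel (flatten ` S) = emeasure lborel S"
proof -
  have [measurable]: "flatten \<in> borel_measurable (borel :: (real \<times> (real ^ 'd)) measure)"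
    using bounded_linear_flatten by (intro borel_measurable_continuous_onI linear_continuous_on)
  have "compact (flatten ` S)"
    using assms bounded_linear_flatten by (intro compact_continuous_image linear_continuous_on)
  then have [measurable]: "flatten ` S \<in> sets borel" by (rule borel_compact)
  have "emeasure lborel (flatten ` S) = emeasure lborel (flatten -` flatten ` S)"
    by (subst distr_flatten[symmetric], subst emeasure_distr) auto
  also have "flatten -` flatten ` S = S"
    by (metis inj_vimage_image_eq inj_on_inverseI unflatten_flatten)
  finally show ?thesis .
qed

lemma borel_measurable_ennreal_indicator:
  fixes f :: "'a::topological_space \<Rightarrow> real"
  assumes "S \<in> sets borel" "continuous_on S f"
  shows "(\<lambda>x. ennreal (f x) * indicator S x) \<in> borel_measurable borel"
proof -
  have "(\<lambda>x. ennreal (f x)) \<in> borel_measurable (restrict_space borel S)"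
    using borel_measurable_continuous_on_restrict[OF assms(2)] by measurable
  then show ?thesis
    using assms(1) by (subst (asm) borel_measurable_restrict_space_iff_ennreal) auto
qed

text \<open>In the permutation expansion, every permutation that moves the time index picks a zero
  of the time row. Each remaining term is the corner times d entries of the spatial block. The time
  column below the corner is arbitrary, and counting all permutations gives the factorial.\<close>

lemma abs_det_ext_le:
  fixes A :: "real ^ ('d::finite ext) ^ ('d ext)"
  assumes corner: "A $ ext_index None $ ext_index None = a"
    and row0: "\<And>k. k \<noteq> ext_index None \<Longrightarrow> A $ ext_index None $ k = 0"
    and entries: "\<And>i j. \<bar>A $ ext_index (Some i) $ ext_index (Some j)\<bar> \<le> B"
  shows "\<bar>det A\<bar> \<le> fact (CARD('d) + 1) * (\<bar>a\<bar> * B ^ CARD('d))"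
proof -
  have B: "0 \<le> B"
    using entries by (meson abs_ge_zero order_trans)
  have *: "\<bar>of_int (sign p) * (\<Prod>k\<in>UNIV. A $ k $ p k)\<bar> \<le> \<bar>a\<bar> * B ^ CARD('d)"
    if p: "p permutes UNIV" for p
  proof (cases "p (ext_index None) = ext_index None")
    case True
    have "\<bar>A $ ext_index (Some i) $ p (ext_index (Some i))\<bar> \<le> B" for i
    proof (cases "p (ext_index (Some i))" rule: ext_cases)
      case 1
      then have "ext_index (Some i) = ext_index None"
        using True permutes_inj[OF p] by (metis injD)
      then show ?thesis by simp
    next
      case (2 j)
      then show ?thesis using entries by simp
    qed
    then have "(\<Prod>i\<in>UNIV. \<bar>A $ ext_index (Some i) $ p (ext_index (Some i))\<bar>) \<le> (\<Prod>i\<in>(UNIV::'d set). B)"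
      by (intro prod_mono) auto
    then show ?thesis
      unfolding prod_ext using True corner
      by (simp add: abs_mult abs_prod mult_left_mono sign_def)
  next
    case False
    then show ?thesis
      unfolding prod_ext using row0 B by simp
  qed
  have "\<bar>det A\<bar> \<le> (\<Sum>p | p permutes UNIV. \<bar>of_int (sign p) * (\<Prod>k\<in>UNIV. A $ k $ p k)\<bar>)"
    unfolding det_def by (rule sum_abs)
  also have "\<dots> \<le> (\<Sum>p | p permutes (UNIV :: 'd ext set). \<bar>a\<bar> * B ^ CARD('d))"
    using * by (intro sum_mono) auto
  also have "\<dots> = fact (CARD('d) + 1) * (\<bar>a\<bar> * B ^ CARD('d))"
    using card_permutations[OF refl, of "UNIV :: 'd ext set"] by (simp add: card_ext algebra_simps)
  finally show ?thesis .
qed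

text \<open>Adding a combination of the other rows to the time row leaves the determinant unchanged
  and clears that row up to its corner. For the contact map this is why the uncontrolled time
  derivative of the gradient does not enter the bound.\<close>

lemma abs_det_sheared_le:
  fixes A :: "real ^ ('d::finite ext) ^ ('d ext)" and c :: "real ^ 'd"
  assumes row0: "row (ext_index None) A =
      a *\<^sub>R axis (ext_index None) 1 - (\<Sum>i\<in>UNIV. c $ i *\<^sub>R row (ext_index (Some i)) A)"
    and entries: "\<And>i j. \<bar>A $ ext_index (Some i) $ ext_index (Some j)\<bar> \<le> B"
  shows "\<bar>det A\<bar> \<le> fact (CARD('d) + 1) * (\<bar>a\<bar> * B ^ CARD('d))"
proof -
  define x where "x = (\<Sum>i\<in>UNIV. c $ i *\<^sub>R row (ext_index (Some i)) A)"
  define A' where "A' = (\<chi> k. if k = ext_index None then row (ext_index None) A + x else row k A)"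
  have "x \<in> vec.span {row j A |j. j \<noteq> ext_index None}"
    unfolding x_def scalar_mult_eq_scaleR[symmetric]
    by (intro vec.span_sum vec.span_scale vec.span_base) auto
  from det_row_span[OF this] have "det A = det A'"
    by (simp add: A'_def)
  moreover have "\<bar>det A'\<bar> \<le> fact (CARD('d) + 1) * (\<bar>a\<bar> * B ^ CARD('d))"
  proof (rule abs_det_ext_le)
    have A'0: "A' $ ext_index None = a *\<^sub>R axis (ext_index None) 1"
      unfolding A'_def x_def row0 by simp
    show "A' $ ext_index None $ ext_index None = a"
      unfolding A'0 by simp
    show "A' $ ext_index None $ k = 0" if "k \<noteq> ext_index None" for k
      unfolding A'0 using that by (simp add: axis_def)
    show "\<bar>A' $ ext_index (Some i) $ ext_index (Some j)\<bar> \<le> B" for i j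
      using entries by (simp add: A'_def row_def)
  qed
  ultimately show ?thesis by simp
qed

text \<open>The measure of a differentiable image is at most the integral of the absolute Jacobian;
  both sides are carried through \<open>flatten\<close>, which preserves measure. Compactness of
  \<open>S\<close> makes all the images Borel.\<close>

lemma emeasure_sheared_image_le:
  fixes S :: "(real \<times> (real ^ 'd)) set" and w :: "real \<times> (real ^ 'd) \<Rightarrow> real"
    and G :: "real \<times> (real ^ 'd) \<Rightarrow> real ^ 'd"
  assumes S: "compact S"
    and dw: "\<And>z. z \<in> S \<Longrightarrow> (w has_derivative w' z) (at z within S)"
    and dG: "\<And>z. z \<in> S \<Longrightarrow> (G has_derivative G' z) (at z within S)"
    and shear: "\<And>z v. z \<in> S \<Longrightarrow> w' z v = a z * fst v - c z \<bullet> G' z v"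
    and entries: "\<And>z i j. z \<in> S \<Longrightarrow> \<bar>G' z (0, axis j 1) $ i\<bar> \<le> H z"
    and cont: "continuous_on S a" "continuous_on S H"
  shows "emeasure lborel ((\<lambda>z. (w z, G z)) ` S) \<le>
    (\<integral>\<^sup>+z\<in>S. ennreal (fact (CARD('d) + 1) * (\<bar>a z\<bar> * H z ^ CARD('d))) \<partial>lborel)"
proof -
  define K where "K z = fact (CARD('d) + 1) * (\<bar>a z\<bar> * H z ^ CARD('d))" for z
  have contK: "continuous_on S K"
    unfolding K_def by (intro continuous_intros cont)
  have H0: "0 \<le> H z" if "z \<in> S" for z
    using entries[OF that] by (meson abs_ge_zero order_trans)
  then have K0: "0 \<le> K z" if "z \<in> S" for z
    using that by (auto simp: K_def)
  define \<Phi> where "\<Phi> z = (w z, G z)" for z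
  define \<Phi>' where "\<Phi>' z v = (w' z v, G' z v)" for z v
  have d\<Phi>: "(\<Phi> has_derivative \<Phi>' z) (at z within S)" if "z \<in> S" for z
    unfolding \<Phi>_def \<Phi>'_def using dw[OF that] dG[OF that] by (rule has_derivative_Pair)
  have contflat: "continuous_on X flatten" for X :: "(real \<times> (real ^ 'd)) set"
    using bounded_linear_flatten by (rule linear_continuous_on)
  have contunflat: "continuous_on X unflatten" for X :: "(real ^ 'd ext) set"
    using bounded_linear_unflatten by (rule linear_continuous_on)
  define S' where "S' = flatten ` S"
  have S': "compact S'"
    unfolding S'_def using S contflat by (rule compact_continuous_image[rotated])
  then have S'leb: "S' \<in> sets lebesgue"
    using lmeasurable_compact by blast
  have unf: "unflatten y \<in> S" if "y \<in> S'" for y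
    using that by (auto simp: S'_def)
  have unfS: "unflatten ` S' = S"
    by (auto simp: S'_def image_image)
  define f where "f = flatten \<circ> \<Phi> \<circ> unflatten"
  define f' where "f' y = flatten \<circ> \<Phi>' (unflatten y) \<circ> unflatten" for y
  have df: "(f has_derivative f' y) (at y within S')" if y: "y \<in> S'" for y
  proof -
    have "(unflatten has_derivative unflatten) (at y within S')"
      using bounded_linear_unflatten by (rule bounded_linear_imp_has_derivative)
    moreover have "(\<Phi> has_derivative \<Phi>' (unflatten y)) (at (unflatten y) within unflatten ` S')"
      unfolding unfS using d\<Phi> unf[OF y] by blast
    ultimately have "(\<Phi> \<circ> unflatten has_derivative \<Phi>' (unflatten y) \<circ> unflatten) (at y within S')"
      by (rule diff_chain_within)
    moreover have "(flatten has_derivative flatten) (at ((\<Phi> \<circ> unflatten) y) within (\<Phi> \<circ> unflatten) ` S')"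
      using bounded_linear_flatten by (rule bounded_linear_imp_has_derivative)
    ultimately show ?thesis
      unfolding f_def f'_def using diff_chain_within[of "\<Phi> \<circ> unflatten" _ y S' flatten flatten]
      by (metis comp_assoc)
  qed
  have det: "\<bar>det (matrix (f' y))\<bar> \<le> K (unflatten y)" if y: "y \<in> S'" for y
  proof -
    define z where "z = unflatten y"
    have z: "z \<in> S" using unf[OF y] by (simp add: z_def)
    have unax: "unflatten (axis (ext_index None) 1) = (1, 0)"
      "unflatten (axis (ext_index (Some j)) 1) = (0, axis j 1)" for j :: 'd
      by (auto simp: unflatten_def axis_def vec_eq_iff)
    have fst_unax: "fst (unflatten (axis k 1)) = (axis (ext_index None) 1 :: real ^ 'd ext) $ k" for k
      by (auto simp: unflatten_def axis_def)
    have ent: "matrix (f' y) $ k $ l = flatten (\<Phi>' z (unflatten (axis l 1))) $ k" for k l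
      by (simp add: matrix_def f'_def z_def)
    have "row (ext_index None) (matrix (f' y)) = a z *\<^sub>R axis (ext_index None) 1 -
        (\<Sum>i\<in>UNIV. c z $ i *\<^sub>R row (ext_index (Some i)) (matrix (f' y)))"
    proof -
      have "row (ext_index None) (matrix (f' y)) $ l = (a z *\<^sub>R axis (ext_index None) 1 -
        (\<Sum>i\<in>UNIV. c z $ i *\<^sub>R row (ext_index (Some i)) (matrix (f' y)))) $ l" for l
        by (simp add: row_def ent \<Phi>'_def shear[OF z] fst_unax inner_vec_def)
      then show ?thesis by (simp add: vec_eq_iff)
    qed
    moreover have "\<bar>matrix (f' y) $ ext_index (Some i) $ ext_index (Some j)\<bar> \<le> H z" for i j
      using entries[OF z] by (simp add: ent unax \<Phi>'_def)
    ultimately show ?thesis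
      unfolding K_def z_def[symmetric] by (rule abs_det_sheared_le)
  qed
  have contK': "continuous_on S' (\<lambda>y. K (unflatten y))"
    by (rule continuous_on_compose2[OF contK contunflat]) (use unfS in auto)
  then have Kint: "(\<lambda>y. K (unflatten y)) absolutely_integrable_on S'"
    using borel_integrable_compact[OF S' contK']
    by (simp add: set_integrable_def integrable_completion borel_measurable_integrable)
  then have Ki: "(\<lambda>y. K (unflatten y)) integrable_on S'"
    by (rule set_lebesgue_integral_eq_integral)
  \<comment> \<open>The Jacobian of a differentiable map is measurable, and it is dominated by a
    continuous function on a compact set.\<close>
  have detint: "(\<lambda>y. \<bar>det (matrix (f' y))\<bar>) integrable_on S'"
  proof -
    have "(\<lambda>y. det (matrix (f' y))) \<in> borel_measurable (lebesgue_on S')"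
      by (rule borel_measurable_det_Jacobian[OF S'leb df])
    then have "(\<lambda>y. \<bar>det (matrix (f' y))\<bar>) \<in> borel_measurable (lebesgue_on S')"
      by measurable
    then show ?thesis
      by (rule measurable_bounded_by_integrable_imp_integrable[OF _ Ki _ S'leb]) (simp add: det)
  qed
  have "emeasure lborel (\<Phi> ` S) = emeasure lborel (flatten ` \<Phi> ` S)"
  proof (rule emeasure_flatten_image[symmetric])
    have "continuous_on S \<Phi>"
      using d\<Phi> by (rule has_derivative_continuous_on)
    then show "compact (\<Phi> ` S)" using S by (rule compact_continuous_image)
  qed
  also have "flatten ` \<Phi> ` S = f ` S'"
    by (simp add: f_def S'_def image_image)
  also have "emeasure lborel (f ` S') = emeasure lebesgue (f ` S')"
  proof -
    have "continuous_on S' f"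
      using df by (rule has_derivative_continuous_on)
    then have "compact (f ` S')" using S' by (rule compact_continuous_image)
    then show ?thesis by (simp add: borel_compact)
  qed
  also have "\<dots> = ennreal (measure lebesgue (f ` S'))"
    using measurable_differentiable_image[OF S'leb df detint] by (simp add: emeasure_eq_measure2)
  also have "\<dots> \<le> ennreal (integral S' (\<lambda>y. \<bar>det (matrix (f' y))\<bar>))"
    using measure_differentiable_image[OF S'leb df detint] by (rule ennreal_leI)
  also have "\<dots> \<le> ennreal (integral S' (\<lambda>y. K (unflatten y)))"
    by (intro ennreal_leI integral_le detint Ki det)
  also have "\<dots> = (\<integral>\<^sup>+y\<in>S'. ennreal (K (unflatten y)) \<partial>lborel)"
    using K0 unf integrable_integral[OF Ki] by (intro nn_integral_has_integral_lebesgue'[symmetric]) auto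
  also have "\<dots> = (\<integral>\<^sup>+z\<in>S. ennreal (K z) \<partial>lborel)"
  proof -
    have "continuous_on UNIV (flatten :: real \<times> (real ^ 'd) \<Rightarrow> _)" by (rule contflat)
    then have [measurable]: "flatten \<in> borel_measurable (borel :: (real \<times> (real ^ 'd)) measure)"
      by (rule borel_measurable_continuous_onI)
    have S'b: "S' \<in> sets borel" using S' by (rule borel_compact)
    have "(\<lambda>y. ennreal (K (unflatten y)) * indicator S' y) \<in> borel_measurable borel"
      by (rule borel_measurable_ennreal_indicator[OF S'b contK'])
    then have "(\<integral>\<^sup>+y\<in>S'. ennreal (K (unflatten y)) \<partial>lborel) =
       (\<integral>\<^sup>+z. ennreal (K (unflatten (flatten z))) * indicator S' (flatten z) \<partial>lborel)"
      by (subst distr_flatten[symmetric], subst nn_integral_distr) auto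
    also have "\<dots> = (\<integral>\<^sup>+z\<in>S. ennreal (K z) \<partial>lborel)"
      by (intro nn_integral_cong) (metis (no_types, lifting) S'_def image_eqI imageE indicator_simps unflatten_flatten)
    finally show ?thesis .
  qed
  finally show ?thesis by (simp add: \<Phi>_def[abs_def] K_def)
qed

subsection \<open>The contact set and the parabolic boundary\<close>

text \<open>Not the set of contact points itself but the closed conditions that hold at a contact
  point and are needed later: the gradient is small, \<open>v\<close> is not increasing, and the
  value of \<open>v\<close> is a record over all later times. Closedness gives compactness, and the
  record condition bounds the descent of \<open>v\<close> over these times for every fixed point of
  space.\<close>

definition contact_set ::
  "(real \<times> (real ^ 'd) \<Rightarrow> real) \<Rightarrow> (real \<times> (real ^ 'd) \<Rightarrow> real) \<Rightarrow> (real \<times> (real ^ 'd) \<Rightarrow> real ^ 'd)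
    \<Rightarrow> real \<Rightarrow> real \<Rightarrow> (real ^ 'd) set \<Rightarrow> real \<Rightarrow> (real \<times> (real ^ 'd)) set" where
  "contact_set v a G T1 T2 W \<delta> =
     {z \<in> {T1..T2} \<times> W. norm (G z) \<le> \<delta> \<and> a z \<le> 0 \<and> (\<forall>s\<in>{fst z..T2}. v (s, snd z) \<le> v z)}"

lemma compact_contact_set:
  assumes W: "compact W" and cont: "continuous_on ({T1..T2} \<times> W) v" "continuous_on ({T1..T2} \<times> W) a"
    "continuous_on ({T1..T2} \<times> W) G"
  shows "compact (contact_set v a G T1 T2 W \<delta>)"
proof -
  let ?C = "{T1..T2} \<times> W"
  have C: "compact ?C" using W by (intro compact_Times) auto
  have "closed (contact_set v a G T1 T2 W \<delta>)"
    unfolding closed_sequential_limits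
  proof (intro allI impI, elim conjE)
    fix f z assume f: "\<forall>n. f n \<in> contact_set v a G T1 T2 W \<delta>" and lim: "f \<longlonglongrightarrow> z"
    have fC: "f n \<in> ?C" for n using f by (auto simp: contact_set_def)
    have zC: "z \<in> ?C"
      using closed_sequentially[OF compact_imp_closed[OF C]] fC lim by blast
    have conv: "(\<lambda>n. g (f n)) \<longlonglongrightarrow> g z" if "continuous_on ?C g" for g :: "_ \<Rightarrow> real"
      using that lim zC fC by (auto intro: continuous_on_tendsto_compose)
    have "(\<lambda>n. norm (G (f n))) \<longlonglongrightarrow> norm (G z)"
      by (intro conv continuous_on_norm cont)
    then have 1: "norm (G z) \<le> \<delta>"
      using f by (intro LIMSEQ_le_const2) (auto simp: contact_set_def)
    have 2: "a z \<le> 0"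
      using conv[OF cont(2)] f by (intro LIMSEQ_le_const2) (auto simp: contact_set_def)
    have 3: "v (s, snd z) \<le> v z" if s: "s \<in> {fst z..T2}" for s
    proof -
      define g where "g n = (max s (fst (f n)), snd (f n))" for n
      have gC: "g n \<in> ?C" for n
        using fC[of n] s zC by (auto simp: g_def mem_Times_iff)
      have "g \<longlonglongrightarrow> (max s (fst z), snd z)"
        unfolding g_def by (intro tendsto_intros lim)
      then have "g \<longlonglongrightarrow> (s, snd z)" using s by (simp add: max_absorb1)
      moreover have "(s, snd z) \<in> ?C" using s zC by (auto simp: mem_Times_iff)
      ultimately have "(\<lambda>n. v (g n)) \<longlonglongrightarrow> v (s, snd z)"
        using gC cont(1) by (auto intro: continuous_on_tendsto_compose)
      moreover have "v (g n) \<le> v (f n)" for n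
        using f[rule_format, of n] gC[of n] by (auto simp: contact_set_def g_def)
      ultimately show ?thesis
        using conv[OF cont(1)] by (intro LIMSEQ_le) auto
    qed
    show "z \<in> contact_set v a G T1 T2 W \<delta>"
      using zC 1 2 3 by (auto simp: contact_set_def)
  qed
  moreover have "contact_set v a G T1 T2 W \<delta> \<subseteq> ?C" by (auto simp: contact_set_def)
  ultimately show ?thesis
    using C by (metis compact_Int_closed inf.absorb_iff2)
qed

text \<open>\<open>w\<close> compares \<open>v\<close> with the affine function of slope \<xi>. The
  level \<open>l\<close> is reached at (T1, x0) because \<open>l \<le> m1\<close>, while the margin
  \<delta> R excludes contact on the top and on the side. At the last contact \<open>w\<close> has a
  spatial maximum in the interior, so the gradient equals \<xi>; being below \<open>l\<close>
  afterwards gives the record condition and the sign of the time derivative.\<close>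

lemma contact_set_covers:
  fixes v a :: "real \<times> (real ^ 'd) \<Rightarrow> real" and G :: "real \<times> (real ^ 'd) \<Rightarrow> real ^ 'd"
  assumes W: "compact W" "x0 \<in> W" and T: "T1 \<le> T2"
    and dv: "\<And>z. z \<in> {T1..T2} \<times> W \<Longrightarrow> (v has_derivative (\<lambda>h. a z * fst h + G z \<bullet> snd h)) (at z)"
    and start: "m1 \<le> v (T1, x0)"
    and top: "\<And>x. x \<in> W \<Longrightarrow> v (T2, x) \<le> m2"
    and side: "\<And>t x. t \<in> {T1..T2} \<Longrightarrow> x \<in> frontier W \<Longrightarrow> v (t, x) \<le> m2"
    and R: "\<And>x. x \<in> W \<Longrightarrow> norm (x - x0) \<le> R" and \<delta>: "0 < \<delta>"
    and \<xi>: "norm \<xi> \<le> \<delta>" and l: "m2 + \<delta> * R < l" "l \<le> m1"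
  shows "(l, \<xi>) \<in> (\<lambda>z. (v z - G z \<bullet> (snd z - x0), G z)) ` contact_set v a G T1 T2 W \<delta>"
proof -
  let ?C = "{T1..T2} \<times> W"
  have C: "compact ?C" using W by (intro compact_Times) auto
  have contv: "continuous_on ?C v"
    using dv by (intro has_derivative_continuous_on[OF has_derivative_at_withinI])
  define w where "w z = v z - \<xi> \<bullet> (snd z - x0)" for z
  have contw: "continuous_on ?C w"
    unfolding w_def by (intro continuous_intros contv)
  have small: "\<bar>\<xi> \<bullet> (x - x0)\<bar> \<le> \<delta> * R" if "x \<in> W" for x
  proof -
    have "\<bar>\<xi> \<bullet> (x - x0)\<bar> \<le> norm \<xi> * norm (x - x0)" by (rule Cauchy_Schwarz_ineq2)
    also have "\<dots> \<le> \<delta> * R" using \<xi> R[OF that] \<delta> by (intro mult_mono) auto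
    finally show ?thesis .
  qed
  define S where "S = {z \<in> ?C. l \<le> w z}"
  have "closed S"
    unfolding S_def using contw compact_imp_closed[OF C] by (intro continuous_on_closed_Collect_le) auto
  then have "compact S"
    using C by (metis (no_types, lifting) S_def compact_Int_closed inf.absorb_iff2 mem_Collect_eq subsetI)
  moreover have "(T1, x0) \<in> S"
    using W T start l by (auto simp: S_def w_def)
  moreover have "continuous_on S fst"
    by (intro continuous_on_fst continuous_on_id)
  ultimately have "\<exists>z\<in>S. \<forall>z'\<in>S. fst z' \<le> fst z"
    by (intro continuous_attains_sup) blast+
  then obtain z where z: "z \<in> S" and zmax: "\<And>z'. z' \<in> S \<Longrightarrow> fst z' \<le> fst z"
    by blast
  obtain t y where ty: "z = (t, y)" by fastforce
  have tyC: "T1 \<le> t" "t \<le> T2" "y \<in> W" and lw: "l \<le> w (t, y)"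
    using z by (auto simp: S_def ty)
  have after: "w (s, y') < l" if "t < s" "s \<le> T2" "y' \<in> W" for s y'
  proof (rule ccontr)
    assume "\<not> w (s, y') < l"
    then have "(s, y') \<in> S" using that tyC by (auto simp: S_def)
    then show False using zmax[of "(s, y')"] that by (simp add: ty)
  qed
  have "t \<noteq> T2"
    using lw top[OF tyC(3)] small[OF tyC(3)] l by (auto simp: w_def)
  then have tT2: "t < T2" using tyC by simp
  \<comment> \<open>At the contact time itself the bound comes from letting later times decrease to
    \<open>t\<close>, which is possible since \<open>t < T2\<close>. It turns
    \<open>l \<le> w\<close> at the contact point into equality.\<close>
  have le_l: "w (t, y') \<le> l" if y': "y' \<in> W" for y'
  proof -
    have "continuous_on {T1..T2} (\<lambda>s. w (s, y'))"
      using y' by (intro continuous_on_compose2[OF contw] continuous_intros) auto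
    then have "((\<lambda>s. w (s, y')) \<longlongrightarrow> w (t, y')) (at t within {T1..T2})"
      using tyC by (auto simp: continuous_on_def)
    then have lim: "((\<lambda>s. w (s, y')) \<longlongrightarrow> w (t, y')) (at t within {t..T2})"
      by (rule tendsto_within_subset) (use tyC in auto)
    have "at t within {t..T2} \<noteq> bot"
      using tT2 by (simp add: at_within_Icc_at_right)
    moreover have "eventually (\<lambda>s. w (s, y') \<le> l) (at t within {t..T2})"
      using after[OF _ _ y'] by (auto simp: eventually_at_filter less_le intro!: always_eventually)
    ultimately show ?thesis
      using lim by (intro tendsto_upperbound[of "\<lambda>s. w (s, y')"])
  qed
  then have wl: "w (t, y) = l" using lw tyC by (intro antisym) auto
  have "y \<notin> frontier W"
  proof
    assume "y \<in> frontier W"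
    then have "v (t, y) \<le> m2" using side tyC by auto
    then show False using wl small[OF tyC(3)] l by (auto simp: w_def)
  qed
  then have yint: "y \<in> interior W"
    using tyC(3) W(1) by (simp add: frontier_def compact_imp_closed closure_closed)
  have dvt: "(v has_derivative (\<lambda>h. a (t, y) * fst h + G (t, y) \<bullet> snd h)) (at (t, y))"
    using dv tyC by auto
  have grad: "G (t, y) = \<xi>"
  proof -
    have "((\<lambda>y'. (t, y')) has_derivative (\<lambda>h. (0, h))) (at y)"
      by (auto intro!: derivative_eq_intros)
    then have "((\<lambda>y'. v (t, y')) has_derivative (\<lambda>h. G (t, y) \<bullet> h)) (at y)"
      using has_derivative_compose[of "\<lambda>y'. (t, y')" _ y UNIV v] dvt by force
    then have "((\<lambda>y'. w (t, y')) has_derivative (\<lambda>h. G (t, y) \<bullet> h - \<xi> \<bullet> h)) (at y)"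
      unfolding w_def by (auto intro!: derivative_eq_intros)
    then have "(\<lambda>h. G (t, y) \<bullet> h - \<xi> \<bullet> h) = (\<lambda>h. 0)"
      using yint le_l wl interior_subset[of W]
      by (intro differential_zero_maxmin[of y "interior W"]) auto
    then have "(G (t, y) - \<xi>) \<bullet> (G (t, y) - \<xi>) = 0"
      by (metis inner_diff_left)
    then show ?thesis by simp
  qed
  have decr: "v (s, y) \<le> v (t, y)" if "s \<in> {t..T2}" for s
    using after[of s y] that tyC(3) wl by (cases "s = t") (auto simp: w_def)
  have "a (t, y) \<le> 0"
  proof (rule ccontr)
    assume "\<not> a (t, y) \<le> 0"
    have "((\<lambda>s. (s, y)) has_derivative (\<lambda>h. (h, 0))) (at t)"
      by (auto intro!: derivative_eq_intros)
    then have "((\<lambda>s. v (s, y)) has_derivative (\<lambda>h. a (t, y) * h)) (at t)"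
      using has_derivative_compose[of "\<lambda>s. (s, y)" _ t UNIV v] dvt by force
    then have "((\<lambda>s. v (s, y)) has_field_derivative a (t, y)) (at t)"
      by (simp add: has_field_derivative_def)
    then obtain d where d: "0 < d" "\<And>h. 0 < h \<Longrightarrow> h < d \<Longrightarrow> v (t, y) < v (t + h, y)"
      using DERIV_pos_inc_right[of "\<lambda>s. v (s, y)" "a (t, y)" t] \<open>\<not> a (t, y) \<le> 0\<close> by auto
    define h where "h = min (d / 2) (T2 - t)"
    have "0 < h" "h < d" "t + h \<in> {t..T2}" using d tT2 by (auto simp: h_def)
    then show False using d(2)[of h] decr[of "t + h"] by auto
  qed
  then have "(t, y) \<in> contact_set v a G T1 T2 W \<delta>"
    using tyC grad \<xi> decr by (auto simp: contact_set_def)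
  moreover have "(l, \<xi>) = (v (t, y) - G (t, y) \<bullet> (snd (t, y) - x0), G (t, y))"
    using grad wl by (simp add: w_def)
  ultimately show ?thesis by (rule rev_image_eqI)
qed

text \<open>In the differential of v - G \<bullet> (x - x0) the terms G \<bullet> dx cancel, leaving
  a dt - (x - x0) \<bullet> dG. This is the sheared form with \<open>c\<close> equal to x - x0, so
  the determinant estimate applies to the map whose image contains a cylinder over the ball of
  slopes.\<close>

lemma contact_set_estimate:
  fixes v a H :: "real \<times> (real ^ 'd) \<Rightarrow> real" and G :: "real \<times> (real ^ 'd) \<Rightarrow> real ^ 'd"
  assumes W: "compact W" "x0 \<in> W" and T: "T1 \<le> T2"
    and dv: "\<And>z. z \<in> {T1..T2} \<times> W \<Longrightarrow> (v has_derivative (\<lambda>h. a z * fst h + G z \<bullet> snd h)) (at z)"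
    and dG: "\<And>z. z \<in> {T1..T2} \<times> W \<Longrightarrow> (G has_derivative G' z) (at z)"
    and G': "\<And>z i j. z \<in> {T1..T2} \<times> W \<Longrightarrow> \<bar>G' z (0, axis j 1) $ i\<bar> \<le> H z"
    and cont: "continuous_on ({T1..T2} \<times> W) a" "continuous_on ({T1..T2} \<times> W) H"
    and start: "m1 \<le> v (T1, x0)"
    and top: "\<And>x. x \<in> W \<Longrightarrow> v (T2, x) \<le> m2"
    and side: "\<And>t x. t \<in> {T1..T2} \<Longrightarrow> x \<in> frontier W \<Longrightarrow> v (t, x) \<le> m2"
    and R: "\<And>x. x \<in> W \<Longrightarrow> norm (x - x0) \<le> R" and \<delta>: "0 < \<delta>" and m: "m2 + \<delta> * R < m1"
  shows "ennreal (m1 - m2 - \<delta> * R) * emeasure lborel (ball (0 :: real ^ 'd) \<delta>) \<le>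
    (\<integral>\<^sup>+z\<in>contact_set v a G T1 T2 W \<delta>. ennreal (fact (CARD('d) + 1) * (\<bar>a z\<bar> * H z ^ CARD('d))) \<partial>lborel)"
proof -
  let ?C = "{T1..T2} \<times> W"
  define \<Gamma> where "\<Gamma> = contact_set v a G T1 T2 W \<delta>"
  have sub: "\<Gamma> \<subseteq> ?C" by (auto simp: \<Gamma>_def contact_set_def)
  have contv: "continuous_on ?C v"
    using dv by (intro has_derivative_continuous_on[OF has_derivative_at_withinI])
  have contG: "continuous_on ?C G"
    using dG by (intro has_derivative_continuous_on[OF has_derivative_at_withinI])
  have \<Gamma>: "compact \<Gamma>"
    unfolding \<Gamma>_def by (intro compact_contact_set W contv contG cont)
  define \<Phi> where "\<Phi> z = (v z - G z \<bullet> (snd z - x0), G z)" for z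
  have "{m2 + \<delta> * R<..<m1} \<times> ball 0 \<delta> \<subseteq> \<Phi> ` \<Gamma>"
  proof clarify
    fix l \<xi> assume "l \<in> {m2 + \<delta> * R<..<m1}" "\<xi> \<in> ball (0 :: real ^ 'd) \<delta>"
    then show "(l, \<xi>) \<in> \<Phi> ` \<Gamma>"
      unfolding \<Phi>_def \<Gamma>_def
      by (intro contact_set_covers[where ?m1.0 = m1 and ?m2.0 = m2 and R = R] W T dv start top side R \<delta>) auto
  qed
  then have "emeasure lborel ({m2 + \<delta> * R<..<m1} \<times> ball (0 :: real ^ 'd) \<delta>) \<le> emeasure lborel (\<Phi> ` \<Gamma>)"
  proof (rule emeasure_mono)
    have "continuous_on \<Gamma> \<Phi>"
      unfolding \<Phi>_def using contv contG sub
      by (intro continuous_intros) (auto intro: continuous_on_subset)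
    then have "compact (\<Phi> ` \<Gamma>)" using \<Gamma> by (rule compact_continuous_image)
    then show "\<Phi> ` \<Gamma> \<in> sets lborel" by (simp add: borel_compact)
  qed
  also have "emeasure lborel ({m2 + \<delta> * R<..<m1} \<times> ball (0 :: real ^ 'd) \<delta>) =
      ennreal (m1 - m2 - \<delta> * R) * emeasure lborel (ball (0 :: real ^ 'd) \<delta>)"
    using m by (subst lborel_prod[symmetric], subst lborel.emeasure_pair_measure_Times) (auto simp: algebra_simps)
  also have "emeasure lborel (\<Phi> ` \<Gamma>) \<le> (\<integral>\<^sup>+z\<in>\<Gamma>. ennreal (fact (CARD('d) + 1) * (\<bar>a z\<bar> * H z ^ CARD('d))) \<partial>lborel)"
    unfolding \<Phi>_def
  proof (rule emeasure_sheared_image_le[where c = "\<lambda>z. snd z - x0"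
        and w' = "\<lambda>z h. a z * fst h + G z \<bullet> snd h - (G z \<bullet> snd h + G' z h \<bullet> (snd z - x0))" and G' = G'])
    fix z assume z: "z \<in> \<Gamma>"
    then have zC: "z \<in> ?C" using sub by auto
    show "((\<lambda>z. v z - G z \<bullet> (snd z - x0)) has_derivative
        (\<lambda>h. a z * fst h + G z \<bullet> snd h - (G z \<bullet> snd h + G' z h \<bullet> (snd z - x0)))) (at z within \<Gamma>)"
    proof (rule has_derivative_at_withinI, rule has_derivative_diff[OF dv[OF zC] has_derivative_inner[OF dG[OF zC]]])
      have "((\<lambda>z. snd z - x0) has_derivative (\<lambda>h. snd h - 0)) (at z)"
        by (intro has_derivative_diff has_derivative_snd has_derivative_ident has_derivative_const)
      then show "((\<lambda>z. snd z - x0) has_derivative snd) (at z)" by simp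
    qed
    show "(G has_derivative G' z) (at z within \<Gamma>)"
      by (rule has_derivative_at_withinI[OF dG[OF zC]])
    show "\<bar>G' z (0, axis j 1) $ i\<bar> \<le> H z" for i j
      by (rule G'[OF zC])
  qed (use \<Gamma> sub cont in \<open>auto simp: inner_commute intro: continuous_on_subset\<close>)
  finally show ?thesis unfolding \<Gamma>_def .
qed

text \<open>Where f' < 0, records have distinct values: just before a later time with the same
  value, f would exceed the earlier record. Hence f is injective there, and by change of variables
  the integral is the length of a subset of [m, M].\<close>

lemma nn_integral_abs_deriv_record_le:
  fixes f f' :: "real \<Rightarrow> real"
  assumes S: "S \<in> sets borel" "S \<subseteq> {T1..T2}"
    and df: "\<And>t. t \<in> {T1..T2} \<Longrightarrow> (f has_field_derivative f' t) (at t)"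
    and cont: "continuous_on {T1..T2} f'"
    and decr: "\<And>t s. t \<in> S \<Longrightarrow> s \<in> {t..T2} \<Longrightarrow> f s \<le> f t" and neg: "\<And>t. t \<in> S \<Longrightarrow> f' t \<le> 0"
    and range: "\<And>t. t \<in> {T1..T2} \<Longrightarrow> f t \<in> {m..M}"
  shows "(\<integral>\<^sup>+t\<in>S. ennreal \<bar>f' t\<bar> \<partial>lborel) \<le> ennreal (M - m)"
proof -
  \<comment> \<open>Record times with vanishing derivative are dropped; they contribute nothing to
    the integral and could spoil injectivity.\<close>
  define S' where "S' = S - {t \<in> {T1..T2}. 0 \<le> f' t}"
  have "closed {t \<in> {T1..T2}. 0 \<le> f' t}"
    using cont by (intro continuous_on_closed_Collect_le) auto
  then have S'b: "S' \<in> sets borel"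
    unfolding S'_def using S(1) by (intro sets.Diff) auto
  then have S'l: "S' \<in> sets lebesgue" by (simp add: lborelD)
  have S'sub: "S' \<subseteq> {T1..T2}" "S' \<subseteq> S" using S(2) by (auto simp: S'_def)
  have no: False if st: "s \<in> S'" "t \<in> S'" "s < t" "f s = f t" for s t
  proof -
    have "f' t < 0" using st(2) neg S'sub by (force simp: S'_def)
    then obtain d where d: "0 < d" "\<And>h. 0 < h \<Longrightarrow> h < d \<Longrightarrow> f t < f (t - h)"
      using DERIV_neg_dec_left[OF df] st(2) S'sub by (metis subsetD)
    define h where "h = min (d / 2) (t - s)"
    have "t \<le> T2" using st(2) S'sub(1) by auto
    then have h: "0 < h" "h < d" "t - h \<in> {s..T2}" using d(1) st(3) by (auto simp: h_def)
    then have "f (t - h) \<le> f s" using decr st(1) S'sub by blast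
    then show False using d(2)[OF h(1,2)] st(4) by simp
  qed
  have inj: "inj_on f S'"
  proof (rule inj_onI)
    fix s t assume "s \<in> S'" "t \<in> S'" "f s = f t"
    then show "s = t" using no[of s t] no[of t s] by (metis linorder_neqE)
  qed
  have int: "(\<lambda>t. \<bar>f' t\<bar>) absolutely_integrable_on S'"
  proof -
    have "continuous_on {T1..T2} (\<lambda>t. \<bar>f' t\<bar>)" by (intro continuous_intros cont)
    then have "(\<lambda>t. \<bar>f' t\<bar>) absolutely_integrable_on {T1..T2}"
      by (rule absolutely_integrable_continuous_real)
    then show ?thesis using S'l S'sub(1) by (rule set_integrable_subset)
  qed
  have dfS: "(f has_field_derivative f' t) (at t within S')" if "t \<in> S'" for t
    using df S'sub(1) that by (blast intro: has_field_derivative_at_within)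
  have "(\<lambda>t. \<bar>f' t\<bar> *\<^sub>R (1 :: real)) absolutely_integrable_on S' \<and> integral S' (\<lambda>t. \<bar>f' t\<bar> *\<^sub>R (1 :: real)) = integral S' (\<lambda>t. \<bar>f' t\<bar>)"
    using int by simp
  then have im: "(\<lambda>_. 1 :: real) absolutely_integrable_on f ` S' \<and> integral (f ` S') (\<lambda>_. 1 :: real) = integral S' (\<lambda>t. \<bar>f' t\<bar>)"
    using has_absolute_integral_change_of_variables_real[OF S'l dfS inj, of "\<lambda>_. 1 :: real" "integral S' (\<lambda>t. \<bar>f' t\<bar>)"] by blast
  then have im_int: "(\<lambda>_. 1 :: real) integrable_on f ` S'"
    using set_lebesgue_integral_eq_integral(1) by blast
  have fsub: "f ` S' \<subseteq> {m..M}" using range S'sub by blast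
  have le: "integral S' (\<lambda>t. \<bar>f' t\<bar>) \<le> M - m \<or> S' = {}"
  proof (cases "S' = {}")
    case False
    then have "m \<le> M" using fsub by fastforce
    have "integral (f ` S') (\<lambda>_. 1 :: real) \<le> integral {m..M} (\<lambda>_. 1 :: real)"
      using fsub im_int by (intro integral_subset_le) auto
    then show ?thesis using im \<open>m \<le> M\<close> by simp
  qed auto
  have "(\<integral>\<^sup>+t\<in>S. ennreal \<bar>f' t\<bar> \<partial>lborel) = (\<integral>\<^sup>+t\<in>S'. ennreal \<bar>f' t\<bar> \<partial>lborel)"
    using neg S(2) by (intro nn_integral_cong) (force simp: S'_def indicator_def)
  also have "\<dots> = ennreal (integral S' (\<lambda>t. \<bar>f' t\<bar>))"
    using set_lebesgue_integral_eq_integral(1)[OF int]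
    by (intro nn_integral_has_integral_lebesgue') (auto intro: integrable_integral)
  also have "\<dots> \<le> ennreal (M - m)"
    using le by (auto intro: ennreal_leI)
  finally show ?thesis .
qed

text \<open>Otherwise the segment from z forward in time to z' leaves Q, and its first exit point
  belongs to the parabolic boundary, the segment being a graph over time. There
  \<open>u \<le> 0\<close>, whereas the oscillation bound keeps \<open>u\<close> above u(z) -
  \<eta>, which is at least 0.\<close>

lemma upper_half_ball_subset:
  fixes Q :: "(real \<times> 'a::euclidean_space) set" and u :: "real \<times> 'a \<Rightarrow> real"
  assumes Q: "open Q" and bdry: "\<forall>z\<in>parabolic_boundary Q. u z \<le> 0"
    and r: "\<And>z z'. z \<in> closure Q \<Longrightarrow> z' \<in> closure Q \<Longrightarrow> dist z' z < r \<Longrightarrow> \<bar>u z' - u z\<bar> < \<eta>"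
    and z: "z \<in> Q" "\<eta> \<le> u z" and z': "fst z < fst z'" "dist z' z < r"
  shows "z' \<in> Q"
proof (rule ccontr)
  assume z'Q: "z' \<notin> Q"
  \<comment> \<open>Normalised so that \<gamma> is parametrised by its own time coordinate; it is
    defined on the whole line, as \<open>parabolic_boundary\<close> demands of its curves.\<close>
  define \<tau> where "\<tau> s = (s - fst z) / (fst z' - fst z)" for s
  define \<gamma> where "\<gamma> s = z + \<tau> s *\<^sub>R (z' - z)" for s
  have fst\<gamma>: "fst (\<gamma> s) = s" for s
    using z' by (simp add: \<gamma>_def \<tau>_def)
  have cont: "continuous_on X \<gamma>" for X
    unfolding \<gamma>_def \<tau>_def using z' by (intro continuous_intros) auto
  have \<gamma>z: "\<gamma> (fst z) = z" "\<gamma> (fst z') = z'"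
    using z' by (simp_all add: \<gamma>_def \<tau>_def)
  define B where "B = {s \<in> {fst z..fst z'}. \<gamma> s \<notin> Q}"
  have "B = {fst z..fst z'} \<inter> \<gamma> -` (- Q)" by (auto simp: B_def)
  moreover have "closed ({fst z..fst z'} \<inter> \<gamma> -` (- Q))"
    using Q by (intro continuous_closed_preimage cont) auto
  ultimately have "closed B" by simp
  have "fst z' \<in> B" using z'Q z' by (simp add: B_def \<gamma>z)
  then have "B \<noteq> {}" by auto
  have bdd: "bdd_below B" by (intro bdd_belowI[of _ "fst z"]) (auto simp: B_def)
  define t0 where "t0 = Inf B"
  have t0B: "t0 \<in> B"
    unfolding t0_def using \<open>B \<noteq> {}\<close> bdd \<open>closed B\<close> by (rule closed_contains_Inf)
  then have t0: "fst z \<le> t0" "t0 \<le> fst z'" "\<gamma> t0 \<notin> Q" by (auto simp: B_def)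
  then have "fst z < t0" using z \<gamma>z(1) by (metis less_le)
  have before: "\<gamma> s \<in> Q" if "s \<in> {fst z..<t0}" for s
  proof (rule ccontr)
    assume "\<gamma> s \<notin> Q"
    then have "s \<in> B" using that t0 by (auto simp: B_def)
    then have "t0 \<le> s" unfolding t0_def using bdd by (rule cInf_lower)
    then show False using that by simp
  qed
  have "\<gamma> t0 \<in> closure Q"
  proof -
    have "(\<gamma> \<longlongrightarrow> \<gamma> t0) (at_left t0)"
      using cont[of UNIV] by (auto simp: continuous_on_def intro: tendsto_within_subset)
    moreover have "eventually (\<lambda>s. \<gamma> s \<in> closure Q) (at_left t0)"
      using eventually_at_left_field[of "\<lambda>s. \<gamma> s \<in> closure Q" t0] \<open>fst z < t0\<close> before closure_subset
      by (metis atLeastLessThan_iff less_imp_le subsetD)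
    ultimately show ?thesis
      by (intro Lim_in_closed_set[of _ "\<gamma>" "at_left t0"]) auto
  qed
  then have "\<gamma> t0 \<in> frontier Q"
    using t0 Q by (simp add: frontier_def interior_open)
  have "\<gamma> t0 \<in> parabolic_boundary Q"
  proof -
    have eq: "\<gamma> s = (s, snd (\<gamma> s))" for s using fst\<gamma>[of s] by (metis prod.collapse)
    have "continuous_on UNIV (\<lambda>s. snd (\<gamma> s))"
      by (intro continuous_on_snd cont)
    moreover have "\<forall>s\<in>{t0 - (t0 - fst z)..<t0}. (s, snd (\<gamma> s)) \<in> Q"
      using before by (simp add: eq[symmetric])
    moreover have "(t0, snd (\<gamma> t0)) \<in> frontier Q"
      using \<open>\<gamma> t0 \<in> frontier Q\<close> by (simp add: eq[symmetric])
    ultimately have "(t0, snd (\<gamma> t0)) \<in> parabolic_boundary Q"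
      unfolding parabolic_boundary_def using \<open>fst z < t0\<close>
      by (auto intro!: exI[of _ "\<lambda>s. snd (\<gamma> s)"] exI[of _ "t0 - fst z"])
    then show ?thesis by (simp add: eq[symmetric])
  qed
  then have "u (\<gamma> t0) \<le> 0" using bdry by blast
  moreover have "dist (\<gamma> t0) z < r"
  proof -
    have "dist (\<gamma> t0) z = \<bar>\<tau> t0\<bar> * dist z' z"
      by (simp add: \<gamma>_def dist_norm)
    also have "\<dots> \<le> 1 * dist z' z"
      using t0 z' by (intro mult_right_mono) (auto simp: \<tau>_def)
    finally show ?thesis using z' by simp
  qed
  then have "\<bar>u (\<gamma> t0) - u z\<bar> < \<eta>"
    using r[of z "\<gamma> t0"] \<open>\<gamma> t0 \<in> closure Q\<close> z closure_subset by blast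
  ultimately show False using z by linarith
qed

text \<open>The cylinder starts at the last time at which \<open>u\<close> reaches the value m =
  u(z1). The delicate point is that all points of the closure of this superlevel set at that last
  time lie in Q and not on its boundary. They form a compact set K inside Q, and a closed
  neighbourhood W of K is the base. On the top and on the side \<open>u\<close> stays below m: later
  times are excluded by the choice of T, and at time T the frontier of W misses K. Compactness of
  top and side gives \<kappa>.\<close>

lemma positive_cylinder:
  fixes Q :: "(real \<times> 'a::euclidean_space) set" and u :: "real \<times> 'a \<Rightarrow> real"
  assumes Q: "open Q" "bounded Q" and u: "continuous_on (closure Q) u"
    and bdry: "\<forall>z\<in>parabolic_boundary Q. u z \<le> 0" and z1: "z1 \<in> Q" "0 < u z1"
  obtains T1 T2 W x0 m \<kappa> where "T1 < T2" "compact W" "x0 \<in> W" "{T1..T2} \<times> W \<subseteq> Q"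
    "m \<le> u (T1, x0)" "0 < \<kappa>" "\<And>x. x \<in> W \<Longrightarrow> u (T2, x) \<le> m - \<kappa>"
    "\<And>t x. t \<in> {T1..T2} \<Longrightarrow> x \<in> frontier W \<Longrightarrow> u (t, x) \<le> m - \<kappa>"
proof -
  define m where "m = u z1"
  \<comment> \<open>One half of m pays for the step back in time below, the other half is what
    \<open>upper_half_ball_subset\<close> asks for.\<close>
  define \<eta> where "\<eta> = m / 2"
  have m: "0 < m" "0 < \<eta>" "m - \<eta> = \<eta>" using z1 by (auto simp: m_def \<eta>_def)
  have cQ: "compact (closure Q)" using Q by (simp add: compact_closure)
  have "uniformly_continuous_on (closure Q) u"
    using u cQ by (rule compact_uniformly_continuous)
  then obtain r where r: "0 < r" "\<And>z z'. z \<in> closure Q \<Longrightarrow> z' \<in> closure Q \<Longrightarrow> dist z' z < r \<Longrightarrow> \<bar>u z' - u z\<bar> < \<eta>"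
    using m(2) unfolding uniformly_continuous_on_def dist_real_def by metis
  define A where "A = {z \<in> Q. m \<le> u z}"
  have AQ: "A \<subseteq> Q" by (auto simp: A_def)
  have cA: "compact (closure A)"
    using Q AQ by (metis bounded_subset compact_closure)
  have clA: "closure A \<subseteq> {z \<in> closure Q. m \<le> u z}"
  proof (rule closure_minimal)
    show "A \<subseteq> {z \<in> closure Q. m \<le> u z}" using closure_subset by (auto simp: A_def)
    show "closed {z \<in> closure Q. m \<le> u z}"
      using u by (intro continuous_on_closed_Collect_le) auto
  qed
  have later: "z0 \<in> A" if z0: "z0 \<in> closure A" and le: "\<And>z. z \<in> A \<Longrightarrow> fst z \<le> fst z0" for z0
  proof -
    obtain z where z: "z \<in> A" "dist z z0 < r"
      using z0 r(1) closure_approachable by blast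
    obtain e where e: "0 < e" "cball z e \<subseteq> Q"
      using z AQ Q(1) open_contains_cball by blast
    \<comment> \<open>A nearby point \<open>z\<close> of \<open>A\<close> may have the same time as
      \<open>z0\<close>, but \<open>upper_half_ball_subset\<close> needs a strictly earlier one; so
      \<open>z\<close> is moved back by a small \<open>h\<close> that keeps it in Q and within r of
      \<open>z0\<close>.\<close>
    define h where "h = min e ((r - dist z z0) / 2)"
    have h: "0 < h" "h \<le> e" "h < r - dist z z0" using e z by (auto simp: h_def min_def)
    define y where "y = (fst z - h, snd z)"
    have dy: "dist y z = h" using h by (simp add: y_def dist_prod_def dist_real_def)
    have yQ: "y \<in> Q" using e dy h by (auto simp: dist_commute)
    have "\<bar>u y - u z\<bar> < \<eta>"
      using r(2)[of z y] yQ z AQ closure_subset[of Q] dy h zero_le_dist[of z z0] by auto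
    then have "\<eta> \<le> u y" using z m by (auto simp: A_def)
    moreover have "dist z0 y < r"
      using dist_triangle[of z0 y z] dy h by (simp add: dist_commute)
    moreover have "fst y < fst z0" using le[OF z(1)] h by (simp add: y_def)
    ultimately have "z0 \<in> Q"
      using upper_half_ball_subset[OF Q(1) bdry r(2) yQ] by blast
    then show ?thesis using clA z0 by (auto simp: A_def)
  qed
  have "z1 \<in> A" using z1 by (simp add: A_def m_def)
  then have "closure A \<noteq> {}" using closure_subset by blast
  moreover have "continuous_on (closure A) fst" by (intro continuous_on_fst continuous_on_id)
  ultimately have "\<exists>z\<in>closure A. \<forall>z'\<in>closure A. fst z' \<le> fst z"
    by (intro continuous_attains_sup cA)
  then obtain z0 where z0: "z0 \<in> closure A" "\<And>z. z \<in> closure A \<Longrightarrow> fst z \<le> fst z0" by blast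
  define T where "T = fst z0"
  have T: "fst z \<le> T" if "z \<in> A" for z
    using z0(2) that closure_subset unfolding T_def by blast
  have z0A: "z0 \<in> A" using later[OF z0(1)] T by (simp add: T_def)
  define K where "K = {x. (T, x) \<in> closure A}"
  have KA: "(T, x) \<in> A" if "x \<in> K" for x
    using later[of "(T, x)"] that T by (auto simp: K_def)
  have "compact K"
  proof -
    have "closed ((\<lambda>x. (T, x)) -` closure A)"
      by (intro continuous_closed_vimage) (auto intro!: continuous_intros)
    moreover have "K = (\<lambda>x. (T, x)) -` closure A" by (auto simp: K_def)
    moreover have "bounded K"
    proof -
      have "K \<subseteq> snd ` closure A" by (force simp: K_def)
      then show ?thesis using cA compact_imp_bounded bounded_snd bounded_subset by metis
    qed
    ultimately show ?thesis by (simp add: compact_eq_bounded_closed)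
  qed
  then have "compact ({T} \<times> K)" by (intro compact_Times) auto
  moreover have "{T} \<times> K \<subseteq> Q" using KA AQ by auto
  ultimately obtain \<epsilon> where \<epsilon>: "0 < \<epsilon>" "(\<Union>z\<in>{T} \<times> K. cball z \<epsilon>) \<subseteq> Q"
    using compact_subset_open_imp_cball_epsilon_subset[OF _ Q(1)] by metis
  \<comment> \<open>Half of the distance \<epsilon> is for the shift in time, half for the shift in
    space.\<close>
  define e where "e = \<epsilon> / 2"
  have e: "0 < e" using \<epsilon> by (simp add: e_def)
  define W where "W = {x + y |x y. x \<in> K \<and> y \<in> cball 0 e}"
  have W: "compact W" unfolding W_def using \<open>compact K\<close> compact_cball by (rule compact_sums)
  have KW: "x \<in> interior W" if "x \<in> K" for x
  proof -
    have "ball x e \<subseteq> W"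
    proof
      fix w assume "w \<in> ball x e"
      then show "w \<in> W" unfolding W_def using that
        by (intro CollectI exI[of _ x] exI[of _ "w - x"]) (auto simp: dist_norm norm_minus_commute)
    qed
    then show ?thesis using e by (intro interiorI[of "ball x e"]) auto
  qed
  have sub: "{T..T + e} \<times> W \<subseteq> Q"
  proof clarify
    fix t w assume t: "t \<in> {T..T + e}" and "w \<in> W"
    then obtain x y where xy: "w = x + y" "x \<in> K" "norm y \<le> e" by (auto simp: W_def)
    have "dist (T, x) (t, w) \<le> dist (T, x) (t, x) + dist (t, x) (t, w)" by (rule dist_triangle)
    also have "\<dots> = \<bar>T - t\<bar> + norm y" by (simp add: dist_prod_def dist_real_def xy dist_norm)
    also have "\<dots> \<le> \<epsilon>" using t xy by (simp add: e_def)
    finally have "(t, w) \<in> cball (T, x) \<epsilon>" by simp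
    then show "(t, w) \<in> Q" using \<epsilon> xy by blast
  qed
  define L where "L = {T..T + e} \<times> frontier W \<union> {T + e} \<times> W"
  have fW: "frontier W \<subseteq> W" using W by (simp add: compact_imp_closed frontier_subset_closed)
  have "compact L"
    unfolding L_def using W by (intro compact_Un compact_Times compact_frontier) auto
  have LQ: "L \<subseteq> Q" using sub fW e by (auto simp: L_def)
  have x0W: "snd z0 \<in> W" using KW[of "snd z0"] z0(1) interior_subset[of W] by (auto simp: K_def T_def)
  have less: "u z < m" if z: "z \<in> L" for z
  proof (rule ccontr)
    assume "\<not> u z < m"
    then have zA: "z \<in> A" using z LQ by (auto simp: A_def)
    from z consider "fst z \<in> {T..T + e}" "snd z \<in> frontier W" | "fst z = T + e" by (auto simp: L_def)
    then show False
    proof cases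
      case 1
      then have "fst z = T" using T[OF zA] by auto
      then have "(T, snd z) \<in> A" using zA by (metis prod.collapse)
      then have "snd z \<in> K" using closure_subset[of A] by (auto simp: K_def)
      then show False using KW 1(2) by (auto simp: frontier_def)
    next
      case 2
      then show False using T[OF zA] e by auto
    qed
  qed
  have "L \<noteq> {}" using x0W by (auto simp: L_def)
  moreover have "continuous_on L u"
    using u LQ closure_subset by (blast intro: continuous_on_subset)
  ultimately obtain zm where zm: "zm \<in> L" "\<And>z. z \<in> L \<Longrightarrow> u z \<le> u zm"
    using continuous_attains_sup[OF \<open>compact L\<close>] by blast
  show ?thesis
  proof (rule that[of T "T + e" W "snd z0" m "m - u zm"])
    show "m \<le> u (T, snd z0)" using z0A by (auto simp: A_def T_def)
  qed (use e W x0W sub less[OF zm(1)] zm(2) in \<open>auto simp: L_def\<close>)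
qed

subsection \<open>Mixed norms\<close>

lemma tendsto_ennreal_powr_0:
  assumes "(f \<longlongrightarrow> 0) F" "0 < a"
  shows "((\<lambda>x. ennreal_powr (f x) a) \<longlongrightarrow> 0) F"
proof (rule order_tendstoI)
  fix e :: ennreal assume "0 < e"
  then have "0 < ennreal_powr e (1 / a)"
    by (simp add: zero_less_iff_neq_zero)
  then have "eventually (\<lambda>x. f x < ennreal_powr e (1 / a)) F"
    using assms(1) by (rule order_tendstoD(2)[rotated])
  then show "eventually (\<lambda>x. ennreal_powr (f x) a < e) F"
  proof (rule eventually_mono)
    fix x assume "f x < ennreal_powr e (1 / a)"
    then have "\<not> e \<le> ennreal_powr (f x) a"
      using ennreal_powr_le_iff[of "1 / a" e "f x"] \<open>0 < a\<close> by simp (metis leD)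
    then show "ennreal_powr (f x) a < e" by simp
  qed
qed (simp add: not_less)

lemma lp_norm_dominated_convergence:
  assumes [measurable]: "\<And>n. f n \<in> borel_measurable M" "g \<in> borel_measurable M"
    and le: "\<And>n. AE x in M. f n x \<le> g x" and fin: "lp_norm M p g < \<infinity>"
    and lim: "AE x in M. (\<lambda>n. f n x) \<longlonglongrightarrow> 0" and p: "0 < p"
  shows "(\<lambda>n. lp_norm M p (f n)) \<longlonglongrightarrow> 0"
proof -
  have "(\<lambda>n. \<integral>\<^sup>+x. ennreal_powr (f n x) p \<partial>M) \<longlonglongrightarrow> (\<integral>\<^sup>+x. 0 \<partial>M)"
  proof (rule nn_integral_dominated_convergence[where w = "\<lambda>x. ennreal_powr (g x) p"])
    show "AE x in M. ennreal_powr (f n x) p \<le> ennreal_powr (g x) p" for n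
      using le[of n] by eventually_elim (use p in \<open>auto intro: ennreal_powr_mono\<close>)
    show "(\<integral>\<^sup>+x. ennreal_powr (g x) p \<partial>M) < \<infinity>"
      using fin by (simp add: lp_norm_def)
    show "AE x in M. (\<lambda>n. ennreal_powr (f n x) p) \<longlonglongrightarrow> 0"
      using lim by eventually_elim (use p in \<open>auto intro: tendsto_ennreal_powr_0\<close>)
  qed auto
  then show ?thesis
    unfolding lp_norm_def using p by (intro tendsto_ennreal_powr_0) auto
qed

section \<open>Reflections, translations and iterated norms\<close>

lemma lborel_distr_minus: "distr lborel borel (\<lambda>x. z - x) = (lborel :: 'a::euclidean_space measure)"
proof -
  have "lborel = density (distr lborel borel (\<lambda>x. z + (- 1) *\<^sub>R x)) (\<lambda>_. ennreal (\<bar>- 1\<bar> ^ DIM('a)))"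
    by (rule lborel_affine) simp
  then show ?thesis by (simp add: density_1)
qed

lemma nn_integral_lborel_minus:
  fixes f :: "'a::euclidean_space \<Rightarrow> ennreal"
  assumes [measurable]: "f \<in> borel_measurable borel"
  shows "(\<integral>\<^sup>+x. f (z - x) \<partial>lborel) = (\<integral>\<^sup>+x. f x \<partial>lborel)"
  by (subst (2) lborel_distr_minus[of z, symmetric], subst nn_integral_distr) auto

lemma lebesgue_integral_lborel_minus:
  fixes f :: "'a::euclidean_space \<Rightarrow> real"
  assumes [measurable]: "f \<in> borel_measurable borel"
  shows "(\<integral>x. f (z - x) \<partial>lborel) = (\<integral>x. f x \<partial>lborel)"
  by (subst (2) lborel_distr_minus[of z, symmetric], subst integral_distr) auto

lemma integrable_lborel_minus_iff:
  fixes f :: "'a::euclidean_space \<Rightarrow> real"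
  assumes [measurable]: "f \<in> borel_measurable borel"
  shows "integrable lborel (\<lambda>x. f (z - x)) \<longleftrightarrow> integrable lborel f"
  by (subst (2) lborel_distr_minus[of z, symmetric], subst integrable_distr_eq) auto

lemma lp_norm_translate:
  fixes f :: "'a::euclidean_space \<Rightarrow> ennreal"
  assumes [measurable]: "f \<in> borel_measurable borel"
  shows "lp_norm lborel p (\<lambda>x. f (x - c)) = lp_norm lborel p f"
proof -
  have "(\<integral>\<^sup>+x. ennreal_powr (f (x - c)) p \<partial>lborel) = (\<integral>\<^sup>+x. ennreal_powr (f x) p \<partial>lborel)"
    by (subst (2) lborel_distr_plus[of "- c", symmetric], subst nn_integral_distr) auto
  then show ?thesis by (simp add: lp_norm_def)
qed

text \<open>The first coordinate is outermost whatever the order of the exponents; the other order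
  of integration is obtained by swapping the coordinates of \<open>F\<close>.\<close>

definition mixed_lp :: "real \<Rightarrow> real \<Rightarrow> ('a::euclidean_space \<times> 'b::euclidean_space \<Rightarrow> ennreal) \<Rightarrow> ennreal" where
  "mixed_lp \<alpha> \<beta> F = lp_norm lborel \<alpha> (\<lambda>a. lp_norm lborel \<beta> (\<lambda>b. F (a, b)))"

lemma borel_measurable_slice_lp [measurable]:
  fixes F :: "'a::euclidean_space \<times> 'b::euclidean_space \<Rightarrow> ennreal"
  assumes [measurable]: "F \<in> borel_measurable borel"
  shows "(\<lambda>a. lp_norm lborel \<beta> (\<lambda>b. F (a, b))) \<in> borel_measurable borel"
proof -
  have "F \<in> borel_measurable (lborel \<Otimes>\<^sub>M lborel)"
    by (simp add: lborel_prod)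
  then have "(\<lambda>a. lp_norm lborel \<beta> (\<lambda>b. F (a, b))) \<in> borel_measurable lborel"
    by (intro borel_measurable_lp_norm lborel.sigma_finite_measure_axioms) simp
  then show ?thesis by simp
qed

lemma mixed_lp_one:
  fixes F :: "'a::euclidean_space \<times> 'b::euclidean_space \<Rightarrow> ennreal"
  assumes [measurable]: "F \<in> borel_measurable borel"
  shows "mixed_lp 1 1 F = (\<integral>\<^sup>+z. F z \<partial>lborel)"
  unfolding mixed_lp_def lp_norm_one
  by (subst lborel_prod[symmetric], subst lborel.nn_integral_fst[symmetric]) (auto simp: lborel_prod)

lemma AE_lborel_Pair:
  assumes "AE z in (lborel :: ('a::euclidean_space \<times> 'b::euclidean_space) measure). P z"
  shows "AE a in lborel. AE b in lborel. P (a, b)"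
  using assms unfolding lborel_prod[symmetric] by (rule lborel_pair.AE_pair)

lemma mixed_lp_mono_AE:
  assumes "AE z in lborel. F z \<le> G z" "0 < \<alpha>" "0 < \<beta>"
  shows "mixed_lp \<alpha> \<beta> F \<le> mixed_lp \<alpha> \<beta> G"
  unfolding mixed_lp_def
  by (rule lp_norm_mono_AE[OF \<open>0 < \<alpha>\<close>])
    (use AE_lborel_Pair[OF assms(1)] in \<open>eventually_elim, auto intro: lp_norm_mono_AE assms\<close>)

lemma mixed_lp_cmult:
  assumes [measurable]: "F \<in> borel_measurable borel" and "0 < \<alpha>" "0 < \<beta>"
  shows "mixed_lp \<alpha> \<beta> (\<lambda>z. c * F z) = c * mixed_lp \<alpha> \<beta> F"
  using assms by (simp add: mixed_lp_def lp_norm_cmult)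

lemma mixed_lp_add_le:
  assumes [measurable]: "F \<in> borel_measurable borel" "G \<in> borel_measurable borel"
    and r: "1 \<le> \<alpha>" "1 \<le> \<beta>"
  shows "mixed_lp \<alpha> \<beta> (\<lambda>z. F z + G z) \<le> mixed_lp \<alpha> \<beta> F + mixed_lp \<alpha> \<beta> G"
proof -
  have "mixed_lp \<alpha> \<beta> (\<lambda>z. F z + G z) \<le> lp_norm lborel \<alpha> (\<lambda>a. lp_norm lborel \<beta> (\<lambda>b. F (a, b)) + lp_norm lborel \<beta> (\<lambda>b. G (a, b)))"
    unfolding mixed_lp_def using r
    by (intro lp_norm_mono lp_norm_add_le lborel.sigma_finite_measure_axioms) auto
  also have "\<dots> \<le> mixed_lp \<alpha> \<beta> F + mixed_lp \<alpha> \<beta> G"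
    unfolding mixed_lp_def using r
    by (intro lp_norm_add_le lborel.sigma_finite_measure_axioms) auto
  finally show ?thesis .
qed

lemma mixed_lp_dominated_convergence:
  assumes [measurable]: "\<And>n. F n \<in> borel_measurable borel" "G \<in> borel_measurable borel"
    and le: "\<And>n. AE z in lborel. F n z \<le> G z" and fin: "mixed_lp \<alpha> \<beta> G < \<infinity>"
    and lim: "AE z in lborel. (\<lambda>n. F n z) \<longlonglongrightarrow> 0" and p: "0 < \<alpha>" "0 < \<beta>"
  shows "(\<lambda>n. mixed_lp \<alpha> \<beta> (F n)) \<longlonglongrightarrow> 0"
  unfolding mixed_lp_def
proof (rule lp_norm_dominated_convergence[where g = "\<lambda>a. lp_norm lborel \<beta> (\<lambda>b. G (a, b))"])
  show "AE a in lborel. lp_norm lborel \<beta> (\<lambda>b. F n (a, b)) \<le> lp_norm lborel \<beta> (\<lambda>b. G (a, b))" for n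
    using AE_lborel_Pair[OF le[of n]] by eventually_elim (rule lp_norm_mono_AE[OF \<open>0 < \<beta>\<close>])
  have "(\<integral>\<^sup>+a. ennreal_powr (lp_norm lborel \<beta> (\<lambda>b. G (a, b))) \<alpha> \<partial>lborel) \<noteq> \<infinity>"
    using fin p by (auto simp: mixed_lp_def lp_norm_def[of _ \<alpha>] less_top)
  then have "AE a in lborel. ennreal_powr (lp_norm lborel \<beta> (\<lambda>b. G (a, b))) \<alpha> \<noteq> \<infinity>"
    by (intro nn_integral_noteq_infinite) auto
  moreover have "AE a in lborel. AE b in lborel. \<forall>n. F n (a, b) \<le> G (a, b)"
    using le by (intro AE_lborel_Pair) (simp add: AE_all_countable)
  ultimately show "AE a in lborel. (\<lambda>n. lp_norm lborel \<beta> (\<lambda>b. F n (a, b))) \<longlonglongrightarrow> 0"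
    using AE_lborel_Pair[OF lim]
  proof eventually_elim
    case (elim a)
    show ?case
      by (rule lp_norm_dominated_convergence[where g = "\<lambda>b. G (a, b)"])
        (use elim p in \<open>auto simp: less_top[symmetric]\<close>)
  qed
qed (use fin p in \<open>auto simp: mixed_lp_def\<close>)

lemma lp_norm_indicator_cbox:
  fixes l u :: "'a::euclidean_space"
  assumes "0 < p"
  shows "lp_norm lborel p (indicator (cbox l u)) < \<infinity>"
proof -
  have "(\<lambda>x. ennreal_powr (indicator (cbox l u) x) p) = indicator (cbox l u)"
    by (auto simp: indicator_def)
  then show ?thesis
    using emeasure_lborel_cbox_finite[of l u] by (simp add: lp_norm_def)
qed

lemma mixed_lp_indicator_finite:
  assumes "bounded B" and p: "0 < \<alpha>" "0 < \<beta>"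
  shows "mixed_lp \<alpha> \<beta> (indicator B) < \<infinity>"
proof -
  obtain c where c: "B \<subseteq> cbox (- c) c"
    using assms(1) bounded_subset_cbox_symmetric by blast
  then have c': "B \<subseteq> cbox (- fst c) (fst c) \<times> cbox (- snd c) (snd c)"
    by (cases c) (simp add: cbox_Pair_eq)
  have "mixed_lp \<alpha> \<beta> (indicator B) \<le> mixed_lp \<alpha> \<beta> (\<lambda>z. indicator (cbox (- fst c) (fst c)) (fst z) * indicator (cbox (- snd c) (snd c)) (snd z))"
    using c' p by (intro mixed_lp_mono_AE AE_I2) (auto simp: indicator_def)
  also have "\<dots> = lp_norm lborel \<alpha> (\<lambda>a. indicator (cbox (- fst c) (fst c)) a * lp_norm lborel \<beta> (indicator (cbox (- snd c) (snd c))))"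
    unfolding mixed_lp_def using p by (simp add: lp_norm_cmult)
  also have "\<dots> = lp_norm lborel \<beta> (indicator (cbox (- snd c) (snd c))) * lp_norm lborel \<alpha> (indicator (cbox (- fst c) (fst c)))"
    using p by (simp add: mult.commute[of "indicator _ _"] lp_norm_cmult)
  also have "\<dots> < \<infinity>"
    using lp_norm_indicator_cbox[OF p(1), of "- fst c" "fst c"] lp_norm_indicator_cbox[OF p(2), of "- snd c" "snd c"]
    by (simp add: ennreal_mult_less_top)
  finally show ?thesis .
qed

lemma mixed_lp_Holder:
  fixes F G :: "'a::euclidean_space \<times> 'b::euclidean_space \<Rightarrow> ennreal"
  assumes [measurable]: "F \<in> borel_measurable borel" "G \<in> borel_measurable borel"
    and p: "1 < \<alpha>" "1 < \<alpha>'" "1 / \<alpha> + 1 / \<alpha>' = 1" "1 < \<beta>" "1 < \<beta>'" "1 / \<beta> + 1 / \<beta>' = 1"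
  shows "(\<integral>\<^sup>+z. F z * G z \<partial>lborel) \<le> mixed_lp \<alpha> \<beta> F * mixed_lp \<alpha>' \<beta>' G"
proof -
  have "(\<integral>\<^sup>+z. F z * G z \<partial>lborel) = (\<integral>\<^sup>+a. \<integral>\<^sup>+b. F (a, b) * G (a, b) \<partial>lborel \<partial>lborel)"
    by (subst lborel_prod[symmetric], subst lborel.nn_integral_fst[symmetric]) (auto simp: lborel_prod)
  also have "\<dots> \<le> (\<integral>\<^sup>+a. lp_norm lborel \<beta> (\<lambda>b. F (a, b)) * lp_norm lborel \<beta>' (\<lambda>b. G (a, b)) \<partial>lborel)"
    using p by (intro nn_integral_mono nn_integral_Holder) auto
  also have "\<dots> \<le> mixed_lp \<alpha> \<beta> F * mixed_lp \<alpha>' \<beta>' G"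
    unfolding mixed_lp_def using p by (intro nn_integral_Holder) auto
  finally show ?thesis .
qed

lemma nn_integral_finite_of_mixed_lp:
  fixes F :: "'a::euclidean_space \<times> 'b::euclidean_space \<Rightarrow> ennreal"
  assumes [measurable]: "F \<in> borel_measurable borel" and p: "1 < \<alpha>" "1 < \<beta>"
    and fin: "mixed_lp \<alpha> \<beta> F < \<infinity>" and B: "bounded B" "\<And>z. z \<notin> B \<Longrightarrow> F z = 0"
  shows "(\<integral>\<^sup>+z. F z \<partial>lborel) < \<infinity>"
proof -
  obtain c where c: "B \<subseteq> cbox (- c) c"
    using B(1) bounded_subset_cbox_symmetric by blast
  have "(\<integral>\<^sup>+z. F z \<partial>lborel) = (\<integral>\<^sup>+z. F z * indicator (cbox (- c) c) z \<partial>lborel)"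
    using c B(2) by (intro nn_integral_cong) (auto simp: indicator_def)
  also have "\<dots> \<le> mixed_lp \<alpha> \<beta> F * mixed_lp (\<alpha> / (\<alpha> - 1)) (\<beta> / (\<beta> - 1)) (indicator (cbox (- c) c))"
    using p by (intro mixed_lp_Holder) (auto simp: field_simps)
  also have "\<dots> < \<infinity>"
    using fin p mixed_lp_indicator_finite[OF bounded_cbox, of "\<alpha> / (\<alpha> - 1)" "\<beta> / (\<beta> - 1)" "-c" c]
    by (auto simp: ennreal_mult_less_top)
  finally show ?thesis .
qed

text \<open>The convolution is an average of translates of \<open>F\<close> with respect to the
  probability measure of density \<rho>. Minkowski's integral inequality is applied in the inner and
  then in the outer variable, and translations preserve both norms.\<close>

lemma mixed_lp_convolution_le:
  fixes F :: "'a::euclidean_space \<times> 'b::euclidean_space \<Rightarrow> ennreal" and \<rho> :: "'a \<times> 'b \<Rightarrow> ennreal"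
  assumes F[measurable]: "F \<in> borel_measurable borel" and \<rho>[measurable]: "\<rho> \<in> borel_measurable borel"
    and \<rho>1: "(\<integral>\<^sup>+w. \<rho> w \<partial>lborel) = 1" and p: "1 \<le> \<alpha>" "1 \<le> \<beta>"
  shows "mixed_lp \<alpha> \<beta> (\<lambda>z. \<integral>\<^sup>+w. \<rho> w * F (z - w) \<partial>lborel) \<le> mixed_lp \<alpha> \<beta> F"
proof -
  define M where "M = density lborel \<rho>"
  have setsM[measurable_cong]: "sets M = sets borel" by (simp add: M_def)
  have M1: "emeasure M (space M) = 1"
    using \<rho>1 by (simp add: M_def emeasure_density)
  interpret M: finite_measure M
    by standard (simp add: M1)
  have intM: "(\<integral>\<^sup>+w. h w \<partial>M) = (\<integral>\<^sup>+w. \<rho> w * h w \<partial>lborel)" if "h \<in> borel_measurable borel" for h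
    unfolding M_def using that by (intro nn_integral_density) auto
  have fst_meas[measurable]: "fst \<in> borel_measurable (borel :: ('a \<times> 'b) measure)"
    by (intro borel_measurable_continuous_onI continuous_on_fst continuous_on_id)
  define P where "P a = lp_norm lborel \<beta> (\<lambda>b. F (a, b))" for a
  have P[measurable]: "P \<in> borel_measurable borel"
    unfolding P_def by measurable
  have slice: "lp_norm lborel \<beta> (\<lambda>b. F ((a, b) - w)) = P (a - fst w)" for a w
    unfolding P_def using lp_norm_translate[of "\<lambda>b. F (a - fst w, b)" \<beta> "snd w"]
    by (simp add: minus_prod_def)
  have inner: "lp_norm lborel \<beta> (\<lambda>b. \<integral>\<^sup>+w. \<rho> w * F ((a, b) - w) \<partial>lborel) \<le> (\<integral>\<^sup>+w. P (a - fst w) \<partial>M)" for a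
  proof -
    have "lp_norm lborel \<beta> (\<lambda>b. \<integral>\<^sup>+w. F ((a, b) - w) \<partial>M) \<le> (\<integral>\<^sup>+w. lp_norm lborel \<beta> (\<lambda>b. F ((a, b) - w)) \<partial>M)"
      using p by (intro Minkowski_integral M.sigma_finite_measure_axioms lborel.sigma_finite_measure_axioms) auto
    then show ?thesis
      by (simp add: slice intM)
  qed
  have "mixed_lp \<alpha> \<beta> (\<lambda>z. \<integral>\<^sup>+w. \<rho> w * F (z - w) \<partial>lborel) \<le> lp_norm lborel \<alpha> (\<lambda>a. \<integral>\<^sup>+w. P (a - fst w) \<partial>M)"
    unfolding mixed_lp_def using p inner by (intro lp_norm_mono) auto
  also have "\<dots> \<le> (\<integral>\<^sup>+w. lp_norm lborel \<alpha> (\<lambda>a. P (a - fst w)) \<partial>M)"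
    using p by (intro Minkowski_integral M.sigma_finite_measure_axioms lborel.sigma_finite_measure_axioms) auto
  also have "\<dots> = mixed_lp \<alpha> \<beta> F"
    using M1 by (simp add: lp_norm_translate mixed_lp_def P_def[symmetric])
  finally show ?thesis .
qed

subsection \<open>Mollification\<close>

definition flat_exp :: "nat \<Rightarrow> real \<Rightarrow> real" where
  "flat_exp k s = (if 0 < s then exp (- 1 / s) / s ^ k else 0)"

text \<open>A single term of the exponential series bounds exp(1/s) from below. The quadratic decay
  is what makes \<open>flat_exp\<close> differentiable at 0 with derivative 0.\<close>

lemma flat_exp_le:
  fixes s :: real
  assumes "0 < s"
  shows "exp (- 1 / s) / s ^ k \<le> fact (k + 2) * s\<^sup>2"
proof -
  have "(1 / s) ^ (k + 2) / fact (k + 2) \<le> exp (1 / s)"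
  proof -
    have sm: "summable (\<lambda>n. (1 / s) ^ n /\<^sub>R fact n)"
      by (rule summable_exp_generic)
    have "(\<Sum>n\<in>{k + 2}. (1 / s) ^ n /\<^sub>R fact n) \<le> (\<Sum>n. (1 / s) ^ n /\<^sub>R fact n)"
      using assms by (intro Series.sum_le_suminf sm) auto
    then show ?thesis
      by (simp add: exp_def divide_inverse mult.commute)
  qed
  moreover define F E :: real where "F = fact (k + 2)" and "E = exp (1 / s)"
  ultimately have "1 / s ^ (k + 2) / F \<le> E" and pos: "0 < F" "0 < E"
    by (simp_all add: power_one_over)
  then have "1 \<le> F * s ^ (k + 2) * E"
    using assms by (simp add: pos_divide_le_eq mult_ac)
  then have "1 / E \<le> F * s ^ (k + 2)"
    using pos by (simp add: pos_divide_le_eq)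
  moreover have "exp (- 1 / s) = 1 / E"
    by (simp add: E_def exp_minus divide_inverse)
  ultimately have "exp (- 1 / s) / s ^ k \<le> F * s ^ (k + 2) / s ^ k"
    using assms by (intro divide_right_mono) auto
  then show ?thesis
    using assms by (simp add: F_def power_add power2_eq_square mult_ac)
qed

lemma flat_exp_has_derivative:
  "(flat_exp k has_field_derivative flat_exp (k + 2) s - real k * flat_exp (k + 1) s) (at s)"
proof (cases s "0 :: real" rule: linorder_cases)
  case less
  have "((\<lambda>s. 0) has_field_derivative 0) (at s)" by simp
  then have "(flat_exp k has_field_derivative 0) (at s)"
    by (rule has_field_derivative_transform_within_open[of _ _ _ "{..<0}"]) (use less in \<open>auto simp: flat_exp_def\<close>)
  then show ?thesis
    using less by (simp add: flat_exp_def)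
next
  case greater
  have "((\<lambda>s. exp (- 1 / s) / s ^ k) has_field_derivative
      (exp (- 1 / s) * (1 / s\<^sup>2) * s ^ k - exp (- 1 / s) * (real k * s ^ (k - Suc 0))) / (s ^ k * s ^ k)) (at s)"
    using greater by (auto intro!: derivative_eq_intros simp: power2_eq_square)
  moreover have eq: "real k * s ^ (k - Suc 0) = real k * s ^ k / s"
    using greater by (cases k) auto
  have "(exp (- 1 / s) * (1 / s\<^sup>2) * s ^ k - exp (- 1 / s) * (real k * s ^ (k - Suc 0))) / (s ^ k * s ^ k) =
      flat_exp (k + 2) s - real k * flat_exp (k + 1) s"
    unfolding eq using greater by (simp add: flat_exp_def field_simps power_add power2_eq_square)
  ultimately have "((\<lambda>s. exp (- 1 / s) / s ^ k) has_field_derivative flat_exp (k + 2) s - real k * flat_exp (k + 1) s) (at s)"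
    by simp
  then show ?thesis
    by (rule has_field_derivative_transform_within_open[of _ _ _ "{0<..}"]) (use greater in \<open>auto simp: flat_exp_def\<close>)
next
  case equal
  have bound: "\<bar>flat_exp k x\<bar> \<le> fact (k + 2) * x\<^sup>2" for x
    using flat_exp_le[of x k] by (auto simp: flat_exp_def)
  have zero: "flat_exp k 0 = 0" by (simp add: flat_exp_def)
  have le: "norm ((flat_exp k (0 + h) - flat_exp k 0) / h) \<le> fact (k + 2) * \<bar>h\<bar>" if "h \<noteq> 0" for h
  proof -
    have "\<bar>flat_exp k h\<bar> / \<bar>h\<bar> \<le> (fact (k + 2) * h\<^sup>2) / \<bar>h\<bar>"
      by (intro divide_right_mono bound) auto
    also have "\<dots> = fact (k + 2) * \<bar>h\<bar>"
    proof -
      define a where "a = \<bar>h\<bar>"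
      have "a \<noteq> 0" "h\<^sup>2 = a * a" using that by (auto simp: a_def power2_eq_square)
      then show ?thesis unfolding a_def[symmetric] by simp
    qed
    finally show ?thesis
      by (simp add: zero del: fact_Suc)
  qed
  have "((\<lambda>h::real. fact (k + 2) * \<bar>h\<bar>) \<longlongrightarrow> fact (k + 2) * \<bar>0\<bar>) (at 0)"
    by (intro tendsto_intros)
  then have lim: "((\<lambda>h::real. fact (k + 2) * \<bar>h\<bar>) \<longlongrightarrow> 0) (at 0)" by simp
  have "(\<lambda>h. (flat_exp k (0 + h) - flat_exp k 0) / h) \<midarrow>0\<rightarrow> 0"
  proof (rule Lim_null_comparison[OF _ lim])
    show "\<forall>\<^sub>F h in at 0. norm ((flat_exp k (0 + h) - flat_exp k 0) / h) \<le> fact (k + 2) * \<bar>h\<bar>"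
      unfolding eventually_at_filter by (rule always_eventually) (use le in blast)
  qed
  then show ?thesis
    using equal by (simp add: DERIV_def flat_exp_def)
qed

text \<open>
  An algebra closed under directional derivatives, so that its members are smooth; the powers of
  \<open>s\<close> in \<open>flat_exp\<close> are there to express its own derivative.
\<close>

inductive_set smooth_bumps :: "('a::euclidean_space \<Rightarrow> real) set" where
  const: "(\<lambda>x. c) \<in> smooth_bumps"
| inner: "(\<lambda>x. (x - a) \<bullet> e) \<in> smooth_bumps"
| flat: "(\<lambda>x. flat_exp k (s - (x - a) \<bullet> (x - a))) \<in> smooth_bumps"
| add: "f \<in> smooth_bumps \<Longrightarrow> g \<in> smooth_bumps \<Longrightarrow> (\<lambda>x. f x + g x) \<in> smooth_bumps"
| mult: "f \<in> smooth_bumps \<Longrightarrow> g \<in> smooth_bumps \<Longrightarrow> (\<lambda>x. f x * g x) \<in> smooth_bumps"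

lemma smooth_bumps_deriv:
  assumes "f \<in> smooth_bumps"
  shows "\<exists>f'. (\<forall>x. (f has_derivative f' x) (at x)) \<and> (\<forall>e. (\<lambda>x. f' x e) \<in> smooth_bumps)"
  using assms
proof induction
  case (const c)
  show ?case
    by (intro exI[of _ "\<lambda>x e. 0"]) (auto intro: smooth_bumps.const)
next
  case (inner a e)
  show ?case
    by (intro exI[of _ "\<lambda>x h. h \<bullet> e"]) (auto intro: smooth_bumps.const intro!: derivative_eq_intros)
next
  case (flat k s a)
  define f' where "f' x h = (flat_exp (k + 2) (s - (x - a) \<bullet> (x - a)) + (- real k) * flat_exp (k + 1) (s - (x - a) \<bullet> (x - a))) *
     ((-2) * ((x - a) \<bullet> h))" for x h :: 'a
  have "((\<lambda>x. flat_exp k (s - (x - a) \<bullet> (x - a))) has_derivative f' x) (at x)" for x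
    unfolding f'_def
    by (rule has_derivative_eq_rhs, rule DERIV_compose_FDERIV[OF flat_exp_has_derivative])
      (auto intro!: derivative_eq_intros simp: inner_commute)
  moreover have "(\<lambda>x. f' x e) \<in> smooth_bumps" for e
    unfolding f'_def
    by (intro smooth_bumps.intros)
  ultimately show ?case by blast
next
  case (add f g)
  then obtain f' g' where "\<forall>x. (f has_derivative f' x) (at x)" "\<forall>e. (\<lambda>x. f' x e) \<in> smooth_bumps"
    "\<forall>x. (g has_derivative g' x) (at x)" "\<forall>e. (\<lambda>x. g' x e) \<in> smooth_bumps" by blast
  then show ?case
    by (intro exI[of _ "\<lambda>x h. f' x h + g' x h"]) (auto intro!: smooth_bumps.intros derivative_intros)
next
  case (mult f g)
  then obtain f' g' where fg: "\<forall>x. (f has_derivative f' x) (at x)" "\<forall>e. (\<lambda>x. f' x e) \<in> smooth_bumps"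
    "\<forall>x. (g has_derivative g' x) (at x)" "\<forall>e. (\<lambda>x. g' x e) \<in> smooth_bumps" by blast
  have "((\<lambda>x. f x * g x) has_derivative (\<lambda>h. f x * g' x h + f' x h * g x)) (at x)" for x
    using fg by (intro has_derivative_mult) auto
  moreover have "(\<lambda>x. f x * g' x e + f' x e * g x) \<in> smooth_bumps" for e
    using fg mult by (intro smooth_bumps.intros) auto
  ultimately show ?case
    by (intro exI[of _ "\<lambda>x h. f x * g' x h + f' x h * g x"]) blast
qed

lemma smooth_bumps_differentiable: "f \<in> smooth_bumps \<Longrightarrow> f differentiable (at x)"
  using smooth_bumps_deriv by (metis differentiableI)

lemma smooth_bumps_has_derivative:
  "f \<in> smooth_bumps \<Longrightarrow> (f has_derivative frechet_derivative f (at x)) (at x)"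
  using smooth_bumps_differentiable frechet_derivative_works by blast

lemma smooth_bumps_continuous_on: "f \<in> smooth_bumps \<Longrightarrow> continuous_on S f"
  by (simp add: continuous_at_imp_continuous_on differentiable_imp_continuous_within smooth_bumps_differentiable)

lemma smooth_bumps_frechet: "f \<in> smooth_bumps \<Longrightarrow> (\<lambda>x. frechet_derivative f (at x) e) \<in> smooth_bumps"
proof -
  assume "f \<in> smooth_bumps"
  then obtain f' where f': "\<And>x. (f has_derivative f' x) (at x)" "\<And>e. (\<lambda>x. f' x e) \<in> smooth_bumps"
    using smooth_bumps_deriv by blast
  have "frechet_derivative f (at x) = f' x" for x
    using frechet_derivative_at[OF f'(1)] by simp
  then show ?thesis using f'(2) by simp
qed

lemma smooth_bumps_C_k: "f \<in> smooth_bumps \<Longrightarrow> C_k n f"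
  by (induction n arbitrary: f)
    (auto simp: smooth_bumps_continuous_on smooth_bumps_differentiable smooth_bumps_frechet)

lemma smooth_bumps_bounded:
  assumes f: "f \<in> smooth_bumps" and supp: "\<And>x. r < norm x \<Longrightarrow> f x = 0"
  shows "\<exists>B\<ge>0. \<forall>x. \<bar>f x\<bar> \<le> B"
proof -
  have "bounded (f ` cball 0 r)"
    by (intro compact_imp_bounded compact_continuous_image smooth_bumps_continuous_on f compact_cball)
  then obtain B where B: "\<forall>x\<in>cball 0 r. \<bar>f x\<bar> \<le> B"
    unfolding bounded_iff by auto
  have "\<bar>f x\<bar> \<le> max 0 B" for x
    by (cases "norm x \<le> r") (use B supp[of x] in \<open>auto simp: le_max_iff_disj\<close>)
  then show ?thesis by (intro exI[of _ "max 0 B"]) auto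
qed

lemma smooth_bumps_frechet_support:
  assumes f: "f \<in> smooth_bumps" and supp: "\<And>x. r < norm x \<Longrightarrow> f x = 0" and x: "r < norm x"
  shows "frechet_derivative f (at x) e = 0"
proof -
  have "open {x :: 'a. r < norm x}"
    by (intro open_Collect_less continuous_intros)
  with has_derivative_const have "(f has_derivative (\<lambda>h. 0)) (at x)"
    by (rule has_derivative_transform_within_open[where f = "\<lambda>x. 0"]) (use x supp in auto)
  then have "(\<lambda>h. 0) = frechet_derivative f (at x)"
    by (rule frechet_derivative_at)
  then show ?thesis by (metis (full_types))
qed

lemma smooth_bumps_Lipschitz:
  assumes f: "f \<in> smooth_bumps" and supp: "\<And>x. r < norm x \<Longrightarrow> f x = 0"
  shows "\<exists>L\<ge>0. \<forall>x y. \<bar>f x - f y\<bar> \<le> L * norm (x - y)"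
proof -
  have "\<exists>B\<ge>0. \<forall>x. \<bar>frechet_derivative f (at x) e\<bar> \<le> B" for e
    by (rule smooth_bumps_bounded[OF smooth_bumps_frechet[OF f] smooth_bumps_frechet_support[OF f supp]])
  then obtain B where B: "\<And>e. 0 \<le> B e" "\<And>e x. \<bar>frechet_derivative f (at x) e\<bar> \<le> B e"
    by metis
  define L where "L = (\<Sum>e\<in>Basis. B e)"
  have "onorm (frechet_derivative f (at x)) \<le> L" for x
  proof (rule onorm_le)
    fix h
    have lin: "linear (frechet_derivative f (at x))"
      using smooth_bumps_differentiable[OF f] by (rule linear_frechet_derivative)
    have "frechet_derivative f (at x) h = (\<Sum>e\<in>Basis. (h \<bullet> e) * frechet_derivative f (at x) e)"
      by (subst euclidean_representation[symmetric], subst linear_sum[OF lin])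
        (simp add: linear_cmul[OF lin])
    also have "norm \<dots> \<le> (\<Sum>e\<in>Basis. norm h * B e)"
      by (intro order_trans[OF norm_sum] sum_mono)
        (auto simp: abs_mult intro!: mult_mono B Basis_le_norm)
    finally show "norm (frechet_derivative f (at x) h) \<le> L * norm h"
      by (simp add: L_def sum_distrib_left mult.commute)
  qed
  then have "norm (f x - f y) \<le> L * norm (x - y)" for x y
    using smooth_bumps_differentiable[OF f]
    by (intro differentiable_bound[OF convex_UNIV, of f "\<lambda>x. frechet_derivative f (at x)"])
      (auto simp: frechet_derivative_works)
  moreover have "0 \<le> L" unfolding L_def by (intro sum_nonneg B)
  ultimately show ?thesis by (intro exI[of _ L]) auto
qed

text \<open>The mean value inequality for f minus its linear part at x, with the Lipschitz bounds of
  the partial derivatives. Uniformity in x allows a convolution with a merely integrable function to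
  be differentiated.\<close>

lemma smooth_bumps_Taylor:
  assumes f: "f \<in> smooth_bumps" and supp: "\<And>x. r < norm x \<Longrightarrow> f x = 0"
  shows "\<exists>L\<ge>0. \<forall>x y. \<bar>f y - f x - frechet_derivative f (at x) (y - x)\<bar> \<le> L * (norm (y - x))\<^sup>2"
proof -
  have "\<exists>B\<ge>0. \<forall>x y. \<bar>frechet_derivative f (at x) e - frechet_derivative f (at y) e\<bar> \<le> B * norm (x - y)" for e
    by (rule smooth_bumps_Lipschitz[OF smooth_bumps_frechet[OF f] smooth_bumps_frechet_support[OF f supp]])
  then obtain B where B: "\<And>e. 0 \<le> B e"
    "\<And>e x y. \<bar>frechet_derivative f (at x) e - frechet_derivative f (at y) e\<bar> \<le> B e * norm (x - y)"
    by metis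
  define L where "L = (\<Sum>e\<in>Basis. B e)"
  have lin: "linear (frechet_derivative f (at x))" for x
    using smooth_bumps_differentiable[OF f] by (rule linear_frechet_derivative)
  have *: "norm (frechet_derivative f (at y) h - frechet_derivative f (at x) h) \<le> L * norm (y - x) * norm h" for x y h
  proof -
    have "frechet_derivative f (at x) h = (\<Sum>e\<in>Basis. (h \<bullet> e) * frechet_derivative f (at x) e)" for x
      by (subst euclidean_representation[symmetric], subst linear_sum[OF lin])
        (simp add: linear_cmul[OF lin])
    then have "frechet_derivative f (at y) h - frechet_derivative f (at x) h =
      (\<Sum>e\<in>Basis. (h \<bullet> e) * (frechet_derivative f (at y) e - frechet_derivative f (at x) e))"
      by (simp add: sum_subtractf[symmetric] right_diff_distrib)
    also have "norm \<dots> \<le> (\<Sum>e\<in>Basis. norm h * (B e * norm (y - x)))"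
      by (intro order_trans[OF norm_sum] sum_mono)
        (auto simp: abs_mult intro!: mult_mono B Basis_le_norm)
    finally show ?thesis
      by (simp add: L_def sum_distrib_left sum_distrib_right mult_ac)
  qed
  have "\<bar>f y - f x - frechet_derivative f (at x) (y - x)\<bar> \<le> L * (norm (y - x))\<^sup>2" for x y
  proof -
    define g where "g z = f z - frechet_derivative f (at x) z" for z
    have g: "(g has_derivative (\<lambda>h. frechet_derivative f (at z) h - frechet_derivative f (at x) h)) (at z within S)" for z S
      unfolding g_def
      by (rule has_derivative_diff[OF has_derivative_at_withinI[OF smooth_bumps_has_derivative[OF f]]
            linear_imp_has_derivative[OF lin]])
    have "norm (g y - g x) \<le> (L * norm (y - x)) * norm (y - x)"
    proof (rule differentiable_bound[OF convex_closed_segment[of x y] g])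
      fix z assume z: "z \<in> closed_segment x y"
      have L: "0 \<le> L" unfolding L_def by (intro sum_nonneg B)
      show "onorm (\<lambda>h. frechet_derivative f (at z) h - frechet_derivative f (at x) h) \<le> L * norm (y - x)"
      proof (rule onorm_le)
        fix h
        have "norm (z - x) \<le> norm (y - x)"
          using z by (metis dist_commute dist_in_closed_segment(1) dist_norm)
        then show "norm (frechet_derivative f (at z) h - frechet_derivative f (at x) h) \<le> L * norm (y - x) * norm h"
          using *[of z h x] L by (meson mult_left_mono mult_right_mono norm_ge_zero order_trans)
      qed
    qed auto
    then show ?thesis
      by (simp add: g_def linear_diff[OF lin] power2_eq_square algebra_simps)
  qed
  moreover have "0 \<le> L" unfolding L_def by (intro sum_nonneg B)
  ultimately show ?thesis by (intro exI[of _ L]) auto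
qed

text \<open>Each radius has its own profile instead of a dilation of a fixed one: what matters is
  positivity, unit mass and support in the ball of radius r. Being radial makes the kernel invariant
  under the exchange of time and space.\<close>

definition kernel :: "real \<Rightarrow> 'a::euclidean_space \<Rightarrow> real" where
  "kernel r z = flat_exp 0 (r\<^sup>2 - z \<bullet> z) / (\<integral>w. flat_exp 0 (r\<^sup>2 - w \<bullet> (w :: 'a)) \<partial>lborel)"

lemma kernel_smooth_bumps: "kernel r \<in> smooth_bumps"
proof -
  have "(\<lambda>z. inverse (\<integral>w. flat_exp 0 (r\<^sup>2 - w \<bullet> (w :: 'a)) \<partial>lborel) * flat_exp 0 (r\<^sup>2 - (z - 0) \<bullet> (z - (0 :: 'a)))) \<in> smooth_bumps"
    by (intro smooth_bumps.mult smooth_bumps.const smooth_bumps.flat)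
  then show ?thesis
    unfolding kernel_def[abs_def] by (simp add: divide_inverse mult.commute)
qed

lemma flat_exp_pos_iff: "0 < flat_exp 0 (r\<^sup>2 - z \<bullet> z) \<longleftrightarrow> norm z < \<bar>r\<bar>"
proof -
  have "norm z < \<bar>r\<bar> \<longleftrightarrow> (norm z)\<^sup>2 < r\<^sup>2"
    by (metis abs_le_square_iff abs_norm_cancel not_le)
  then show ?thesis by (simp add: flat_exp_def power2_norm_eq_inner)
qed

lemma flat_exp_nonneg: "0 \<le> flat_exp k s"
  by (simp add: flat_exp_def)

lemma kernel_nonneg: "0 \<le> kernel r z"
  unfolding kernel_def by (intro divide_nonneg_nonneg integral_nonneg_AE AE_I2 flat_exp_nonneg)

lemma flat_exp_eq_0: "r < norm z \<Longrightarrow> 0 < r \<Longrightarrow> flat_exp 0 (r\<^sup>2 - z \<bullet> z) = 0"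
  using flat_exp_pos_iff[of r z] flat_exp_nonneg[of 0 "r\<^sup>2 - z \<bullet> z"] by auto

lemma kernel_support: "0 < r \<Longrightarrow> r < norm z \<Longrightarrow> kernel r z = 0"
  by (simp add: kernel_def flat_exp_eq_0)

lemma borel_measurable_kernel [measurable]: "kernel r \<in> borel_measurable borel"
  by (intro borel_measurable_continuous_onI smooth_bumps_continuous_on kernel_smooth_bumps)

lemma flat_exp_inner_smooth_bumps: "(\<lambda>w. flat_exp 0 (s - w \<bullet> w)) \<in> smooth_bumps"
  using smooth_bumps.flat[of 0 s 0] by simp

lemma integrable_compactly_supported:
  fixes f :: "'a::euclidean_space \<Rightarrow> real"
  assumes "continuous_on UNIV f" and "\<And>z. r < norm z \<Longrightarrow> f z = 0"
  shows "integrable lborel f"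
proof -
  have "integrable lborel (\<lambda>x. indicator (cball 0 r) x *\<^sub>R f x)"
    using assms(1) by (intro borel_integrable_compact compact_cball) (rule continuous_on_subset, auto)
  moreover have "(\<lambda>x. indicator (cball 0 r) x *\<^sub>R f x) = f"
  proof
    fix x show "indicator (cball 0 r) x *\<^sub>R f x = f x"
      by (cases "norm x \<le> r") (use assms(2)[of x] in auto)
  qed
  ultimately show ?thesis by simp
qed

lemma flat_exp_integral_pos:
  assumes "0 < r"
  shows "0 < (\<integral>w. flat_exp 0 (r\<^sup>2 - w \<bullet> (w :: 'a::euclidean_space)) \<partial>lborel)"
proof -
  let ?f = "\<lambda>w :: 'a. flat_exp 0 (r\<^sup>2 - w \<bullet> w)"
  have int: "integrable lborel ?f"
    by (rule integrable_compactly_supported[where r = r])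
      (use assms flat_exp_eq_0 in \<open>auto intro: smooth_bumps_continuous_on flat_exp_inner_smooth_bumps\<close>)
  have "emeasure lborel (ball (0 :: 'a) r) \<noteq> 0"
    using content_ball_pos[OF assms, of "0 :: 'a"] by (auto simp: measure_def)
  then have "\<not> (AE w in lborel. ?f w = 0)"
  proof (rule contrapos_nn)
    assume "AE w in lborel. ?f w = 0"
    then have "AE w in lborel. w \<notin> ball (0 :: 'a) r"
    proof eventually_elim
      case (elim w)
      then show ?case using flat_exp_pos_iff[of r w] assms by auto
    qed
    then show "emeasure lborel (ball (0 :: 'a) r) = 0"
      by (subst (asm) AE_iff_measurable[OF _ refl]) (auto simp: ball_def)
  qed
  then have "(\<integral>w. ?f w \<partial>lborel) \<noteq> 0"
    using integral_nonneg_eq_0_iff_AE[OF int] flat_exp_nonneg by auto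
  moreover have "0 \<le> (\<integral>w. ?f w \<partial>lborel)"
    by (intro integral_nonneg_AE AE_I2 flat_exp_nonneg)
  ultimately show ?thesis by simp
qed

lemma integrable_kernel: "0 < r \<Longrightarrow> integrable lborel (kernel r)"
  by (rule integrable_compactly_supported[where r = r])
    (auto intro: smooth_bumps_continuous_on kernel_smooth_bumps kernel_support)

lemma integral_kernel: "0 < r \<Longrightarrow> (\<integral>w. kernel r w \<partial>(lborel :: 'a::euclidean_space measure)) = 1"
  using flat_exp_integral_pos[of r, where 'a = 'a] by (simp add: kernel_def)

lemma nn_integral_kernel: "0 < r \<Longrightarrow> (\<integral>\<^sup>+w. ennreal (kernel r w) \<partial>lborel) = 1"
  by (subst nn_integral_eq_integral[OF integrable_kernel]) (auto simp: kernel_nonneg integral_kernel)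

section \<open>Mollification of integrable functions\<close>

definition mollify :: "real \<Rightarrow> ('a::euclidean_space \<Rightarrow> real) \<Rightarrow> 'a \<Rightarrow> real" where
  "mollify r f z = (\<integral>w. kernel r (z - w) * f w \<partial>lborel)"

lemma integrable_bump_mult:
  fixes f :: "'a::euclidean_space \<Rightarrow> real"
  assumes \<kappa>: "\<kappa> \<in> smooth_bumps" "\<And>x. r < norm x \<Longrightarrow> \<kappa> x = 0" and f: "integrable lborel f"
  shows "integrable lborel (\<lambda>w. \<kappa> (z - w) * f w)"
proof -
  obtain B where B: "0 \<le> B" "\<And>x. \<bar>\<kappa> x\<bar> \<le> B"
    using smooth_bumps_bounded[OF \<kappa>] by blast
  have [measurable]: "\<kappa> \<in> borel_measurable borel"
    by (intro borel_measurable_continuous_onI smooth_bumps_continuous_on \<kappa>)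
  have [measurable]: "f \<in> borel_measurable borel" using f by simp
  show ?thesis
  proof (rule Bochner_Integration.integrable_bound)
    show "integrable lborel (\<lambda>w. B * f w)" using f by simp
    show "AE w in lborel. norm (\<kappa> (z - w) * f w) \<le> norm (B * f w)"
      using B by (intro AE_I2) (auto simp: abs_mult intro!: mult_right_mono)
  qed measurable
qed

text \<open>The quadratic Taylor remainder, integrated against \<bar>f\<bar>, is still quadratic in
  the increment.\<close>

lemma bump_convolution_has_derivative:
  fixes f :: "'a::euclidean_space \<Rightarrow> real"
  assumes \<kappa>: "\<kappa> \<in> smooth_bumps" and supp: "\<And>x. r < norm x \<Longrightarrow> \<kappa> x = 0" and f: "integrable lborel f"
  shows "((\<lambda>z. \<integral>w. \<kappa> (z - w) * f w \<partial>lborel) has_derivative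
    (\<lambda>h. \<integral>w. frechet_derivative \<kappa> (at (z - w)) h * f w \<partial>lborel)) (at z)"
proof -
  obtain L where L: "0 \<le> L" "\<And>x y. \<bar>\<kappa> y - \<kappa> x - frechet_derivative \<kappa> (at x) (y - x)\<bar> \<le> L * (norm (y - x))\<^sup>2"
    using smooth_bumps_Taylor[OF \<kappa> supp] by blast
  define F where "F z = (\<integral>w. \<kappa> (z - w) * f w \<partial>lborel)" for z
  define D where "D h = (\<integral>w. frechet_derivative \<kappa> (at (z - w)) h * f w \<partial>lborel)" for h
  define C where "C = L * (\<integral>w. \<bar>f w\<bar> \<partial>lborel)"
  have int: "integrable lborel (\<lambda>w. \<kappa> (z - w) * f w)" for z
    by (rule integrable_bump_mult[OF \<kappa> supp f])
  have int': "integrable lborel (\<lambda>w. frechet_derivative \<kappa> (at (z - w)) h * f w)" for h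
    by (rule integrable_bump_mult[OF smooth_bumps_frechet[OF \<kappa>] smooth_bumps_frechet_support[OF \<kappa> supp] f])
  have lin: "linear (frechet_derivative \<kappa> (at x))" for x
    using smooth_bumps_differentiable[OF \<kappa>] by (rule linear_frechet_derivative)
  have "linear D"
  proof (rule linearI)
    fix h k :: 'a and c :: real
    show "D (h + k) = D h + D k"
      unfolding D_def using int'
      by (subst Bochner_Integration.integral_add[symmetric]) (auto simp: linear_add[OF lin] distrib_right)
    show "D (c *\<^sub>R h) = c *\<^sub>R D h"
      unfolding D_def by (simp add: linear_cmul[OF lin] mult.assoc)
  qed
  have bound: "\<bar>F y - F z - D (y - z)\<bar> \<le> C * (norm (y - z))\<^sup>2" for y
  proof -
    have "F y - F z - D (y - z) = (\<integral>w. (\<kappa> (y - w) - \<kappa> (z - w) - frechet_derivative \<kappa> (at (z - w)) (y - z)) * f w \<partial>lborel)"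
      unfolding F_def D_def using int int'
      by (simp add: left_diff_distrib)
    also have "\<bar>\<dots>\<bar> \<le> (\<integral>w. L * (norm (y - z))\<^sup>2 * \<bar>f w\<bar> \<partial>lborel)"
    proof (rule integral_abs_bound_integral)
      show "integrable lborel (\<lambda>w. (\<kappa> (y - w) - \<kappa> (z - w) - frechet_derivative \<kappa> (at (z - w)) (y - z)) * f w)"
        using int int' by (simp add: left_diff_distrib)
      show "integrable lborel (\<lambda>w. L * (norm (y - z))\<^sup>2 * \<bar>f w\<bar>)" using f by simp
      fix w
      have "\<bar>\<kappa> (y - w) - \<kappa> (z - w) - frechet_derivative \<kappa> (at (z - w)) (y - z)\<bar> \<le> L * (norm (y - z))\<^sup>2"
        using L(2)[of "y - w" "z - w"] by simp
      then show "\<bar>(\<kappa> (y - w) - \<kappa> (z - w) - frechet_derivative \<kappa> (at (z - w)) (y - z)) * f w\<bar> \<le> L * (norm (y - z))\<^sup>2 * \<bar>f w\<bar>"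
        by (simp add: abs_mult mult_right_mono)
    qed
    also have "\<dots> = C * (norm (y - z))\<^sup>2" by (simp add: C_def)
    finally show ?thesis .
  qed
  have "(F has_derivative D) (at z)"
    unfolding has_derivative_iff_norm
  proof
    show "bounded_linear D" using \<open>linear D\<close> by (rule linear_conv_bounded_linear[THEN iffD1])
    have lim: "((\<lambda>y. C * norm (y - z)) \<longlongrightarrow> 0) (at z)"
      by (rule tendsto_eq_intros | simp)+
    show "((\<lambda>y. norm (F y - F z - D (y - z)) / norm (y - z)) \<longlongrightarrow> 0) (at z)"
    proof (rule Lim_null_comparison[OF _ lim])
      have "norm (norm (F y - F z - D (y - z)) / norm (y - z)) \<le> C * norm (y - z)" if "y \<noteq> z" for y
        using bound[of y] that by (simp add: divide_le_eq power2_eq_square mult.assoc)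
      then show "\<forall>\<^sub>F y in at z. norm (norm (F y - F z - D (y - z)) / norm (y - z)) \<le> C * norm (y - z)"
        unfolding eventually_at_filter by (intro always_eventually) auto
    qed
  qed
  then show ?thesis unfolding F_def D_def .
qed

lemma mollify_has_derivative:
  assumes "0 < r" "integrable lborel f"
  shows "(mollify r f has_derivative (\<lambda>h. \<integral>w. frechet_derivative (kernel r) (at (z - w)) h * f w \<partial>lborel)) (at z)"
  unfolding mollify_def[abs_def] using assms
  by (intro bump_convolution_has_derivative[where r = r] kernel_smooth_bumps kernel_support)

lemma continuous_on_mollify:
  assumes "0 < r" "integrable lborel f"
  shows "continuous_on S (mollify r f)"
  using mollify_has_derivative[OF assms] by (meson has_derivative_continuous continuous_at_imp_continuous_on)

lemma integrable_mollify_kernel: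
  assumes "0 < r" "integrable lborel f"
  shows "integrable lborel (\<lambda>w. kernel r (z - w) * f w)"
  using assms by (intro integrable_bump_mult[where r = r] kernel_smooth_bumps kernel_support)

lemma mollify_mono:
  assumes "0 < r" "integrable lborel f" "integrable lborel g" "AE w in lborel. f w \<le> g w"
  shows "mollify r f z \<le> mollify r g z"
  unfolding mollify_def using assms(4)
  by (intro integral_mono_AE integrable_mollify_kernel assms) (auto intro: mult_left_mono kernel_nonneg)

lemma abs_mollify_le:
  assumes "0 < r" "integrable lborel f"
  shows "\<bar>mollify r f z\<bar> \<le> mollify r (\<lambda>w. \<bar>f w\<bar>) z"
  unfolding mollify_def
  by (intro integral_abs_bound_integral integrable_mollify_kernel integrable_abs assms)
    (simp add: abs_mult kernel_nonneg)

lemma mollify_diff: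
  assumes "0 < r" "integrable lborel f" "integrable lborel g"
  shows "mollify r (\<lambda>w. f w - g w) z = mollify r f z - mollify r g z"
  unfolding mollify_def using integrable_mollify_kernel[OF assms(1,2)] integrable_mollify_kernel[OF assms(1,3)]
  by (simp add: right_diff_distrib)

text \<open>Puts the mollification into the form in which \<open>mixed_lp_convolution_le\<close>
  applies.\<close>

lemma ennreal_mollify:
  assumes r: "0 < r" and f: "integrable lborel f" and nonneg: "\<And>w. 0 \<le> f w"
  shows "ennreal (mollify r f z) = (\<integral>\<^sup>+w. ennreal (kernel r w) * ennreal (f (z - w)) \<partial>lborel)"
proof -
  have [measurable]: "f \<in> borel_measurable borel" using f by simp
  have "ennreal (mollify r f z) = (\<integral>\<^sup>+w. ennreal (kernel r (z - w) * f w) \<partial>lborel)"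
    unfolding mollify_def using nonneg
    by (intro nn_integral_eq_integral[symmetric] integrable_mollify_kernel r f) (auto simp: kernel_nonneg)
  also have "\<dots> = (\<integral>\<^sup>+w. ennreal (kernel r w) * ennreal (f (z - w)) \<partial>lborel)"
    using nonneg
    by (subst nn_integral_lborel_minus[of _ z, symmetric]) (auto simp: ennreal_mult' kernel_nonneg intro!: nn_integral_cong)
  finally show ?thesis .
qed

lemma mollify_close:
  assumes r: "0 < r" and f: "integrable lborel f" and close: "\<And>w. norm (z - w) \<le> r \<Longrightarrow> \<bar>f w - c\<bar> \<le> e"
  shows "\<bar>mollify r f z - c\<bar> \<le> e"
proof -
  have [measurable]: "f \<in> borel_measurable borel" using f by simp
  have k: "integrable lborel (\<lambda>w. kernel r (z - w))" "(\<integral>w. kernel r (z - w) \<partial>lborel) = 1"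
    using integrable_kernel[OF r] integral_kernel[OF r]
    by (simp_all add: integrable_lborel_minus_iff lebesgue_integral_lborel_minus)
  have "mollify r f z - c = (\<integral>w. kernel r (z - w) * f w \<partial>lborel) - (\<integral>w. kernel r (z - w) * c \<partial>lborel)"
    using k by (simp add: mollify_def)
  also have "\<dots> = (\<integral>w. kernel r (z - w) * (f w - c) \<partial>lborel)"
    using k integrable_mollify_kernel[OF r f, of z] by (simp add: right_diff_distrib)
  also have "\<bar>\<dots>\<bar> \<le> (\<integral>w. kernel r (z - w) * e \<partial>lborel)"
  proof (rule integral_abs_bound_integral)
    show "integrable lborel (\<lambda>w. kernel r (z - w) * (f w - c))"
      using k integrable_mollify_kernel[OF r f, of z] by (simp add: right_diff_distrib)
    show "integrable lborel (\<lambda>w. kernel r (z - w) * e)" using k by simp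
    show "\<bar>kernel r (z - w) * (f w - c)\<bar> \<le> kernel r (z - w) * e" for w
      using close[of w] kernel_support[OF r, of "z - w"] kernel_nonneg[of r "z - w"]
      by (cases "norm (z - w) \<le> r") (auto simp: abs_mult intro!: mult_left_mono)
  qed
  also have "\<dots> = e" using k by simp
  finally show ?thesis .
qed

lemma mixed_lp_mollify_le:
  fixes f :: "'a::euclidean_space \<times> 'b::euclidean_space \<Rightarrow> real"
  assumes "0 < r" "integrable lborel f" and p: "1 \<le> \<alpha>" "1 \<le> \<beta>"
  shows "mixed_lp \<alpha> \<beta> (\<lambda>z. ennreal \<bar>mollify r f z\<bar>) \<le> mixed_lp \<alpha> \<beta> (\<lambda>z. ennreal \<bar>f z\<bar>)"
proof -
  have [measurable]: "f \<in> borel_measurable borel" using assms by simp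
  have "mixed_lp \<alpha> \<beta> (\<lambda>z. ennreal \<bar>mollify r f z\<bar>) \<le> mixed_lp \<alpha> \<beta> (\<lambda>z. ennreal (mollify r (\<lambda>w. \<bar>f w\<bar>) z))"
    using p by (intro mixed_lp_mono_AE AE_I2 ennreal_leI abs_mollify_le assms) auto
  also have "\<dots> = mixed_lp \<alpha> \<beta> (\<lambda>z. \<integral>\<^sup>+w. ennreal (kernel r w) * ennreal \<bar>f (z - w)\<bar> \<partial>lborel)"
    using assms by (subst ennreal_mollify) auto
  also have "\<dots> \<le> mixed_lp \<alpha> \<beta> (\<lambda>z. ennreal \<bar>f z\<bar>)"
    using assms by (intro mixed_lp_convolution_le nn_integral_kernel) auto
  finally show ?thesis .
qed

text \<open>A measurable function is an a.e. limit of continuous ones. Clamping and cutting these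
  off makes dominated convergence available in the mixed norm.\<close>

lemma mixed_lp_continuous_approx_bounded:
  fixes f :: "'a::euclidean_space \<times> 'b::euclidean_space \<Rightarrow> real"
  assumes [measurable]: "f \<in> borel_measurable borel" and p: "0 < \<alpha>" "0 < \<beta>"
    and k: "0 \<le> k" "\<And>z. \<bar>f z\<bar> \<le> k" "\<And>z. k < norm z \<Longrightarrow> f z = 0" and e: "0 < e"
  obtains g where "continuous_on UNIV g" "\<And>z. k + 1 < norm z \<Longrightarrow> g z = 0"
    "mixed_lp \<alpha> \<beta> (\<lambda>z. ennreal \<bar>f z - g z\<bar>) < e"
proof -
  have "f \<in> borel_measurable lebesgue"
    by (simp add: measurable_completion)
  then have "f measurable_on UNIV"
    by (intro lebesgue_measurable_imp_measurable_on) auto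
  then obtain N g where N: "negligible N" and g: "\<And>n. continuous_on UNIV (g n)"
    and lim: "\<And>z. z \<notin> N \<Longrightarrow> (\<lambda>n::nat. g n z) \<longlonglongrightarrow> f z"
    unfolding measurable_on_def by auto
  \<comment> \<open>\<open>k\<close> bounds both the height and the support of \<open>f\<close>. The
    clamp to [-k, k] and the cutoff, which is 1 on the ball of radius k and 0 beyond k + 1,
    therefore leave the limit \<open>f\<close> unchanged.\<close>
  define h where "h n z = max (- k) (min k (g n z)) * max 0 (min 1 (k + 1 - norm z))" for n z
  have h: "continuous_on UNIV (h n)" for n
    unfolding h_def by (intro continuous_intros continuous_on_max continuous_on_min g)
  have [measurable]: "h n \<in> borel_measurable borel" for n
    using h by (rule borel_measurable_continuous_onI)
  have h0: "h n z = 0" if "k + 1 < norm z" for n z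
    using that by (simp add: h_def)
  have hk: "\<bar>h n z\<bar> \<le> k" for n z
  proof -
    have "\<bar>h n z\<bar> \<le> k * 1"
      unfolding h_def abs_mult using k by (intro mult_mono) auto
    then show ?thesis by simp
  qed
  define B where "B = cball (0 :: 'a \<times> 'b) (k + 1)"
  have [measurable]: "B \<in> sets borel" by (simp add: B_def)
  have "(\<lambda>n. mixed_lp \<alpha> \<beta> (\<lambda>z. ennreal \<bar>f z - h n z\<bar>)) \<longlonglongrightarrow> 0"
  proof (rule mixed_lp_dominated_convergence[where G = "\<lambda>z. ennreal (2 * k) * indicator B z"])
    show "AE z in lborel. ennreal \<bar>f z - h n z\<bar> \<le> ennreal (2 * k) * indicator B z" for n
    proof (rule AE_I2)
      fix z
      show "ennreal \<bar>f z - h n z\<bar> \<le> ennreal (2 * k) * indicator B z"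
      proof (cases "z \<in> B")
        case True
        have "\<bar>f z - h n z\<bar> \<le> 2 * k"
          using k(2)[of z] hk[of n z] by linarith
        then show ?thesis using True by (simp add: ennreal_leI)
      next
        case False
        then show ?thesis using k h0[of z n] by (simp add: B_def)
      qed
    qed
    show "mixed_lp \<alpha> \<beta> (\<lambda>z. ennreal (2 * k) * indicator B z) < \<infinity>"
      using mixed_lp_indicator_finite[OF bounded_cball, of \<alpha> \<beta> "0 :: 'a \<times> 'b" "k + 1"] p
      by (simp add: mixed_lp_cmult ennreal_mult_less_top B_def[symmetric])
    have "AE z in lebesgue. z \<notin> N"
      using N by (intro AE_not_in) (simp add: negligible_iff_null_sets)
    then have "AE z in lborel. z \<notin> N"
      by (simp add: AE_completion_iff)
    then show "AE z in lborel. (\<lambda>n. ennreal \<bar>f z - h n z\<bar>) \<longlonglongrightarrow> 0"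
    proof eventually_elim
      case (elim z)
      have "(\<lambda>n. h n z) \<longlonglongrightarrow> max (- k) (min k (f z)) * max 0 (min 1 (k + 1 - norm z))"
        unfolding h_def by (intro tendsto_intros lim elim)
      also have "max (- k) (min k (f z)) * max 0 (min 1 (k + 1 - norm z)) = f z"
        using k(2)[of z] k(3)[of z] by (cases "norm z \<le> k") (auto simp: max_def min_def)
      finally have "(\<lambda>n. \<bar>f z - h n z\<bar>) \<longlonglongrightarrow> \<bar>f z - f z\<bar>"
        by (intro tendsto_intros)
      then show ?case
        using tendsto_ennrealI by fastforce
    qed
  qed (use p in auto)
  then have "eventually (\<lambda>n. mixed_lp \<alpha> \<beta> (\<lambda>z. ennreal \<bar>f z - h n z\<bar>) < e) sequentially"
    using e by (rule order_tendstoD)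
  then obtain n where "mixed_lp \<alpha> \<beta> (\<lambda>z. ennreal \<bar>f z - h n z\<bar>) < e"
    by (auto simp: eventually_sequentially)
  then show ?thesis using h h0 by (intro that[of "h n"])
qed

lemma ennreal_pos_lower_bound:
  assumes "(0 :: ennreal) < e"
  obtains \<epsilon> :: real where "0 < \<epsilon>" "ennreal \<epsilon> \<le> e"
proof (cases e)
  case (real x)
  then show ?thesis using assms by (intro that[of x]) (auto simp: ennreal_less_zero_iff)
next
  case top
  then show ?thesis by (intro that[of 1]) auto
qed

lemma mixed_lp_continuous_approx:
  fixes f :: "'a::euclidean_space \<times> 'b::euclidean_space \<Rightarrow> real"
  assumes [measurable]: "f \<in> borel_measurable borel" and p: "1 \<le> \<alpha>" "1 \<le> \<beta>"
    and fin: "mixed_lp \<alpha> \<beta> (\<lambda>z. ennreal \<bar>f z\<bar>) < \<infinity>" and e: "0 < e"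
  obtains g R where "continuous_on UNIV g" "\<And>z. R < norm z \<Longrightarrow> g z = 0"
    "mixed_lp \<alpha> \<beta> (\<lambda>z. ennreal \<bar>f z - g z\<bar>) < e"
proof -
  define F where "F k z = (if norm z \<le> real k then max (- real k) (min (real k) (f z)) else 0)" for k z
  have [measurable]: "F k \<in> borel_measurable borel" for k
    unfolding F_def by measurable
  obtain \<epsilon> where \<epsilon>: "0 < \<epsilon>" "ennreal \<epsilon> \<le> e"
    using ennreal_pos_lower_bound[OF e] .
  have e2: "0 < ennreal (\<epsilon> / 2)" using \<epsilon> by simp
  have "(\<lambda>k. mixed_lp \<alpha> \<beta> (\<lambda>z. ennreal \<bar>f z - F k z\<bar>)) \<longlonglongrightarrow> 0"
  proof (rule mixed_lp_dominated_convergence[where G = "\<lambda>z. ennreal \<bar>f z\<bar>"])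
    show "AE z in lborel. ennreal \<bar>f z - F k z\<bar> \<le> ennreal \<bar>f z\<bar>" for k
      by (intro AE_I2 ennreal_leI) (auto simp: F_def max_def min_def)
    show "AE z in lborel. (\<lambda>k. ennreal \<bar>f z - F k z\<bar>) \<longlonglongrightarrow> 0"
    proof (rule AE_I2)
      fix z
      obtain K where K: "max (norm z) \<bar>f z\<bar> \<le> real K" using real_arch_simple by blast
      have "F k z = f z" if "K \<le> k" for k
      proof -
        have "max (norm z) \<bar>f z\<bar> \<le> real k" using K that by linarith
        then show ?thesis by (auto simp: F_def)
      qed
      then have "eventually (\<lambda>k. 0 = ennreal \<bar>f z - F k z\<bar>) sequentially"
        by (intro eventually_sequentiallyI[of K]) simp
      then show "(\<lambda>k. ennreal \<bar>f z - F k z\<bar>) \<longlonglongrightarrow> 0"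
        by (rule Lim_transform_eventually[OF tendsto_const])
    qed
  qed (use p fin in auto)
  then have "eventually (\<lambda>k. mixed_lp \<alpha> \<beta> (\<lambda>z. ennreal \<bar>f z - F k z\<bar>) < ennreal (\<epsilon> / 2)) sequentially"
    using e2 by (rule order_tendstoD)
  then obtain k where k: "mixed_lp \<alpha> \<beta> (\<lambda>z. ennreal \<bar>f z - F k z\<bar>) < ennreal (\<epsilon> / 2)"
    by (auto simp: eventually_sequentially)
  obtain g where g: "continuous_on UNIV g" "\<And>z. real k + 1 < norm z \<Longrightarrow> g z = 0"
    "mixed_lp \<alpha> \<beta> (\<lambda>z. ennreal \<bar>F k z - g z\<bar>) < ennreal (\<epsilon> / 2)"
    by (rule mixed_lp_continuous_approx_bounded[of "F k" \<alpha> \<beta> "real k" "ennreal (\<epsilon> / 2)"])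
      (use p e2 in \<open>auto simp: F_def\<close>)
  have [measurable]: "g \<in> borel_measurable borel"
    using g(1) by (rule borel_measurable_continuous_onI)
  have "mixed_lp \<alpha> \<beta> (\<lambda>z. ennreal \<bar>f z - g z\<bar>) \<le> mixed_lp \<alpha> \<beta> (\<lambda>z. ennreal \<bar>f z - F k z\<bar> + ennreal \<bar>F k z - g z\<bar>)"
    using p by (intro mixed_lp_mono_AE AE_I2) (auto simp flip: ennreal_plus intro!: ennreal_leI)
  also have "\<dots> \<le> mixed_lp \<alpha> \<beta> (\<lambda>z. ennreal \<bar>f z - F k z\<bar>) + mixed_lp \<alpha> \<beta> (\<lambda>z. ennreal \<bar>F k z - g z\<bar>)"
    using p by (intro mixed_lp_add_le) auto
  also have "\<dots> < ennreal (\<epsilon> / 2) + ennreal (\<epsilon> / 2)"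
    using k g(3) by (rule add_strict_mono)
  also have "\<dots> = ennreal \<epsilon>"
    using \<epsilon> by (simp flip: ennreal_plus)
  also note \<epsilon>(2)
  finally show ?thesis using g by (intro that[of g "real k + 1"])
qed

text \<open>Since mollification is a contraction, \<open>f\<close> may be replaced by a nearby
  continuous function of compact support. For that function the convergence is uniform and takes
  place in a fixed ball, whose indicator has finite mixed norm.\<close>

lemma mollify_tendsto_mixed_lp:
  fixes f :: "'a::euclidean_space \<times> 'b::euclidean_space \<Rightarrow> real"
  assumes f: "integrable lborel f" and p: "1 \<le> \<alpha>" "1 \<le> \<beta>"
    and fin: "mixed_lp \<alpha> \<beta> (\<lambda>z. ennreal \<bar>f z\<bar>) < \<infinity>"
    and r: "\<And>n. 0 < r n" "r \<longlonglongrightarrow> 0"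
  shows "(\<lambda>n. mixed_lp \<alpha> \<beta> (\<lambda>z. ennreal \<bar>mollify (r n) f z - f z\<bar>)) \<longlonglongrightarrow> 0"
proof (rule order_tendstoI)
  fix e :: ennreal assume e: "0 < e"
  have fm[measurable]: "f \<in> borel_measurable borel" using f by simp
  have [measurable]: "mollify (r n) h \<in> borel_measurable borel" if "integrable lborel h" for n and h :: "'a \<times> 'b \<Rightarrow> real"
    using continuous_on_mollify[OF r(1) that] by (rule borel_measurable_continuous_onI)
  obtain \<epsilon> where \<epsilon>: "0 < \<epsilon>" "ennreal \<epsilon> \<le> e"
    using ennreal_pos_lower_bound[OF e] .
  have e4: "0 < ennreal (\<epsilon> / 4)" using \<epsilon> by simp
  obtain g R where g: "continuous_on UNIV g" "\<And>z. R < norm z \<Longrightarrow> g z = 0"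
    "mixed_lp \<alpha> \<beta> (\<lambda>z. ennreal \<bar>f z - g z\<bar>) < ennreal (\<epsilon> / 4)"
    by (rule mixed_lp_continuous_approx[OF fm p fin e4]) blast
  have gm[measurable]: "g \<in> borel_measurable borel"
    using g(1) by (rule borel_measurable_continuous_onI)
  have gint: "integrable lborel g"
    using g by (intro integrable_compactly_supported)
  define B where "B = cball (0 :: 'a \<times> 'b) (R + 1)"
  have [measurable]: "B \<in> sets borel" by (simp add: B_def)
  have B: "mixed_lp \<alpha> \<beta> (indicator B) < \<infinity>"
    using p by (intro mixed_lp_indicator_finite) (auto simp: B_def)
  obtain d where d: "0 < d" "ennreal d * mixed_lp \<alpha> \<beta> (indicator B) < ennreal (\<epsilon> / 4)"
  proof -
    obtain c where c: "mixed_lp \<alpha> \<beta> (indicator B) = ennreal c" "0 \<le> c"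
      using B by (cases "mixed_lp \<alpha> \<beta> (indicator B)") auto
    have "\<epsilon> / 4 / (c + 1) * c < \<epsilon> / 4"
      using \<epsilon> c by (simp add: field_simps)
    moreover have "0 < \<epsilon> / 4 / (c + 1)" using \<epsilon> c by simp
    ultimately show ?thesis
      using \<epsilon> c by (intro that[of "\<epsilon> / 4 / (c + 1)"]) (simp_all add: ennreal_less_iff flip: ennreal_mult)
  qed
  have "uniformly_continuous_on UNIV g"
  proof -
    have "uniformly_continuous_on (cball 0 (R + 2)) g"
      using g(1) by (intro compact_uniformly_continuous) (auto intro: continuous_on_subset)
    show ?thesis
      unfolding uniformly_continuous_on_def
    proof (intro allI impI)
      fix s :: real assume "0 < s"
      with \<open>uniformly_continuous_on (cball 0 (R + 2)) g\<close> obtain t where t: "0 < t"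
        "\<And>x x'. x \<in> cball 0 (R + 2) \<Longrightarrow> x' \<in> cball 0 (R + 2) \<Longrightarrow> dist x' x < t \<Longrightarrow> dist (g x') (g x) < s"
        unfolding uniformly_continuous_on_def by metis
      show "\<exists>d>0. \<forall>x\<in>UNIV. \<forall>x'\<in>UNIV. dist x' x < d \<longrightarrow> dist (g x') (g x) < s"
      proof (intro exI[of _ "min t 1"] conjI ballI impI)
        show "0 < min t 1" using t by simp
        fix x x' :: "'a \<times> 'b" assume xx: "dist x' x < min t 1"
        show "dist (g x') (g x) < s"
        proof (cases "norm x \<le> R + 2 \<and> norm x' \<le> R + 2")
          case True
          then show ?thesis using t xx by auto
        next
          case False
          have "norm x \<le> norm x' + dist x' x" "norm x' \<le> norm x + dist x' x"
            by (metis dist_norm norm_triangle_sub norm_minus_commute)+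
          then have "R < norm x" "R < norm x'" using False xx by auto
          then show ?thesis using g(2) \<open>0 < s\<close> by simp
        qed
      qed
    qed
  qed
  then obtain t where t: "0 < t" "\<And>x x'. dist x' x < t \<Longrightarrow> \<bar>g x' - g x\<bar> < d"
    unfolding uniformly_continuous_on_def dist_real_def using d(1) by (metis UNIV_I)
  have "eventually (\<lambda>n. r n < min t 1) sequentially"
    using r(2) t(1) by (intro order_tendstoD) auto
  then show "eventually (\<lambda>n. mixed_lp \<alpha> \<beta> (\<lambda>z. ennreal \<bar>mollify (r n) f z - f z\<bar>) < e) sequentially"
  proof eventually_elim
    case (elim n)
    have fg: "integrable lborel (\<lambda>z. f z - g z)" using f gint by simp
    have "ennreal \<bar>mollify (r n) f z - f z\<bar> \<le>
        ennreal \<bar>mollify (r n) (\<lambda>z. f z - g z) z\<bar> + (ennreal d * indicator B z + ennreal \<bar>f z - g z\<bar>)" for z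
    proof -
      have "\<bar>mollify (r n) g z - g z\<bar> \<le> d * indicator B z"
      proof (cases "z \<in> B")
        case True
        have "\<bar>mollify (r n) g z - g z\<bar> \<le> d"
        proof (rule mollify_close[OF r(1) gint])
          fix w assume "norm (z - w) \<le> r n"
          then have "dist w z < t" using elim by (simp add: dist_norm norm_minus_commute)
          then show "\<bar>g w - g z\<bar> \<le> d" using t(2) by fastforce
        qed
        then show ?thesis using True by simp
      next
        case False
        then have z: "R + 1 < norm z" by (simp add: B_def)
        have "\<bar>mollify (r n) g z - 0\<bar> \<le> 0"
        proof (rule mollify_close[OF r(1) gint])
          fix w assume "norm (z - w) \<le> r n"
          then have "R < norm w" using z elim norm_triangle_sub[of z w] by simp
          then show "\<bar>g w - 0\<bar> \<le> 0" using g(2) by simp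
        qed
        then show ?thesis using False z g(2) by simp
      qed
      then have "\<bar>mollify (r n) f z - f z\<bar> \<le> \<bar>mollify (r n) (\<lambda>z. f z - g z) z\<bar> + (d * indicator B z + \<bar>f z - g z\<bar>)"
        unfolding mollify_diff[OF r(1) f gint] by linarith
      then have "ennreal \<bar>mollify (r n) f z - f z\<bar> \<le> ennreal (\<bar>mollify (r n) (\<lambda>z. f z - g z) z\<bar> + (d * indicator B z + \<bar>f z - g z\<bar>))"
        by (rule ennreal_leI)
      then show ?thesis
        using d(1) by (simp add: ennreal_mult' ennreal_indicator)
    qed
    then have "mixed_lp \<alpha> \<beta> (\<lambda>z. ennreal \<bar>mollify (r n) f z - f z\<bar>) \<le> mixed_lp \<alpha> \<beta> (\<lambda>z.
        ennreal \<bar>mollify (r n) (\<lambda>z. f z - g z) z\<bar> + (ennreal d * indicator B z + ennreal \<bar>f z - g z\<bar>))"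
      using p by (intro mixed_lp_mono_AE AE_I2) auto
    also have "\<dots> \<le> mixed_lp \<alpha> \<beta> (\<lambda>z. ennreal \<bar>mollify (r n) (\<lambda>z. f z - g z) z\<bar>) +
        (mixed_lp \<alpha> \<beta> (\<lambda>z. ennreal d * indicator B z) + mixed_lp \<alpha> \<beta> (\<lambda>z. ennreal \<bar>f z - g z\<bar>))"
      using p fg by (intro order_trans[OF mixed_lp_add_le] add_left_mono mixed_lp_add_le) auto
    also have "\<dots> \<le> mixed_lp \<alpha> \<beta> (\<lambda>z. ennreal \<bar>f z - g z\<bar>) +
        (ennreal d * mixed_lp \<alpha> \<beta> (indicator B) + mixed_lp \<alpha> \<beta> (\<lambda>z. ennreal \<bar>f z - g z\<bar>))"
      using p fg by (intro add_mono mixed_lp_mollify_le r order.refl) (auto simp: mixed_lp_cmult)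
    also have "\<dots> < ennreal (\<epsilon> / 4) + (ennreal (\<epsilon> / 4) + ennreal (\<epsilon> / 4))"
      using d g(3) by (intro add_strict_mono)
    also have "\<dots> \<le> ennreal \<epsilon>"
      using \<epsilon> by (simp flip: ennreal_plus)
    also note \<epsilon>(2)
    finally show ?case .
  qed
qed simp

section \<open>Mollification and weak derivatives\<close>

lemma kernel_test_function:
  assumes "0 < r" "cball z r \<subseteq> Q"
  shows "(\<lambda>w. kernel r (z - w)) \<in> test_functions Q"
proof -
  have "(\<lambda>w. inverse (\<integral>w. flat_exp 0 (r\<^sup>2 - w \<bullet> (w :: 'a)) \<partial>lborel) * flat_exp 0 (r\<^sup>2 - (w - z) \<bullet> (w - z))) \<in> smooth_bumps"
    by (intro smooth_bumps.mult smooth_bumps.const smooth_bumps.flat)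
  moreover have "(z - w) \<bullet> (z - w) = (w - z) \<bullet> (w - z)" for w
    by (metis inner_minus_left inner_minus_right minus_diff_eq minus_minus)
  ultimately have "(\<lambda>w. kernel r (z - w)) \<in> smooth_bumps"
    unfolding kernel_def by (simp add: divide_inverse mult.commute)
  moreover have sub: "closure {w. kernel r (z - w) \<noteq> 0} \<subseteq> cball z r"
  proof (rule closure_minimal)
    show "{w. kernel r (z - w) \<noteq> 0} \<subseteq> cball z r"
      using kernel_support[OF assms(1)] by (force simp: dist_norm)
  qed simp
  moreover have "compact (closure {w. kernel r (z - w) \<noteq> 0})"
    using sub by (metis bounded_cball bounded_subset closed_closure compact_eq_bounded_closed)
  ultimately show ?thesis
    using assms(2) smooth_bumps_C_k by (auto simp: test_functions_def)
qed

lemma frechet_derivative_kernel_reflect: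
  "frechet_derivative (\<lambda>w. kernel r (z - w)) (at w) e = - frechet_derivative (kernel r) (at (z - w)) e"
proof -
  have d: "(kernel r has_derivative frechet_derivative (kernel r) (at (z - w))) (at (z - w))"
    by (rule smooth_bumps_has_derivative[OF kernel_smooth_bumps])
  have "((\<lambda>w. z - w) has_derivative (\<lambda>h. - h)) (at w)"
    by (auto intro!: derivative_eq_intros)
  then have "((\<lambda>w. kernel r (z - w)) has_derivative (\<lambda>h. frechet_derivative (kernel r) (at (z - w)) (- h))) (at w)"
    using has_derivative_compose[of "\<lambda>w. z - w" "\<lambda>h. - h" w UNIV "kernel r"] d by simp
  then have "frechet_derivative (\<lambda>w. kernel r (z - w)) (at w) = (\<lambda>h. frechet_derivative (kernel r) (at (z - w)) (- h))"
    by (rule frechet_derivative_at[symmetric])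
  then show ?thesis
    using linear_neg[OF linear_frechet_derivative[OF smooth_bumps_differentiable[OF kernel_smooth_bumps]]] by simp
qed

text \<open>Passes from the Lebesgue integrals over Q, in which weak derivatives are defined, to
  \<open>lborel\<close> integrals of a Borel version. As \<phi> vanishes off \<open>K\<close>,
  agreement of the two versions on \<open>K\<close> suffices.\<close>

lemma set_integral_eq_lborel:
  fixes v v' \<phi> :: "'a::euclidean_space \<Rightarrow> real"
  assumes K: "v absolutely_integrable_on K" "K \<in> sets borel" "K \<subseteq> Q" "\<And>w. w \<notin> K \<Longrightarrow> \<phi> w = 0"
    and v': "v' \<in> borel_measurable borel" "AE w in lborel. w \<in> K \<longrightarrow> v' w = v w"
    and \<phi>: "\<phi> \<in> borel_measurable borel"
  shows "(LINT w:Q|lebesgue. v w * \<phi> w) = (\<integral>w. v' w * \<phi> w \<partial>lborel)"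
proof -
  have [measurable]: "(\<lambda>w. indicator K w *\<^sub>R v w) \<in> borel_measurable lebesgue"
    using K(1) unfolding set_integrable_def by (rule borel_measurable_integrable)
  have \<phi>l[measurable]: "\<phi> \<in> borel_measurable lebesgue" and v'l[measurable]: "v' \<in> borel_measurable lebesgue"
    using \<phi> v' by (auto intro: measurable_completion)
  have "(LINT w:Q|lebesgue. v w * \<phi> w) = (\<integral>w. (indicator K w *\<^sub>R v w) * \<phi> w \<partial>lebesgue)"
    unfolding set_lebesgue_integral_def using K(3,4)
    by (intro Bochner_Integration.integral_cong) (auto simp: indicator_def)
  also have "\<dots> = (\<integral>w. v' w * \<phi> w \<partial>lebesgue)"
  proof (rule integral_cong_AE)
    have "AE w in lebesgue. w \<in> K \<longrightarrow> v' w = v w"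
      using v'(2) by (rule AE_completion)
    then show "AE w in lebesgue. (indicator K w *\<^sub>R v w) * \<phi> w = v' w * \<phi> w"
      by eventually_elim (use K(4) in \<open>auto simp: indicator_def\<close>)
  qed measurable
  also have "\<dots> = (\<integral>w. v' w * \<phi> w \<partial>lborel)"
    using v'(1) \<phi> by (intro integral_completion borel_measurable_times) simp_all
  finally show ?thesis .
qed

text \<open>The reflected kernel w \<mapsto> kernel r (z - w) is a test function once the closed
  ball lies in Q. The sign from the reflection cancels the sign in the definition of the weak
  derivative, so the derivative of the mollification is the mollification of the weak
  derivative.\<close>

lemma mollify_weak_derivative:
  assumes weak: "weak_derivative Q e u v" and r: "0 < r" "cball z r \<subseteq> Q"
    and u': "u' \<in> borel_measurable borel" "AE w in lborel. w \<in> cball z r \<longrightarrow> u' w = u w"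
    and v': "v' \<in> borel_measurable borel" "AE w in lborel. w \<in> cball z r \<longrightarrow> v' w = v w"
  shows "(\<integral>w. frechet_derivative (kernel r) (at (z - w)) e * u' w \<partial>lborel) = mollify r v' z"
proof -
  let ?\<phi> = "\<lambda>w. kernel r (z - w)"
  have locint: "u absolutely_integrable_on cball z r" "v absolutely_integrable_on cball z r"
    using weak r(2) unfolding weak_derivative_def locally_integrable_def by auto
  have supp: "w \<notin> cball z r \<Longrightarrow> r < norm (z - w)" for w
    by (simp add: dist_norm)
  have meas: "(\<lambda>w. frechet_derivative (kernel r) (at (z - w)) e) \<in> borel_measurable borel"
  proof -
    have [measurable]: "(\<lambda>w. frechet_derivative (kernel r) (at w) e) \<in> borel_measurable borel"
      by (intro borel_measurable_continuous_onI smooth_bumps_continuous_on smooth_bumps_frechet kernel_smooth_bumps)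
    show ?thesis by measurable
  qed
  have "(LINT w:Q|lebesgue. u w * frechet_derivative ?\<phi> (at w) e) = - (LINT w:Q|lebesgue. v w * ?\<phi> w)"
    using weak kernel_test_function[OF r] unfolding weak_derivative_def by blast
  moreover have "(LINT w:Q|lebesgue. u w * frechet_derivative ?\<phi> (at w) e) =
      (\<integral>w. u' w * frechet_derivative ?\<phi> (at w) e \<partial>lborel)"
    using locint r u' meas supp smooth_bumps_frechet_support[where r = r, OF kernel_smooth_bumps kernel_support[OF r(1)]]
    by (intro set_integral_eq_lborel[where K = "cball z r"]) (auto simp: frechet_derivative_kernel_reflect)
  moreover have "(LINT w:Q|lebesgue. v w * ?\<phi> w) = (\<integral>w. v' w * ?\<phi> w \<partial>lborel)"
    using locint r v' supp kernel_support[OF r(1)]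
    by (intro set_integral_eq_lborel[where K = "cball z r"]) auto
  ultimately show ?thesis
    by (simp add: frechet_derivative_kernel_reflect mollify_def mult.commute)
qed

lemma mollify_tendsto_L1:
  fixes f :: "'a::euclidean_space \<times> 'b::euclidean_space \<Rightarrow> real"
  assumes f: "integrable lborel f" and r: "\<And>n. 0 < r n" "r \<longlonglongrightarrow> 0"
  shows "(\<lambda>n. \<integral>\<^sup>+z. ennreal \<bar>mollify (r n) f z - f z\<bar> \<partial>lborel) \<longlonglongrightarrow> 0"
proof -
  have fm[measurable]: "f \<in> borel_measurable borel" using f by simp
  have [measurable]: "mollify (r n) f \<in> borel_measurable borel" for n
    using continuous_on_mollify[OF r(1) f] by (rule borel_measurable_continuous_onI)
  have "mixed_lp 1 1 (\<lambda>z. ennreal \<bar>f z\<bar>) < \<infinity>"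
    using f by (subst mixed_lp_one) (auto simp: integrable_iff_bounded)
  then have "(\<lambda>n. mixed_lp 1 1 (\<lambda>z. ennreal \<bar>mollify (r n) f z - f z\<bar>)) \<longlonglongrightarrow> 0"
    using f r by (intro mollify_tendsto_mixed_lp) auto
  then show ?thesis by (subst (asm) mixed_lp_one) auto
qed

text \<open>The fundamental lemma of the calculus of variations. On a ball whose double lies in Q,
  kernels of small radius are test functions, so all the mollifications vanish there, and so does
  their L1 limit. By Lindeloef's theorem countably many such balls cover Q.\<close>

lemma AE_eq_0_if_test_integrals_vanish:
  fixes f :: "'a::euclidean_space \<times> 'b::euclidean_space \<Rightarrow> real"
  assumes Q: "open Q" and f: "locally_integrable Q f"
    and vanish: "\<And>\<phi>. \<phi> \<in> test_functions Q \<Longrightarrow> (LINT z:Q|lebesgue. f z * \<phi> z) = 0"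
  shows "AE z in lborel. z \<in> Q \<longrightarrow> f z = 0"
proof -
  have ball0: "AE z in lborel. z \<in> ball x s \<longrightarrow> f z = 0" if s: "0 < s" "cball x (2 * s) \<subseteq> Q" for x s
  proof -
    have "f absolutely_integrable_on cball x (2 * s)"
      using f s unfolding locally_integrable_def by auto
    then have int: "integrable lebesgue (\<lambda>z. indicator (cball x (2 * s)) z *\<^sub>R f z)"
      unfolding set_integrable_def .
    then obtain g where g[measurable]: "g \<in> borel_measurable borel"
      and ge: "AE z in lborel. indicator (cball x (2 * s)) z *\<^sub>R f z = g z"
      using completion_ex_borel_measurable_real[of _ lborel] borel_measurable_integrable[OF int] by auto
    have "integrable lebesgue g"
      using int by (rule integrable_cong_AE_imp) (use ge in \<open>auto intro: measurable_completion AE_completion elim!: eventually_mono\<close>)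
    then have gint: "integrable lborel g"
      by (simp add: integrable_completion)
    have gf: "AE z in lborel. z \<in> cball x (2 * s) \<longrightarrow> g z = f z"
      using ge by eventually_elim auto
    define r where "r n = s / (real n + 1)" for n
    have r: "0 < r n" "r n \<le> s" for n
      using s by (auto simp: r_def field_simps)
    have "r \<longlonglongrightarrow> 0"
      unfolding r_def by real_asymp
    have [measurable]: "mollify (r n) g \<in> borel_measurable borel" for n
      using continuous_on_mollify[OF r(1) gint] by (rule borel_measurable_continuous_onI)
    have mol0: "mollify (r n) g z = 0" if z: "z \<in> ball x s" for n z
    proof -
      have sub: "cball z (r n) \<subseteq> cball x (2 * s)"
      proof
        fix y assume "y \<in> cball z (r n)"
        moreover have "dist x y \<le> dist x z + dist z y" by (rule dist_triangle)
        ultimately show "y \<in> cball x (2 * s)" using z r(2)[of n] by auto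
      qed
      then have "AE w in lborel. w \<in> cball z (r n) \<longrightarrow> g w = f w"
        using gf by (auto elim!: eventually_mono)
      moreover have "f absolutely_integrable_on cball z (r n)"
        using f s sub unfolding locally_integrable_def by auto
      ultimately have "(LINT w:Q|lebesgue. f w * kernel (r n) (z - w)) = (\<integral>w. g w * kernel (r n) (z - w) \<partial>lborel)"
      proof (intro set_integral_eq_lborel[where K = "cball z (r n)"])
        show "kernel (r n) (z - w) = 0" if "w \<notin> cball z (r n)" for w
          using that by (intro kernel_support r) (simp add: dist_norm)
      qed (use sub s in auto)
      moreover have "(LINT w:Q|lebesgue. f w * kernel (r n) (z - w)) = 0"
        using sub s r by (intro vanish kernel_test_function) auto
      ultimately show ?thesis by (simp add: mollify_def mult.commute)
    qed
    have "(\<integral>\<^sup>+z. ennreal \<bar>g z\<bar> * indicator (ball x s) z \<partial>lborel) \<le> (\<integral>\<^sup>+z. ennreal \<bar>mollify (r n) g z - g z\<bar> \<partial>lborel)" for n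
      by (intro nn_integral_mono) (auto simp: indicator_def mol0)
    then have "(\<integral>\<^sup>+z. ennreal \<bar>g z\<bar> * indicator (ball x s) z \<partial>lborel) \<le> 0"
      using mollify_tendsto_L1[OF gint r(1) \<open>r \<longlonglongrightarrow> 0\<close>] by (intro LIMSEQ_le_const) auto
    moreover have "(\<lambda>z. ennreal \<bar>g z\<bar> * indicator (ball x s) z) \<in> borel_measurable lborel"
      by (intro borel_measurable_times_ennreal borel_measurable_indicator) auto
    ultimately have "AE z in lborel. ennreal \<bar>g z\<bar> * indicator (ball x s) z = 0"
      by (simp add: nn_integral_0_iff_AE)
    with gf show ?thesis
      by eventually_elim (use s in \<open>auto simp: indicator_def split: if_splits\<close>)
  qed
  define \<F> where "\<F> = {ball x s | x s. 0 < s \<and> cball x (2 * s) \<subseteq> Q}"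
  have "\<Union>\<F> = Q"
  proof
    show "\<Union>\<F> \<subseteq> Q"
      unfolding \<F>_def by (force simp: subset_eq)
    show "Q \<subseteq> \<Union>\<F>"
    proof
      fix x assume "x \<in> Q"
      then obtain e where e: "0 < e" "cball x e \<subseteq> Q"
        using Q open_contains_cball by blast
      then have "ball x (e / 2) \<in> \<F>" unfolding \<F>_def by (intro CollectI exI[of _ x] exI[of _ "e / 2"]) auto
      then show "x \<in> \<Union>\<F>" using e by (intro UnionI[of "ball x (e / 2)"]) auto
    qed
  qed
  moreover obtain \<G> where \<G>: "\<G> \<subseteq> \<F>" "countable \<G>" "\<Union>\<G> = \<Union>\<F>"
    using Lindelof[of \<F>] by (auto simp: \<F>_def)
  moreover have "AE z in lborel. \<forall>B\<in>\<G>. z \<in> B \<longrightarrow> f z = 0"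
    using \<G> ball0 by (subst AE_ball_countable) (auto simp: \<F>_def)
  ultimately show ?thesis
    by (auto elim!: eventually_mono)
qed

text \<open>Needed because the differential inequality of the theorem is stated for given
  derivatives \<open>ut\<close> and \<open>Du\<close>, while membership in \<open>W12\<close> only
  provides some derivatives with finite mixed norm. The difference of two derivatives vanishes
  against every test function.\<close>

lemma weak_derivative_unique:
  fixes u :: "'a::euclidean_space \<times> 'b::euclidean_space \<Rightarrow> real"
  assumes "open Q" "weak_derivative Q e u v" "weak_derivative Q e u v'"
  shows "AE z in lborel. z \<in> Q \<longrightarrow> v z = v' z"
proof -
  have loc: "locally_integrable Q v" "locally_integrable Q v'"
    using assms unfolding weak_derivative_def by auto
  have "locally_integrable Q (\<lambda>z. v z - v' z)"
    using loc unfolding locally_integrable_def by (auto intro: set_integral_diff)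
  moreover have "(LINT z:Q|lebesgue. (v z - v' z) * \<phi> z) = 0" if \<phi>: "\<phi> \<in> test_functions Q" for \<phi>
  proof -
    define K where "K = closure {z. \<phi> z \<noteq> 0}"
    have K: "compact K" "K \<subseteq> Q" using \<phi> by (auto simp: K_def test_functions_def)
    have \<phi>0: "\<phi> z = 0" if "z \<notin> K" for z
      using that closure_subset[of "{z. \<phi> z \<noteq> 0}"] unfolding K_def by auto
    have "C_k 0 \<phi>" using \<phi> unfolding test_functions_def by blast
    then have c: "continuous_on UNIV \<phi>" by simp
    have int: "set_integrable lebesgue Q (\<lambda>z. h z * \<phi> z)" if "locally_integrable Q h" for h
    proof -
      have "h absolutely_integrable_on K"
        using that K unfolding locally_integrable_def by auto
      moreover have "bounded (\<phi> ` K)"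
        using K c by (intro compact_imp_bounded compact_continuous_image) (auto intro: continuous_on_subset)
      moreover have "\<phi> \<in> borel_measurable (lebesgue_on K)"
        using c K by (intro continuous_imp_measurable_on_sets_lebesgue) (auto intro: continuous_on_subset lmeasurable_compact fmeasurableD)
      ultimately have "(\<lambda>z. \<phi> z * h z) absolutely_integrable_on K"
        using K by (intro absolutely_integrable_bounded_measurable_product[OF bilinear_times]) (auto intro: lmeasurable_compact fmeasurableD)
      moreover have "(\<lambda>z. indicator K z *\<^sub>R (\<phi> z * h z)) = (\<lambda>z. indicator Q z *\<^sub>R (h z * \<phi> z))"
        (is "?l = ?r")
      proof
        fix z show "?l z = ?r z"
          using K \<phi>0[of z] by (auto simp: indicator_def)
      qed
      ultimately show ?thesis unfolding set_integrable_def by (simp only:)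
    qed
    have "(LINT z:Q|lebesgue. v z * \<phi> z) = (LINT z:Q|lebesgue. v' z * \<phi> z)"
      using assms \<phi> unfolding weak_derivative_def by fastforce
    then show ?thesis
      using set_integral_diff(2)[OF int[OF loc(1)] int[OF loc(2)]] by (simp add: left_diff_distrib)
  qed
  ultimately have "AE z in lborel. z \<in> Q \<longrightarrow> v z - v' z = 0"
    using assms(1) by (intro AE_eq_0_if_test_integrals_vanish)
  then show ?thesis by simp
qed

subsection \<open>Cutting at a level depending on time\<close>

text \<open>
  Above the level, \<open>B\<^bsup>q\<^esup> \<le> l\<^bsup>q - p0\<^esup> B\<^bsup>p0\<^esup>\<close>, so Hoelder's inequality applies with the exponents \<open>q\<close>
  and \<open>p / d\<close>; the level is the one for which its bound becomes \<open>\<delta>\<^sup>d l\<close>.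
\<close>

lemma lp_norm_level_split:
  fixes B H :: "'a \<Rightarrow> ennreal"
  assumes [measurable]: "B \<in> borel_measurable M" "H \<in> borel_measurable M"
    and d: "0 < d" and pq: "1 < q" "1 < p / d" "d / p + 1 / q = 1" "q \<le> p0" and \<delta>: "0 < \<delta>"
  defines "l \<equiv> lp_norm M p0 B * ennreal_powr (ennreal (1 / \<delta>) * lp_norm M p H) (q * d / p0)"
  shows "(\<integral>\<^sup>+x. (if l < B x then B x else 0) * ennreal_powr (H x) d \<partial>M) \<le> ennreal (\<delta> powr d) * l"
proof -
  have p: "0 < p" "0 < p0" using pq d by (auto simp: zero_less_divide_iff)
  consider (0) "l = 0" | (top) "l = top" | (pos) "l \<noteq> 0" "l \<noteq> top" by blast
  then show ?thesis
  proof cases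
    case 0
    then have "lp_norm M p0 B = 0 \<or> lp_norm M p H = 0"
      using \<delta> by (auto simp: l_def)
    then have "AE x in M. (if l < B x then B x else 0) * ennreal_powr (H x) d = 0"
      by (auto simp: lp_norm_eq_0 elim!: eventually_mono)
    then have "(\<integral>\<^sup>+x. (if l < B x then B x else 0) * ennreal_powr (H x) d \<partial>M) = 0"
      by (subst nn_integral_0_iff_AE) auto
    then show ?thesis by simp
  next
    case top
    then show ?thesis by (simp add: less_top[symmetric])
  next
    case pos
    then have nz: "lp_norm M p0 B \<noteq> 0" "lp_norm M p0 B \<noteq> top" "lp_norm M p H \<noteq> 0" "lp_norm M p H \<noteq> top"
      using \<delta> by (auto simp: l_def ennreal_mult_eq_top_iff)
    then obtain b \<kappa> where b: "lp_norm M p0 B = ennreal b" "0 < b" and \<kappa>: "lp_norm M p H = ennreal \<kappa>" "0 < \<kappa>"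
      by (cases "lp_norm M p0 B"; cases "lp_norm M p H") (auto simp: less_le)
    define m where "m = b * (\<kappa> / \<delta>) powr (q * d / p0)"
    have m: "l = ennreal m" "0 < m"
      using b \<kappa> \<delta> by (auto simp: l_def m_def ennreal_powr_ennreal simp flip: ennreal_mult)
    define B1 where "B1 x = (if l < B x then B x else 0)" for x
    have [measurable]: "B1 \<in> borel_measurable M" unfolding B1_def by measurable
    have "(\<integral>\<^sup>+x. B1 x * ennreal_powr (H x) d \<partial>M) \<le> lp_norm M q B1 * lp_norm M (p / d) (\<lambda>x. ennreal_powr (H x) d)"
      using pq by (intro nn_integral_Holder) auto
    also have "lp_norm M (p / d) (\<lambda>x. ennreal_powr (H x) d) = ennreal (\<kappa> powr d)"
      using d p \<kappa> by (simp add: lp_norm_powr ennreal_powr_ennreal)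
    also have "lp_norm M q B1 \<le> ennreal ((b powr p0 / m powr (p0 - q)) powr (1 / q))"
    proof -
      have "ennreal (m powr (p0 - q)) * (\<integral>\<^sup>+x. ennreal_powr (B1 x) q \<partial>M) = (\<integral>\<^sup>+x. ennreal (m powr (p0 - q)) * ennreal_powr (B1 x) q \<partial>M)"
        by (simp add: nn_integral_cmult)
      also have "\<dots> \<le> (\<integral>\<^sup>+x. ennreal_powr (B x) p0 \<partial>M)"
      proof (intro nn_integral_mono)
        fix x
        show "ennreal (m powr (p0 - q)) * ennreal_powr (B1 x) q \<le> ennreal_powr (B x) p0"
        proof (cases "l < B x")
          case True
          have "ennreal (m powr (p0 - q)) = ennreal_powr l (p0 - q)"
            using m by (simp add: ennreal_powr_ennreal)
          also have "\<dots> \<le> ennreal_powr (B x) (p0 - q)"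
            using True pq by (intro ennreal_powr_mono) auto
          finally have "ennreal (m powr (p0 - q)) * ennreal_powr (B1 x) q \<le> ennreal_powr (B x) (p0 - q) * ennreal_powr (B1 x) q"
            by (rule mult_right_mono) simp
          also have "\<dots> = ennreal_powr (B x) p0"
            using True by (simp add: B1_def flip: ennreal_powr_add)
          finally show ?thesis .
        qed (simp add: B1_def)
      qed
      also have "\<dots> = ennreal (b powr p0)"
        using ennreal_powr_lp_norm[of p0 M B] b p by (simp add: ennreal_powr_ennreal)
      finally have *: "ennreal (m powr (p0 - q)) * (\<integral>\<^sup>+x. ennreal_powr (B1 x) q \<partial>M) \<le> ennreal (b powr p0)" .
      have "(\<integral>\<^sup>+x. ennreal_powr (B1 x) q \<partial>M) = ennreal (1 / m powr (p0 - q)) * (ennreal (m powr (p0 - q)) * (\<integral>\<^sup>+x. ennreal_powr (B1 x) q \<partial>M))"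
        using m by (simp add: mult.assoc[symmetric] flip: ennreal_mult)
      also have "\<dots> \<le> ennreal (1 / m powr (p0 - q)) * ennreal (b powr p0)"
        using * by (rule mult_left_mono) simp
      also have "\<dots> = ennreal (b powr p0 / m powr (p0 - q))"
        by (simp flip: ennreal_mult)
      finally show ?thesis
        using pq by (simp add: lp_norm_def flip: ennreal_powr_ennreal) (rule ennreal_powr_mono, auto)
    qed
    also have "ennreal ((b powr p0 / m powr (p0 - q)) powr (1 / q)) * ennreal (\<kappa> powr d) = ennreal (\<delta> powr d) * l"
    proof -
      \<comment> \<open>In logarithms the choice of m reads (p0 / q) (ln b - ln m) = - d (ln
        \<kappa> - ln \<delta>). Thus the powers of \<kappa> cancel and only \<delta>^d m is
        left.\<close>
      have "ln ((b powr p0 / m powr (p0 - q)) powr (1 / q) * \<kappa> powr d) = ln (\<delta> powr d * m)"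
      proof -
        have lm: "ln m = ln b + (q * d / p0) * (ln \<kappa> - ln \<delta>)"
          using b \<kappa> \<delta> by (simp add: m_def ln_mult ln_powr ln_div)
        have "ln ((b powr p0 / m powr (p0 - q)) powr (1 / q) * \<kappa> powr d) = (1 / q) * (p0 * ln b - (p0 - q) * ln m) + d * ln \<kappa>"
          using b \<kappa> m by (simp add: ln_mult ln_powr ln_div)
        also have "\<dots> = ln m + (p0 / q) * (ln b - ln m) + d * ln \<kappa>"
          using pq by (simp add: field_simps)
        also have "(p0 / q) * (ln b - ln m) = - d * (ln \<kappa> - ln \<delta>)"
          unfolding lm using p pq by (simp add: field_simps)
        also have "ln m + - d * (ln \<kappa> - ln \<delta>) + d * ln \<kappa> = ln (\<delta> powr d * m)"
          using \<delta> m by (simp add: ln_mult ln_powr algebra_simps)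
        finally show ?thesis .
      qed
      then have "(b powr p0 / m powr (p0 - q)) powr (1 / q) * \<kappa> powr d = \<delta> powr d * m"
        using b \<kappa> m \<delta> by (subst (asm) ln_inj_iff) auto
      then show ?thesis
        using m by (simp flip: ennreal_mult)
    qed
    finally show ?thesis
      unfolding B1_def by (simp add: mult_right_mono)
  qed
qed

text \<open>Hoelder's inequality in time with the exponents \<open>q0\<close> and p0 / d, which are
  conjugate by hypothesis. The product of p0 / d with q d / p0 is q, so the second factor is a power
  of the q-norm of \<open>k\<close>.\<close>

lemma nn_integral_split_level_le:
  fixes \<beta> k :: "'a \<Rightarrow> ennreal"
  assumes [measurable]: "\<beta> \<in> borel_measurable M" "k \<in> borel_measurable M"
    and d: "0 < d" and pq: "1 < q" "1 < q0" "d / p0 + 1 / q0 = 1" "0 < p0" and \<delta>: "0 < \<delta>"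
  shows "(\<integral>\<^sup>+t. \<beta> t * ennreal_powr (ennreal (1 / \<delta>) * k t) (q * d / p0) \<partial>M)
     \<le> lp_norm M q0 \<beta> * ennreal_powr (ennreal (1 / \<delta>) * lp_norm M q k) (q * d / p0)"
proof -
  define r where "r = p0 / d"
  have e: "d / p0 = 1 - 1 / q0" using pq by simp
  have r: "1 < r" "1 / q0 + 1 / r = 1" "r * (q * d / p0) = q"
  proof -
    show "1 / q0 + 1 / r = 1" using pq d by (simp add: r_def)
    have "0 < 1 / q0" using pq by simp
    then have "d / p0 < 1" using e by linarith
    then show "1 < r" using d pq by (simp add: r_def divide_less_eq less_divide_eq)
    show "r * (q * d / p0) = q" using d pq by (simp add: r_def)
  qed
  have "(\<integral>\<^sup>+t. \<beta> t * ennreal_powr (ennreal (1 / \<delta>) * k t) (q * d / p0) \<partial>M) \<le>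
     lp_norm M q0 \<beta> * lp_norm M r (\<lambda>t. ennreal_powr (ennreal (1 / \<delta>) * k t) (q * d / p0))"
    using pq r by (intro nn_integral_Holder) auto
  also have "lp_norm M r (\<lambda>t. ennreal_powr (ennreal (1 / \<delta>) * k t) (q * d / p0)) = ennreal_powr (ennreal (1 / \<delta>) * lp_norm M q k) (q * d / p0)"
    using d pq r by (subst lp_norm_powr) (auto simp: lp_norm_cmult)
  finally show ?thesis .
qed

text \<open>Hoelder's inequality for f^r = f^(1-s) f^(s q) with the exponents 1 / (1 - s) and 1 / s,
  interpolating between L1 and Lq.\<close>

lemma lp_norm_interpolation:
  assumes [measurable]: "f \<in> borel_measurable M" and q: "1 < q" and \<theta>: "0 < \<theta>" "\<theta> \<le> 1"
    and r: "1 / r = 1 - \<theta> + \<theta> / q"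
  shows "lp_norm M r f \<le> ennreal_powr (\<integral>\<^sup>+x. f x \<partial>M) (1 - \<theta>) * ennreal_powr (lp_norm M q f) \<theta>"
proof (cases "\<theta> = 1")
  case True
  then have rq: "r = q" using r q by simp
  \<comment> \<open>For \<theta> = 1 the first factor is a zeroth power, which
    \<open>ennreal_powr\<close> sets to 0 at 0, to 1 at positive finite arguments and to \<infinity>
    at \<infinity>. A vanishing integral is therefore a case of its own.\<close>
  show ?thesis
  proof (cases "(\<integral>\<^sup>+x. f x \<partial>M) = 0")
    case zero: True
    then have "AE x in M. f x = 0" by (simp add: nn_integral_0_iff_AE)
    then have "lp_norm M r f = 0" by (simp add: lp_norm_eq_0)
    then show ?thesis by simp
  next
    case False
    have "ennreal_powr (\<integral>\<^sup>+x. f x \<partial>M) 0 \<ge> 1"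
      using False by (cases "\<integral>\<^sup>+x. f x \<partial>M") (auto simp: ennreal_powr_ennreal)
    then have "1 * lp_norm M q f \<le> ennreal_powr (\<integral>\<^sup>+x. f x \<partial>M) 0 * lp_norm M q f"
      by (rule mult_right_mono) simp
    then show ?thesis by (simp add: rq True)
  qed
next
  case False
  with \<theta> have \<theta>1: "\<theta> < 1" by simp
  have "0 < 1 / r" using r \<theta> q \<theta>1 by (simp add: add_pos_pos)
  then have r0: "0 < r" by simp
  \<comment> \<open>Chosen so that s q = \<theta> r; the relation between r and \<theta> then says 1
    - s = (1 - \<theta>) r, and the exponents 1 - s and s q add up to r.\<close>
  define s where "s = \<theta> * r / q"
  have s: "1 - s = (1 - \<theta>) * r"
  proof -
    have "1 = (1 - \<theta> + \<theta> / q) * r" using r r0 by (metis less_irrefl nonzero_eq_divide_eq)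
    then show ?thesis by (simp add: s_def algebra_simps)
  qed
  have "0 < (1 - \<theta>) * r" using \<theta>1 r0 by (intro mult_pos_pos) auto
  then have "s < 1" using s by linarith
  moreover have "0 < s" using \<theta> r0 q by (simp add: s_def)
  ultimately have s01: "0 < s" "s < 1" by auto
  have "(\<integral>\<^sup>+x. ennreal_powr (f x) r \<partial>M) = (\<integral>\<^sup>+x. ennreal_powr (f x) (1 - s) * ennreal_powr (f x) (s * q) \<partial>M)"
  proof -
    have "r = (1 - s) + s * q"
      using s q by (simp add: s_def algebra_simps)
    then show ?thesis by (metis (no_types) ennreal_powr_add)
  qed
  also have "\<dots> \<le> lp_norm M (1 / (1 - s)) (\<lambda>x. ennreal_powr (f x) (1 - s)) * lp_norm M (1 / s) (\<lambda>x. ennreal_powr (f x) (s * q))"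
    using s01 by (intro nn_integral_Holder) auto
  also have "\<dots> = ennreal_powr (\<integral>\<^sup>+x. f x \<partial>M) (1 - s) * ennreal_powr (lp_norm M q f) (s * q)"
    using s01 q by (simp add: lp_norm_powr lp_norm_one)
  finally have "lp_norm M r f \<le> ennreal_powr (ennreal_powr (\<integral>\<^sup>+x. f x \<partial>M) (1 - s) * ennreal_powr (lp_norm M q f) (s * q)) (1 / r)"
    unfolding lp_norm_def[of M r] using r0 by (intro ennreal_powr_mono) auto
  also have "\<dots> = ennreal_powr (\<integral>\<^sup>+x. f x \<partial>M) ((1 - s) * (1 / r)) * ennreal_powr (lp_norm M q f) (s * q * (1 / r))"
    by (simp only: ennreal_powr_mult ennreal_powr_powr)
  also have "(1 - s) * (1 / r) = 1 - \<theta>" using s r0 by simp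
  also have "s * q * (1 / r) = \<theta>" using r0 q by (simp add: s_def)
  finally show ?thesis .
qed

text \<open>Here the first coordinate is space and the second time. In time, Hoelder's inequality
  pairs the d-th power of \<open>H\<close> in the exponent q / d with \<open>A\<close> in the
  conjugate exponent r, and \<open>A\<close> is interpolated between L1, where the columns are
  bounded by \<open>C\<close>, and Lq, where \<open>h\<close> dominates. In space, Hoelder's
  inequality with q and p / d then yields the mixed norms. A positive power of the norm of
  \<open>h\<close> survives, so the bound is small with \<open>h\<close>.\<close>

lemma nn_integral_column_bound:
  fixes A h H :: "'a::euclidean_space \<times> 'b::euclidean_space \<Rightarrow> ennreal"
  assumes [measurable]: "A \<in> borel_measurable borel" "h \<in> borel_measurable borel" "H \<in> borel_measurable borel"
    and d: "0 < d" and pq: "1 < p" "p \<le> q" "d < p" "d / p + 1 / q = 1"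
    and le: "\<And>z. A z \<le> h z" and C: "\<And>x. (\<integral>\<^sup>+t. A (x, t) \<partial>lborel) \<le> C"
  shows "(\<integral>\<^sup>+z. A z * ennreal_powr (H z) d \<partial>lborel) \<le>
     ennreal_powr C (1 - p / q) * (ennreal_powr (mixed_lp p q h) (p / q) * ennreal_powr (mixed_lp p q H) d)"
proof -
  \<comment> \<open>\<theta> q = p turns the q-norm in space of the \<theta>-th power into a p-norm.
    The same \<theta> fits the interpolation to r because d / p + 1 / q = 1 means p / q = p -
    d.\<close>
  define \<theta> where "\<theta> = p / q"
  define r where "r = q / (q - d)"
  have \<theta>: "0 < \<theta>" "\<theta> \<le> 1" "\<theta> * q = p" using pq by (auto simp: \<theta>_def)
  have q: "1 < q" "d < q" using pq by auto
  have r: "1 < r" "1 / r + 1 / (q / d) = 1" "1 / r = 1 - \<theta> + \<theta> / q"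
  proof -
    show "1 < r" using q d by (simp add: r_def field_simps)
    show "1 / r + 1 / (q / d) = 1" using q d by (simp add: r_def field_simps)
    have "p / q = p - d"
      using pq d q by (simp add: field_simps)
    then have "\<theta> / q = p / q - d / q" by (simp add: \<theta>_def diff_divide_distrib)
    moreover have "1 / r = 1 - d / q" using q by (simp add: r_def diff_divide_distrib)
    ultimately show "1 / r = 1 - \<theta> + \<theta> / q" by (simp add: \<theta>_def)
  qed
  define P where "P x = lp_norm lborel q (\<lambda>t. h (x, t))" for x
  define K where "K x = lp_norm lborel q (\<lambda>t. H (x, t))" for x
  have [measurable]: "P \<in> borel_measurable borel" "K \<in> borel_measurable borel"
    unfolding P_def K_def by measurable
  have inner: "(\<integral>\<^sup>+t. A (x, t) * ennreal_powr (H (x, t)) d \<partial>lborel) \<le> ennreal_powr C (1 - \<theta>) * (ennreal_powr (P x) \<theta> * ennreal_powr (K x) d)" for x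
  proof -
    have "(\<integral>\<^sup>+t. A (x, t) * ennreal_powr (H (x, t)) d \<partial>lborel) \<le>
       lp_norm lborel r (\<lambda>t. A (x, t)) * lp_norm lborel (q / d) (\<lambda>t. ennreal_powr (H (x, t)) d)"
      using r q d by (intro nn_integral_Holder) auto
    also have "lp_norm lborel (q / d) (\<lambda>t. ennreal_powr (H (x, t)) d) = ennreal_powr (K x) d"
      using d q by (simp add: lp_norm_powr K_def)
    also have "lp_norm lborel r (\<lambda>t. A (x, t)) \<le> ennreal_powr (\<integral>\<^sup>+t. A (x, t) \<partial>lborel) (1 - \<theta>) * ennreal_powr (lp_norm lborel q (\<lambda>t. A (x, t))) \<theta>"
      using q \<theta> r by (intro lp_norm_interpolation) auto
    also have "\<dots> \<le> ennreal_powr C (1 - \<theta>) * ennreal_powr (P x) \<theta>"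
      using \<theta> q le C unfolding P_def by (intro mult_mono ennreal_powr_mono lp_norm_mono) auto
    finally show ?thesis by (simp add: mult.assoc mult_right_mono)
  qed
  have "(\<integral>\<^sup>+z. A z * ennreal_powr (H z) d \<partial>lborel) = (\<integral>\<^sup>+x. \<integral>\<^sup>+t. A (x, t) * ennreal_powr (H (x, t)) d \<partial>lborel \<partial>lborel)"
    by (subst lborel_prod[symmetric], subst lborel.nn_integral_fst[symmetric]) (auto simp: lborel_prod)
  also have "\<dots> \<le> (\<integral>\<^sup>+x. ennreal_powr C (1 - \<theta>) * (ennreal_powr (P x) \<theta> * ennreal_powr (K x) d) \<partial>lborel)"
    by (intro nn_integral_mono inner)
  also have "\<dots> = ennreal_powr C (1 - \<theta>) * (\<integral>\<^sup>+x. ennreal_powr (P x) \<theta> * ennreal_powr (K x) d \<partial>lborel)"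
    by (intro nn_integral_cmult) auto
  also have "(\<integral>\<^sup>+x. ennreal_powr (P x) \<theta> * ennreal_powr (K x) d \<partial>lborel) \<le>
     lp_norm lborel q (\<lambda>x. ennreal_powr (P x) \<theta>) * lp_norm lborel (p / d) (\<lambda>x. ennreal_powr (K x) d)"
    using pq q d by (intro nn_integral_Holder) auto
  also have "lp_norm lborel q (\<lambda>x. ennreal_powr (P x) \<theta>) = ennreal_powr (lp_norm lborel p P) \<theta>"
    using \<theta> q by (simp add: lp_norm_powr mult.commute)
  also have "lp_norm lborel (p / d) (\<lambda>x. ennreal_powr (K x) d) = ennreal_powr (lp_norm lborel p K) d"
    using d pq by (simp add: lp_norm_powr)
  finally show ?thesis
    unfolding \<theta>_def mixed_lp_def P_def K_def by (simp add: mult_left_mono)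
qed

section \<open>Exchanging time and space\<close>

lemma distr_lborel_swap:
  "distr lborel borel (\<lambda>z. (snd z, fst z)) = (lborel :: ('a::euclidean_space \<times> 'b::euclidean_space) measure)"
proof -
  have "distr (lborel \<Otimes>\<^sub>M lborel) (lborel \<Otimes>\<^sub>M lborel) (\<lambda>(x, y). (y, x)) = (lborel \<Otimes>\<^sub>M lborel :: ('a \<times> 'b) measure)"
    by (rule lborel_pair.distr_pair_swap[symmetric])
  then have "distr lborel lborel (\<lambda>(x, y). (y, x)) = (lborel :: ('a \<times> 'b) measure)"
    by (simp add: lborel_prod)
  moreover have "distr lborel lborel (\<lambda>(x, y). (y, x)) = (distr lborel borel (\<lambda>z. (snd z, fst z)) :: ('a \<times> 'b) measure)"
    by (intro distr_cong) auto
  ultimately show ?thesis by simp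
qed

lemma borel_measurable_swap_pair [measurable]:
  "(\<lambda>z. (snd z, fst z)) \<in> borel_measurable (borel :: ('a::euclidean_space \<times> 'b::euclidean_space) measure)"
  by (intro borel_measurable_continuous_onI continuous_intros)

lemma AE_lborel_swap:
  assumes "AE z in (lborel :: ('a::euclidean_space \<times> 'b::euclidean_space) measure). P z"
  shows "AE z in lborel. P (snd z, fst z)"
proof -
  obtain N where "{z \<in> space lborel. \<not> P z} \<subseteq> N" "emeasure lborel N = 0" "N \<in> sets lborel"
    using AE_E[OF assms] .
  then have N: "N \<in> null_sets lborel" "{z. \<not> P z} \<subseteq> N" by (auto simp: null_sets_def)
  then have [measurable]: "N \<in> sets borel" by (auto simp: null_sets_def)
  have "emeasure lborel ((\<lambda>z :: 'b \<times> 'a. (snd z, fst z)) -` N) = emeasure lborel N"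
    by (subst (2) distr_lborel_swap[symmetric], subst emeasure_distr) auto
  moreover have "(\<lambda>z :: 'b \<times> 'a. (snd z, fst z)) -` N \<in> sets borel"
    using measurable_sets[OF borel_measurable_swap_pair, of N] by simp
  ultimately have "(\<lambda>z :: 'b \<times> 'a. (snd z, fst z)) -` N \<in> null_sets lborel"
    using N by (auto simp: null_sets_def)
  then show ?thesis
    using N(2) by (auto intro!: AE_I'[of "(\<lambda>z :: 'b \<times> 'a. (snd z, fst z)) -` N"])
qed

lemma integrable_swap:
  fixes f :: "'a::euclidean_space \<times> 'b::euclidean_space \<Rightarrow> real"
  assumes "integrable lborel f"
  shows "integrable lborel (\<lambda>z. f (snd z, fst z))"
proof -
  have [measurable]: "f \<in> borel_measurable borel" using assms by simp
  show ?thesis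
    using assms by (subst (asm) distr_lborel_swap[symmetric], subst (asm) integrable_distr_eq) auto
qed

lemma lebesgue_integral_swap:
  fixes f :: "'a::euclidean_space \<times> 'b::euclidean_space \<Rightarrow> real"
  assumes [measurable]: "f \<in> borel_measurable borel"
  shows "(\<integral>z. f (snd z, fst z) \<partial>lborel) = (\<integral>z. f z \<partial>lborel)"
  by (subst (2) distr_lborel_swap[symmetric], subst integral_distr) auto

text \<open>The exchange of coordinates preserves Lebesgue measure and the norm, and the kernel is
  radial.\<close>

lemma mollify_swap:
  fixes f :: "'a::euclidean_space \<times> 'b::euclidean_space \<Rightarrow> real"
  assumes [measurable]: "f \<in> borel_measurable borel"
  shows "mollify r f (snd z, fst z) = mollify r (\<lambda>z. f (snd z, fst z)) z"
proof -
  have inner: "(snd w, fst w) \<bullet> (snd w, fst w) = w \<bullet> w" for w :: "'b \<times> 'a"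
    by (cases w) (simp add: add.commute)
  have "(\<integral>w. flat_exp 0 (r\<^sup>2 - w \<bullet> (w :: 'a \<times> 'b)) \<partial>lborel) = (\<integral>w. flat_exp 0 (r\<^sup>2 - w \<bullet> (w :: 'b \<times> 'a)) \<partial>lborel)"
  proof -
    have "(\<lambda>w. flat_exp 0 (r\<^sup>2 - w \<bullet> (w :: 'a \<times> 'b))) \<in> borel_measurable borel"
      by (intro borel_measurable_continuous_onI smooth_bumps_continuous_on flat_exp_inner_smooth_bumps)
    from lebesgue_integral_swap[OF this] show ?thesis by (simp only: inner)
  qed
  then have kernel: "kernel r (snd w, fst w) = kernel r w" for w :: "'b \<times> 'a"
    by (simp only: kernel_def inner)
  have "mollify r f (snd z, fst z) = (\<integral>w. kernel r ((snd z, fst z) - (snd w, fst w)) * f (snd w, fst w) \<partial>lborel)"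
    unfolding mollify_def by (subst distr_lborel_swap[symmetric], subst integral_distr) auto
  also have "\<dots> = (\<integral>w. kernel r (z - w) * f (snd w, fst w) \<partial>lborel)"
    using kernel[of "z - w" for w] by (simp add: minus_prod_def)
  finally show ?thesis by (simp add: mollify_def)
qed

definition ordered_mixed_lp ::
  "real \<Rightarrow> real \<Rightarrow> ('a::euclidean_space \<times> 'b::euclidean_space \<Rightarrow> ennreal) \<Rightarrow> ennreal" where
  "ordered_mixed_lp q p F = (if p > q then mixed_lp q p F else mixed_lp p q (\<lambda>z. F (snd z, fst z)))"

lemma mixed_norm_eq_ordered_mixed_lp:
  assumes "0 < p" "0 < q"
  shows "mixed_norm q p f = ordered_mixed_lp q p (\<lambda>z. ennreal (norm (f z)))"
  using assms
  by (simp add: mixed_norm_def ordered_mixed_lp_def mixed_lp_def lp_norm_def nn_integral_completion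
      ennreal_powr_ennreal ennreal_powr_powr)

lemma ordered_mixed_lp_mono_AE:
  assumes "AE z in lborel. F z \<le> G z" "0 < q" "0 < p"
  shows "ordered_mixed_lp q p F \<le> ordered_mixed_lp q p G"
  unfolding ordered_mixed_lp_def
  using mixed_lp_mono_AE[OF assms] mixed_lp_mono_AE[OF AE_lborel_swap[OF assms(1)] assms(3,2)] by simp

lemma ordered_mixed_lp_add_le:
  assumes [measurable]: "F \<in> borel_measurable borel" "G \<in> borel_measurable borel" and "1 \<le> q" "1 \<le> p"
  shows "ordered_mixed_lp q p (\<lambda>z. F z + G z) \<le> ordered_mixed_lp q p F + ordered_mixed_lp q p G"
  using assms by (simp add: ordered_mixed_lp_def mixed_lp_add_le)

lemma ordered_mixed_lp_dominated_convergence: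
  assumes [measurable]: "\<And>n. F n \<in> borel_measurable borel" "G \<in> borel_measurable borel"
    and le: "\<And>n. AE z in lborel. F n z \<le> G z" and fin: "ordered_mixed_lp q p G < \<infinity>"
    and lim: "AE z in lborel. (\<lambda>n. F n z) \<longlonglongrightarrow> 0" and p: "0 < q" "0 < p"
  shows "(\<lambda>n. ordered_mixed_lp q p (F n)) \<longlonglongrightarrow> 0"
proof (cases "p > q")
  case True
  then show ?thesis
    using mixed_lp_dominated_convergence[of F G, OF _ _ le _ lim p] fin
    by (simp add: ordered_mixed_lp_def)
next
  case False
  then show ?thesis
    using mixed_lp_dominated_convergence[of "\<lambda>n z. F n (snd z, fst z)" "\<lambda>z. G (snd z, fst z)",
        OF _ _ AE_lborel_swap[OF le] _ AE_lborel_swap[OF lim] p(2,1)] fin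
    by (simp add: ordered_mixed_lp_def)
qed

lemma ordered_mixed_lp_mollify_le:
  assumes r: "0 < r" and f: "integrable lborel f" and "1 \<le> q" "1 \<le> p"
  shows "ordered_mixed_lp q p (\<lambda>z. ennreal \<bar>mollify r f z\<bar>) \<le> ordered_mixed_lp q p (\<lambda>z. ennreal \<bar>f z\<bar>)"
proof -
  have "f \<in> borel_measurable borel" using f by simp
  then show ?thesis
    using assms mixed_lp_mollify_le[OF r integrable_swap[OF f]]
    by (simp add: ordered_mixed_lp_def mixed_lp_mollify_le mollify_swap)
qed

lemma mollify_tendsto_ordered_mixed_lp:
  assumes f: "integrable lborel f" and p: "1 \<le> q" "1 \<le> p"
    and fin: "ordered_mixed_lp q p (\<lambda>z. ennreal \<bar>f z\<bar>) < \<infinity>" and r: "\<And>n. 0 < r n" "r \<longlonglongrightarrow> 0"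
  shows "(\<lambda>n. ordered_mixed_lp q p (\<lambda>z. ennreal \<bar>mollify (r n) f z - f z\<bar>)) \<longlonglongrightarrow> 0"
proof -
  have "f \<in> borel_measurable borel" using f by simp
  then show ?thesis
    using mollify_tendsto_mixed_lp[OF f p _ r] mollify_tendsto_mixed_lp[OF integrable_swap[OF f] p(2,1) _ r] fin
    by (cases "p > q") (simp_all add: ordered_mixed_lp_def mollify_swap)
qed

lemma nn_integral_swap:
  fixes F :: "'a::euclidean_space \<times> 'b::euclidean_space \<Rightarrow> ennreal"
  assumes [measurable]: "F \<in> borel_measurable borel"
  shows "(\<integral>\<^sup>+z. F (snd z, fst z) \<partial>lborel) = (\<integral>\<^sup>+z. F z \<partial>lborel)"
  by (subst (2) distr_lborel_swap[symmetric], subst nn_integral_distr) auto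

lemma nn_integral_finite_of_ordered_mixed_lp:
  fixes F :: "'a::euclidean_space \<times> 'b::euclidean_space \<Rightarrow> ennreal"
  assumes [measurable]: "F \<in> borel_measurable borel" and p: "1 < q" "1 < p"
    and fin: "ordered_mixed_lp q p F < \<infinity>" and B: "bounded B" "\<And>z. z \<notin> B \<Longrightarrow> F z = 0"
  shows "(\<integral>\<^sup>+z. F z \<partial>lborel) < \<infinity>"
proof (cases "p > q")
  case True
  then show ?thesis
    using nn_integral_finite_of_mixed_lp[of F q p B] assms by (simp add: ordered_mixed_lp_def)
next
  case False
  have "bounded ((\<lambda>z. (snd z, fst z)) ` B)"
  proof -
    have "bounded (snd ` B \<times> fst ` B)" using B(1) by (intro bounded_Times bounded_fst bounded_snd)
    then show ?thesis by (rule bounded_subset) auto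
  qed
  moreover have "F (snd z, fst z) = 0" if "z \<notin> (\<lambda>z. (snd z, fst z)) ` B" for z
  proof (rule B(2), rule notI)
    assume "(snd z, fst z) \<in> B"
    then have "(\<lambda>z. (snd z, fst z)) (snd z, fst z) \<in> (\<lambda>z. (snd z, fst z)) ` B" by (rule imageI)
    then show False using that by simp
  qed
  ultimately have "(\<integral>\<^sup>+z. F (snd z, fst z) \<partial>lborel) < \<infinity>"
    using False p fin
    by (intro nn_integral_finite_of_mixed_lp[where B = "(\<lambda>z. (snd z, fst z)) ` B" and \<alpha> = p and \<beta> = q])
      (auto simp: ordered_mixed_lp_def)
  then show ?thesis by (simp add: nn_integral_swap)
qed

text \<open>The cut at a level depending on time needs time outermost. If \<open>q \<ge> p\<close>,
  the given norm has time inside with the larger exponent, and by Minkowski's inequality it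
  dominates the norm with time outside.\<close>

lemma mixed_lp_le_ordered_mixed_lp:
  fixes F :: "'a::euclidean_space \<times> 'b::euclidean_space \<Rightarrow> ennreal"
  assumes [measurable]: "F \<in> borel_measurable borel" and "0 < q" "0 < p"
  shows "mixed_lp q p F \<le> ordered_mixed_lp q p F"
proof (cases "p > q")
  case False
  have m: "(\<lambda>z. F (snd z, fst z)) \<in> borel_measurable (lborel \<Otimes>\<^sub>M lborel)"
    by (simp add: lborel_prod)
  have "lp_norm lborel q (\<lambda>t. lp_norm lborel p (\<lambda>x. F (t, x))) \<le> lp_norm lborel p (\<lambda>x. lp_norm lborel q (\<lambda>t. F (t, x)))"
    using False assms m
    by (intro lp_norm_Minkowski_swap lborel.sigma_finite_measure_axioms) (auto simp: split_beta')
  then show ?thesis using False by (simp add: ordered_mixed_lp_def mixed_lp_def)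
qed (simp add: ordered_mixed_lp_def)

text \<open>Reduced to the approximation on product spaces: f(t) is multiplied by the indicator of
  [0, 1] in an auxiliary variable. If every slice over [0, 1] had error at least \<open>e\<close>,
  so would the approximation in the plane; hence some slice is good.\<close>

lemma continuous_L1_approx_real:
  fixes f :: "real \<Rightarrow> real"
  assumes f: "integrable lborel f" "\<And>t. 0 \<le> f t" and e: "0 < e"
  obtains g where "continuous_on UNIV g" "\<And>t. 0 \<le> g t" "(\<integral>\<^sup>+t. ennreal \<bar>f t - g t\<bar> \<partial>lborel) < e"
proof -
  have [measurable]: "f \<in> borel_measurable borel" using f by simp
  define F where "F z = f (fst z) * indicator {0..1} (snd z)" for z :: "real \<times> real"
  have [measurable]: "F \<in> borel_measurable borel"
    unfolding F_def borel_prod[symmetric] by measurable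
  have eq: "mixed_lp 1 1 K = (\<integral>\<^sup>+x. \<integral>\<^sup>+t. K (t, x) \<partial>lborel \<partial>lborel)" if [measurable]: "K \<in> borel_measurable borel" for K :: "real \<times> real \<Rightarrow> ennreal"
    unfolding mixed_lp_def lp_norm_one
    using lborel_pair.Fubini'[of "\<lambda>t x. K (t, x)"] by (simp add: lborel_prod)
  have Fe: "ennreal \<bar>F z\<bar> = ennreal (f (fst z)) * indicator {0..1} (snd z)" for z
    using f by (simp add: F_def indicator_def)
  have "mixed_lp 1 1 (\<lambda>z. ennreal \<bar>F z\<bar>) = (\<integral>\<^sup>+x. \<integral>\<^sup>+t. ennreal \<bar>F (t, x)\<bar> \<partial>lborel \<partial>lborel)"
    by (rule eq) measurable
  also have "\<dots> = (\<integral>\<^sup>+x. \<integral>\<^sup>+t. ennreal (f t) * indicator {0..1} (x :: real) \<partial>lborel \<partial>lborel)"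
    by (simp only: Fe fst_conv snd_conv)
  also have "\<dots> = (\<integral>\<^sup>+t. ennreal (f t) \<partial>lborel)"
    by (simp add: nn_integral_multc nn_integral_cmult)
  also have "\<dots> < \<infinity>"
    using f by (simp add: integrable_iff_bounded)
  finally have fin: "mixed_lp 1 1 (\<lambda>z. ennreal \<bar>F z\<bar>) < \<infinity>" .
  obtain g R where g: "continuous_on UNIV g" "\<And>z. R < norm z \<Longrightarrow> g z = 0"
    "mixed_lp 1 1 (\<lambda>z. ennreal \<bar>F z - g z\<bar>) < e"
    by (rule mixed_lp_continuous_approx[OF _ _ _ fin e]) auto
  have [measurable]: "g \<in> borel_measurable borel" using g(1) by (rule borel_measurable_continuous_onI)
  have "\<exists>x\<in>{0..1}. (\<integral>\<^sup>+t. ennreal \<bar>f t - g (t, x)\<bar> \<partial>lborel) < e"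
  proof (rule ccontr)
    assume "\<not> (\<exists>x\<in>{0..1}. (\<integral>\<^sup>+t. ennreal \<bar>f t - g (t, x)\<bar> \<partial>lborel) < e)"
    then have "e * indicator {0..1} x \<le> (\<integral>\<^sup>+t. ennreal \<bar>F (t, x) - g (t, x)\<bar> \<partial>lborel)" for x
      by (cases "x \<in> {0..1}") (auto simp: F_def not_less)
    then have "(\<integral>\<^sup>+x. e * indicator {0..1} (x :: real) \<partial>lborel) \<le> mixed_lp 1 1 (\<lambda>z. ennreal \<bar>F z - g z\<bar>)"
      by (subst eq) (auto intro: nn_integral_mono)
    then have "e \<le> mixed_lp 1 1 (\<lambda>z. ennreal \<bar>F z - g z\<bar>)"
      by (simp add: nn_integral_cmult)
    then show False using g(3) by simp
  qed
  then obtain x where x: "(\<integral>\<^sup>+t. ennreal \<bar>f t - g (t, x)\<bar> \<partial>lborel) < e" by blast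
  show ?thesis
  proof (rule that[of "\<lambda>t. max 0 (g (t, x))"])
    show "continuous_on UNIV (\<lambda>t. max 0 (g (t, x)))"
      by (intro continuous_intros continuous_on_compose2[OF g(1)]) auto
    have "(\<integral>\<^sup>+t. ennreal \<bar>f t - max 0 (g (t, x))\<bar> \<partial>lborel) \<le> (\<integral>\<^sup>+t. ennreal \<bar>f t - g (t, x)\<bar> \<partial>lborel)"
    proof (intro nn_integral_mono ennreal_leI)
      fix t show "\<bar>f t - max 0 (g (t, x))\<bar> \<le> \<bar>f t - g (t, x)\<bar>" using f(2)[of t] by (simp add: max_def)
    qed
    then show "(\<integral>\<^sup>+t. ennreal \<bar>f t - max 0 (g (t, x))\<bar> \<partial>lborel) < e" using x by simp
  qed simp
qed

subsection \<open>The main estimate\<close>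

lemma emeasure_compact_finite: "compact S \<Longrightarrow> emeasure lborel S < \<infinity>"
  using emeasure_bounded_finite[of S] compact_imp_bounded by auto

lemma primitive_of_continuous:
  fixes l :: "real \<Rightarrow> real"
  assumes cont: "continuous_on UNIV l" and nonneg: "\<And>t. 0 \<le> l t"
    and bound: "(\<integral>\<^sup>+t. ennreal (l t) \<partial>lborel) \<le> ennreal J" "0 \<le> J"
  obtains L where "\<And>t. t \<in> {T1..T2} \<Longrightarrow> (L has_field_derivative l t) (at t)"
    "\<And>t. t \<in> {T1..T2} \<Longrightarrow> 0 \<le> L t" "\<And>t. t \<in> {T1..T2} \<Longrightarrow> L t \<le> J"
proof -
  \<comment> \<open>The integral starts at T1 - 1 so that the derivative at the endpoint T1 is
    two-sided; subtracting a constant makes \<open>L\<close> vanish at T1.\<close>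
  define L where "L t = integral {T1 - 1..t} l - integral {T1 - 1..T1} l" for t
  have int: "l integrable_on {x..y}" for x y
    by (intro integrable_continuous_real continuous_on_subset[OF cont]) auto
  have L: "L t = integral {T1..t} l" if "T1 \<le> t" for t
    unfolding L_def using that Henstock_Kurzweil_Integration.integral_combine[of "T1 - 1" T1 t l] int by simp
  show ?thesis
  proof (rule that[of L])
    fix t assume t: "t \<in> {T1..T2}"
    have "((\<lambda>t. integral {T1 - 1..t} l) has_field_derivative l t) (at t within {T1 - 1..T2 + 1})"
      using t by (intro integral_has_real_derivative continuous_on_subset[OF cont]) auto
    moreover have "at t within {T1 - 1..T2 + 1} = at t"
      using t by (intro at_within_interior) auto
    ultimately have "((\<lambda>t. integral {T1 - 1..t} l) has_field_derivative l t) (at t)" by simp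
    then show "(L has_field_derivative l t) (at t)"
      unfolding L_def by (auto intro!: derivative_eq_intros)
    show "0 \<le> L t" using t nonneg by (simp add: L int Henstock_Kurzweil_Integration.integral_nonneg)
    have "ennreal (integral {T1..t} l) = (\<integral>\<^sup>+s. ennreal (l s) * indicator {T1..t} s \<partial>lborel)"
      using nonneg int by (intro nn_integral_has_integral_lebesgue'[symmetric]) (auto intro: integrable_integral)
    also have "\<dots> \<le> (\<integral>\<^sup>+s. ennreal (l s) \<partial>lborel)"
      by (intro nn_integral_mono) (auto simp: indicator_def)
    also have "\<dots> \<le> ennreal J" by (rule bound)
    finally have "ennreal (integral {T1..t} l) \<le> ennreal J" .
    then show "L t \<le> J" using t bound(2) by (simp add: L)
  qed
qed

text \<open>Adding a primitive of the level to \<open>v\<close> leaves the gradient alone, cancels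
  the part \<open>l\<close> of the bound on the descent, and costs \<open>J\<close> of the gap. The
  level is only integrable, whereas the contact estimate needs a continuous time derivative; so
  \<open>l\<close> is replaced by a continuous \<open>l'\<close> and the difference goes into
  \<open>D\<close>. \<open>A\<close> is the absolute time derivative of the modified function on its
  contact set, and \<open>X\<close> is the part of the bound that is left to the caller.\<close>

lemma contact_core:
  fixes v a H :: "real \<times> (real ^ 'd) \<Rightarrow> real" and G :: "real \<times> (real ^ 'd) \<Rightarrow> real ^ 'd"
    and X :: "real \<times> (real ^ 'd) \<Rightarrow> ennreal" and l :: "real \<Rightarrow> real"
  assumes W: "compact W" "x0 \<in> W" and T: "T1 < T2"
    and dv: "\<And>z. z \<in> {T1..T2} \<times> W \<Longrightarrow> (v has_derivative (\<lambda>h. a z * fst h + G z \<bullet> snd h)) (at z)"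
    and dG: "\<And>z. z \<in> {T1..T2} \<times> W \<Longrightarrow> (G has_derivative G' z) (at z)"
    and G': "\<And>z i j. z \<in> {T1..T2} \<times> W \<Longrightarrow> \<bar>G' z (0, axis j 1) $ i\<bar> \<le> H z"
    and cont: "continuous_on UNIV a" "continuous_on UNIV H" and H0: "\<And>z. 0 \<le> H z"
    and start: "m1 \<le> v (T1, x0)"
    and top: "\<And>x. x \<in> W \<Longrightarrow> v (T2, x) \<le> m2"
    and side: "\<And>t x. t \<in> {T1..T2} \<Longrightarrow> x \<in> frontier W \<Longrightarrow> v (t, x) \<le> m2"
    and U: "\<And>z. z \<in> {T1..T2} \<times> W \<Longrightarrow> \<bar>v z\<bar> \<le> U"
    and R: "\<And>x. x \<in> W \<Longrightarrow> norm (x - x0) \<le> R" and \<delta>: "0 < \<delta>"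
    and l: "integrable lborel l" "\<And>t. 0 \<le> l t" "(\<integral>\<^sup>+t. ennreal (l t) \<partial>lborel) \<le> ennreal J" "0 \<le> J"
    and gap: "0 < g" "m2 + J + \<delta> * R + g < m1"
    and X[measurable]: "X \<in> borel_measurable borel"
    and bound: "AE z in lborel. z \<in> {T1..T2} \<times> W \<longrightarrow> norm (G z) \<le> \<delta> \<longrightarrow> ennreal (- a z) \<le> ennreal (l (fst z)) + X z"
    and s: "0 < s"
  obtains A D :: "real \<times> (real ^ 'd) \<Rightarrow> ennreal"
  where "A \<in> borel_measurable borel" "D \<in> borel_measurable borel"
    "AE z in lborel. A z \<le> X z + D z"
    "(\<integral>\<^sup>+z. D z * ennreal (H z ^ CARD('d)) \<partial>lborel) \<le> ennreal s"
    "\<And>x. (\<integral>\<^sup>+t. A (t, x) \<partial>lborel) \<le> ennreal (2 * U + J + 1)"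
    "ennreal g * emeasure lborel (ball (0 :: real ^ 'd) \<delta>) \<le>
       ennreal (fact (CARD('d) + 1)) * (\<integral>\<^sup>+z. A z * ennreal (H z ^ CARD('d)) \<partial>lborel)"
proof -
  let ?C = "{T1..T2} \<times> W"
  have C: "compact ?C" using W by (intro compact_Times) auto
  have Wb[measurable]: "W \<in> sets borel" using W by (simp add: borel_compact)
  have [measurable]: "a \<in> borel_measurable borel" "H \<in> borel_measurable borel" "l \<in> borel_measurable borel"
    using cont l(1) by (auto intro: borel_measurable_continuous_onI)
  have [measurable]: "fst \<in> borel_measurable (borel :: (real \<times> (real ^ 'd)) measure)"
    "snd \<in> borel_measurable (borel :: (real \<times> (real ^ 'd)) measure)"
    by (intro borel_measurable_continuous_onI continuous_intros)+
  obtain Hm where Hm: "0 \<le> Hm" "\<And>z. z \<in> ?C \<Longrightarrow> H z \<le> Hm"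
  proof -
    have "bounded (H ` ?C)"
      using C cont(2) by (intro compact_imp_bounded compact_continuous_image) (auto intro: continuous_on_subset)
    then obtain B where "\<forall>z\<in>?C. \<bar>H z\<bar> \<le> B" unfolding bounded_iff by auto
    then show ?thesis by (intro that[of "max 0 B"]) (auto simp: le_max_iff_disj abs_le_iff)
  qed
  obtain w where w: "emeasure lborel W = ennreal w" "0 \<le> w"
    using emeasure_compact_finite[OF W(1)] by (cases "emeasure lborel W") auto
  \<comment> \<open>The error of approximating the level must leave the gap open (half of the slack
    is used), contribute at most \<open>s\<close> after multiplication by the maximum of the power
    of \<open>H\<close> and the measure of \<open>W\<close>, and not exceed 1.\<close>
  define e where "e = min 1 (min ((m1 - (m2 + J + \<delta> * R + g)) / 2) (s / (Hm ^ CARD('d) * w + 1)))"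
  have Kw: "0 \<le> Hm ^ CARD('d) * w" using Hm w by simp
  have e: "0 < e" "e \<le> 1" "m2 + (J + e) + \<delta> * R + g \<le> m1" "e * (Hm ^ CARD('d) * w) \<le> s"
  proof -
    show "0 < e" using gap s Kw by (auto simp: e_def)
    show "e \<le> 1" by (simp add: e_def)
    have "e \<le> (m1 - (m2 + J + \<delta> * R + g)) / 2"
      unfolding e_def by (rule min.coboundedI2[OF min.cobounded1])
    then show "m2 + (J + e) + \<delta> * R + g \<le> m1" using gap by (simp add: field_simps)
    have "e * (Hm ^ CARD('d) * w) \<le> e * (Hm ^ CARD('d) * w + 1)"
      using \<open>0 < e\<close> by simp
    also have "\<dots> \<le> s / (Hm ^ CARD('d) * w + 1) * (Hm ^ CARD('d) * w + 1)"
      using Kw by (intro mult_right_mono) (auto simp: e_def)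
    also have "\<dots> = s" using Kw by simp
    finally show "e * (Hm ^ CARD('d) * w) \<le> s" .
  qed
  obtain l' where l': "continuous_on UNIV l'" "\<And>t. 0 \<le> l' t" "(\<integral>\<^sup>+t. ennreal \<bar>l t - l' t\<bar> \<partial>lborel) < ennreal e"
    using continuous_L1_approx_real[OF l(1,2), of "ennreal e"] e by auto
  have [measurable]: "l' \<in> borel_measurable borel" using l'(1) by (rule borel_measurable_continuous_onI)
  have "(\<integral>\<^sup>+t. ennreal (l' t) \<partial>lborel) \<le> (\<integral>\<^sup>+t. ennreal (l t) + ennreal \<bar>l t - l' t\<bar> \<partial>lborel)"
    using l(2) by (intro nn_integral_mono) (auto simp flip: ennreal_plus intro!: ennreal_leI)
  also have "\<dots> = (\<integral>\<^sup>+t. ennreal (l t) \<partial>lborel) + (\<integral>\<^sup>+t. ennreal \<bar>l t - l' t\<bar> \<partial>lborel)"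
    by (intro nn_integral_add) auto
  also have "\<dots> \<le> ennreal J + ennreal e"
    using l(3) l'(3) by (intro add_mono) auto
  also have "\<dots> = ennreal (J + e)"
    using l(4) e by simp
  finally have l'J: "(\<integral>\<^sup>+t. ennreal (l' t) \<partial>lborel) \<le> ennreal (J + e)" .
  obtain L where L: "\<And>t. t \<in> {T1..T2} \<Longrightarrow> (L has_field_derivative l' t) (at t)"
    "\<And>t. t \<in> {T1..T2} \<Longrightarrow> 0 \<le> L t" "\<And>t. t \<in> {T1..T2} \<Longrightarrow> L t \<le> J + e"
    by (rule primitive_of_continuous[OF l'(1,2) l'J]) (use l(4) e in auto)
  define v' where "v' z = v z + L (fst z)" for z
  define a' where "a' z = a z + l' (fst z)" for z
  have dv': "(v' has_derivative (\<lambda>h. a' z * fst h + G z \<bullet> snd h)) (at z)" if z: "z \<in> ?C" for z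
  proof -
    have "(L has_derivative (\<lambda>h. l' (fst z) * h)) (at (fst z))"
      using L(1)[of "fst z"] z by (auto simp: has_field_derivative_def)
    then have "((\<lambda>z. L (fst z)) has_derivative (\<lambda>h. l' (fst z) * fst h)) (at z)"
      using has_derivative_compose[of fst fst z UNIV L "\<lambda>h. l' (fst z) * h"]
      by (simp add: has_derivative_fst)
    then have "(v' has_derivative (\<lambda>h. (a z * fst h + G z \<bullet> snd h) + l' (fst z) * fst h)) (at z)"
      unfolding v'_def by (rule has_derivative_add[OF dv[OF z]])
    moreover have "(\<lambda>h. (a z * fst h + G z \<bullet> snd h) + l' (fst z) * fst h) = (\<lambda>h. a' z * fst h + G z \<bullet> snd h)"
      by (auto simp: a'_def algebra_simps)
    ultimately show ?thesis by simp
  qed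
  have conta': "continuous_on S a'" for S
    unfolding a'_def
    by (intro continuous_intros continuous_on_subset[OF cont(1)] continuous_on_compose2[OF l'(1)]) auto
  define \<Gamma> where "\<Gamma> = contact_set v' a' G T1 T2 W \<delta>"
  have \<Gamma>C: "\<Gamma> \<subseteq> ?C" by (auto simp: \<Gamma>_def contact_set_def)
  have "compact \<Gamma>"
    unfolding \<Gamma>_def
    by (intro compact_contact_set W conta' has_derivative_continuous_on[OF has_derivative_at_withinI[OF dv']]
        has_derivative_continuous_on[OF has_derivative_at_withinI[OF dG]])
  then have \<Gamma>b[measurable]: "\<Gamma> \<in> sets borel" by (rule borel_compact)
  define A where "A z = ennreal \<bar>a' z\<bar> * indicator \<Gamma> z" for z
  define D where "D z = ennreal \<bar>l (fst z) - l' (fst z)\<bar> * indicator ?C z" for z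
  have Cb[measurable]: "?C \<in> sets borel" using C by (rule borel_compact)
  have a'm[measurable]: "a' \<in> borel_measurable borel" using conta' by (rule borel_measurable_continuous_onI)
  have Am: "A \<in> borel_measurable borel" unfolding A_def by measurable
  have Dm: "D \<in> borel_measurable borel" unfolding D_def by measurable
  have AD: "AE z in lborel. A z \<le> X z + D z"
    using bound
  proof eventually_elim
    case (elim z)
    show ?case
    proof (cases "z \<in> \<Gamma>")
      case True
      then have z: "z \<in> ?C" "norm (G z) \<le> \<delta>" "a' z \<le> 0" by (auto simp: \<Gamma>_def contact_set_def)
      then have le: "ennreal (- a z) \<le> ennreal (l (fst z)) + X z" using elim by blast
      have "ennreal (- a' z) \<le> X z + ennreal \<bar>l (fst z) - l' (fst z)\<bar>"
      proof (cases "X z")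
        case (real x)
        then have "ennreal (- a z) \<le> ennreal (l (fst z) + x)"
          using le l(2)[of "fst z"] by simp
        then have "- a z \<le> l (fst z) + x"
          using l(2)[of "fst z"] real(1) by (subst (asm) ennreal_le_iff) auto
        then have "- a' z \<le> x + \<bar>l (fst z) - l' (fst z)\<bar>" by (simp add: a'_def)
        then show ?thesis using real by (simp add: ennreal_leI flip: ennreal_plus)
      qed simp
      then show ?thesis using z True by (simp add: A_def D_def)
    qed (simp add: A_def)
  qed
  have DH: "(\<integral>\<^sup>+z. D z * ennreal (H z ^ CARD('d)) \<partial>lborel) \<le> ennreal s"
  proof -
    have "(\<integral>\<^sup>+z. D z * ennreal (H z ^ CARD('d)) \<partial>lborel) \<le>
      (\<integral>\<^sup>+z. ennreal \<bar>l (fst z) - l' (fst z)\<bar> * (ennreal (Hm ^ CARD('d)) * indicator W (snd z)) \<partial>lborel)"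
    proof (intro nn_integral_mono)
      fix z
      show "D z * ennreal (H z ^ CARD('d)) \<le> ennreal \<bar>l (fst z) - l' (fst z)\<bar> * (ennreal (Hm ^ CARD('d)) * indicator W (snd z))"
      proof (cases "z \<in> ?C")
        case True
        then have "ennreal (H z ^ CARD('d)) \<le> ennreal (Hm ^ CARD('d))"
          using Hm H0 by (intro ennreal_leI power_mono) auto
        then show ?thesis using True by (auto simp: D_def mem_Times_iff intro!: mult_left_mono)
      qed (simp add: D_def)
    qed
    also have "\<dots> = (\<integral>\<^sup>+t. \<integral>\<^sup>+x. ennreal \<bar>l t - l' t\<bar> * (ennreal (Hm ^ CARD('d)) * indicator W x) \<partial>lborel \<partial>lborel)"
      by (subst lborel_prod[symmetric], subst lborel.nn_integral_fst[symmetric]) (auto simp: lborel_prod)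
    also have "\<dots> = (\<integral>\<^sup>+t. ennreal \<bar>l t - l' t\<bar> * (ennreal (Hm ^ CARD('d)) * emeasure lborel W) \<partial>lborel)"
      by (simp add: nn_integral_cmult nn_integral_cmult_indicator)
    also have "\<dots> = (\<integral>\<^sup>+t. ennreal \<bar>l t - l' t\<bar> \<partial>lborel) * (ennreal (Hm ^ CARD('d)) * emeasure lborel W)"
      by (intro nn_integral_multc) auto
    also have "\<dots> \<le> ennreal e * (ennreal (Hm ^ CARD('d)) * emeasure lborel W)"
      using l'(3) by (intro mult_right_mono) auto
    also have "\<dots> = ennreal (e * (Hm ^ CARD('d) * w))"
      using w e Hm by (simp add: ennreal_mult)
    also have "\<dots> \<le> ennreal s" using e(4) by (rule ennreal_leI)
    finally show ?thesis .
  qed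
  have col: "(\<integral>\<^sup>+t. A (t, x) \<partial>lborel) \<le> ennreal (2 * U + J + 1)" for x
  proof (cases "x \<in> W")
    case True
    define S where "S = {t. (t, x) \<in> \<Gamma>}"
    have "closed ((\<lambda>t. (t, x)) -` \<Gamma>)"
      using \<open>compact \<Gamma>\<close> by (intro continuous_closed_vimage compact_imp_closed) (auto intro!: continuous_intros)
    then have Sb: "S \<in> sets borel" by (simp add: S_def vimage_def)
    have Ssub: "S \<subseteq> {T1..T2}" using \<Gamma>C by (auto simp: S_def)
    have df: "((\<lambda>t. v' (t, x)) has_field_derivative a' (t, x)) (at t)" if "t \<in> {T1..T2}" for t
    proof -
      have "((\<lambda>t. (t, x)) has_derivative (\<lambda>h. (h, 0))) (at t)"
        by (auto intro!: derivative_eq_intros)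
      then have "((\<lambda>t. v' (t, x)) has_derivative (\<lambda>h. a' (t, x) * h)) (at t)"
        using has_derivative_compose[of "\<lambda>t. (t, x)" _ t UNIV v'] dv'[of "(t, x)"] that True by force
      then show ?thesis by (simp add: has_field_derivative_def)
    qed
    have cf: "continuous_on {T1..T2} (\<lambda>t. a' (t, x))"
      by (intro continuous_on_compose2[OF conta'[of UNIV]] continuous_intros) auto
    \<comment> \<open>The modified function oscillates by at most 2 U + J + e, which is the source
      of the column bound 2 U + J + 1.\<close>
    have rng: "v' (t, x) \<in> {- U..U + (J + e)}" if "t \<in> {T1..T2}" for t
      using U[of "(t, x)"] L(2,3)[OF that] that True by (auto simp: v'_def abs_le_iff)
    have "(\<integral>\<^sup>+t\<in>S. ennreal \<bar>a' (t, x)\<bar> \<partial>lborel) \<le> ennreal (U + (J + e) - (- U))"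
    proof (rule nn_integral_abs_deriv_record_le[OF Sb Ssub df cf _ _ rng])
      show "v' (s, x) \<le> v' (t, x)" if "t \<in> S" "s \<in> {t..T2}" for t s
        using that by (auto simp: S_def \<Gamma>_def contact_set_def)
      show "a' (t, x) \<le> 0" if "t \<in> S" for t
        using that by (simp add: S_def \<Gamma>_def contact_set_def)
    qed
    also have "\<dots> \<le> ennreal (2 * U + J + 1)" using e by (intro ennreal_leI) auto
    also have "(\<integral>\<^sup>+t\<in>S. ennreal \<bar>a' (t, x)\<bar> \<partial>lborel) = (\<integral>\<^sup>+t. A (t, x) \<partial>lborel)"
      by (intro nn_integral_cong) (auto simp: A_def S_def indicator_def)
    finally show ?thesis .
  next
    case False
    then have "A (t, x) = 0" for t using \<Gamma>C by (auto simp: A_def indicator_def)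
    then show ?thesis by simp
  qed
  have "ennreal g * emeasure lborel (ball (0 :: real ^ 'd) \<delta>) \<le> ennreal (m1 - (m2 + (J + e)) - \<delta> * R) * emeasure lborel (ball (0 :: real ^ 'd) \<delta>)"
    using e(3) by (intro mult_right_mono ennreal_leI) auto
  also have "\<dots> \<le> (\<integral>\<^sup>+z\<in>\<Gamma>. ennreal (fact (CARD('d) + 1) * (\<bar>a' z\<bar> * H z ^ CARD('d))) \<partial>lborel)"
    unfolding \<Gamma>_def
  proof (rule contact_set_estimate[OF W _ dv' dG G'])
    show "m1 \<le> v' (T1, x0)" using start L(2)[of T1] T by (simp add: v'_def)
    show "v' (T2, x) \<le> m2 + (J + e)" if "x \<in> W" for x
      using top[OF that] L(3)[of T2] T by (simp add: v'_def)
    show "v' (t, x) \<le> m2 + (J + e)" if "t \<in> {T1..T2}" "x \<in> frontier W" for t x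
      using side[OF that] L(3)[OF that(1)] by (simp add: v'_def)
  qed (use T \<delta> e gap R conta' continuous_on_subset[OF cont(2)] in auto)
  also have "\<dots> = (\<integral>\<^sup>+z. ennreal (fact (CARD('d) + 1)) * (A z * ennreal (H z ^ CARD('d))) \<partial>lborel)"
    by (intro nn_integral_cong) (auto simp: A_def indicator_def ennreal_mult' H0)
  also have "\<dots> = ennreal (fact (CARD('d) + 1)) * (\<integral>\<^sup>+z. A z * ennreal (H z ^ CARD('d)) \<partial>lborel)"
    using Am by (intro nn_integral_cmult) auto
  finally have main: "ennreal g * emeasure lborel (ball (0 :: real ^ 'd) \<delta>) \<le>
       ennreal (fact (CARD('d) + 1)) * (\<integral>\<^sup>+z. A z * ennreal (H z ^ CARD('d)) \<partial>lborel)" .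
  show ?thesis
    by (rule that[OF Am Dm AD DH col main])
qed

lemma AE_lborel_fst:
  assumes "AE t in (lborel :: 'a::euclidean_space measure). P t"
  shows "AE z in (lborel :: ('a \<times> 'b::euclidean_space) measure). P (fst z)"
proof -
  obtain N where N: "{t \<in> space lborel. \<not> P t} \<subseteq> N" "emeasure lborel N = 0" "N \<in> sets lborel"
    using AE_E[OF assms] .
  have "emeasure (lborel \<Otimes>\<^sub>M lborel) (N \<times> (UNIV :: 'b set)) = 0"
    using N by (subst lborel.emeasure_pair_measure_Times) auto
  then have "N \<times> (UNIV :: 'b set) \<in> null_sets lborel"
    using N(3) unfolding lborel_prod by (intro null_setsI) (auto intro!: borel_Times)
  then show ?thesis
    using N(1) by (intro AE_I'[of "N \<times> (UNIV :: 'b set)"]) auto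
qed

lemma ennreal_power_eq_powr: "0 \<le> x \<Longrightarrow> 0 < n \<Longrightarrow> ennreal (x ^ n) = ennreal_powr (ennreal x) (real n)"
  by (cases "x = 0") (auto simp: ennreal_powr_ennreal powr_realpow)

text \<open>The split at each time, integrated over time. One quantity controls both costs: it
  bounds the integral of the level, which is taken from the gap, and, multiplied by the order
  \<delta>^d of the volume of the ball of slopes, it bounds the contribution from above the
  level.\<close>

lemma nn_integral_level_split_le:
  fixes B H :: "'a::euclidean_space \<times> 'b::euclidean_space \<Rightarrow> ennreal"
  assumes [measurable]: "B \<in> borel_measurable borel" "H \<in> borel_measurable borel"
    and d: "0 < d" and pq: "1 < q" "1 < q0" "1 < p / d" "d / p + 1 / q = 1" "d / p0 + 1 / q0 = 1" "q \<le> p0"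
    and \<delta>: "0 < \<delta>"
    and NB: "mixed_lp q0 p0 B \<le> ennreal NB" "0 \<le> NB" and NH: "mixed_lp q p H \<le> ennreal NH" "0 \<le> NH"
  obtains l where "l \<in> borel_measurable borel"
    "(\<integral>\<^sup>+t. l t \<partial>lborel) \<le> ennreal (NB * (NH / \<delta>) powr (q * d / p0))"
    "(\<integral>\<^sup>+z. (if l (fst z) < B z then B z else 0) * ennreal_powr (H z) d \<partial>lborel) \<le>
       ennreal (\<delta> powr d * (NB * (NH / \<delta>) powr (q * d / p0)))"
proof -
  define \<beta> where "\<beta> t = lp_norm lborel p0 (\<lambda>x. B (t, x))" for t
  define k where "k t = lp_norm lborel p (\<lambda>x. H (t, x))" for t
  define l where "l t = \<beta> t * ennreal_powr (ennreal (1 / \<delta>) * k t) (q * d / p0)" for t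
  have [measurable]: "\<beta> \<in> borel_measurable borel" "k \<in> borel_measurable borel"
    unfolding \<beta>_def k_def by measurable
  have l[measurable]: "l \<in> borel_measurable borel" unfolding l_def by measurable
  have [measurable]: "fst \<in> borel_measurable (borel :: ('a \<times> 'b) measure)"
    by (intro borel_measurable_continuous_onI continuous_intros)
  have p0: "0 < p0" using pq by linarith
  have "(\<integral>\<^sup>+t. l t \<partial>lborel) \<le> lp_norm lborel q0 \<beta> * ennreal_powr (ennreal (1 / \<delta>) * lp_norm lborel q k) (q * d / p0)"
    unfolding l_def using d pq \<delta> p0 by (intro nn_integral_split_level_le) auto
  also have "\<dots> \<le> ennreal NB * ennreal_powr (ennreal (1 / \<delta>) * ennreal NH) (q * d / p0)"
    using NB NH d pq p0 unfolding mixed_lp_def \<beta>_def k_def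
    by (intro mult_mono ennreal_powr_mono) auto
  also have "\<dots> = ennreal (NB * (NH / \<delta>) powr (q * d / p0))"
    using NB(2) NH(2) \<delta> by (simp add: ennreal_powr_ennreal flip: ennreal_mult)
  finally have int: "(\<integral>\<^sup>+t. l t \<partial>lborel) \<le> ennreal (NB * (NH / \<delta>) powr (q * d / p0))" .
  have "(\<integral>\<^sup>+z. (if l (fst z) < B z then B z else 0) * ennreal_powr (H z) d \<partial>lborel) =
     (\<integral>\<^sup>+t. \<integral>\<^sup>+x. (if l t < B (t, x) then B (t, x) else 0) * ennreal_powr (H (t, x)) d \<partial>lborel \<partial>lborel)"
    by (subst lborel_prod[symmetric], subst lborel.nn_integral_fst[symmetric]) (auto simp: lborel_prod)
  also have "\<dots> \<le> (\<integral>\<^sup>+t. ennreal (\<delta> powr d) * l t \<partial>lborel)"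
    unfolding l_def \<beta>_def k_def using d pq \<delta>
    by (intro nn_integral_mono lp_norm_level_split) auto
  also have "\<dots> = ennreal (\<delta> powr d) * (\<integral>\<^sup>+t. l t \<partial>lborel)"
    by (intro nn_integral_cmult) auto
  also have "\<dots> \<le> ennreal (\<delta> powr d) * ennreal (NB * (NH / \<delta>) powr (q * d / p0))"
    using int by (intro mult_left_mono) auto
  also have "\<dots> = ennreal (\<delta> powr d * (NB * (NH / \<delta>) powr (q * d / p0)))"
    using NB(2) by (simp add: ennreal_mult)
  finally show ?thesis using l int by (intro that[of l])
qed

lemma enn2real_representative:
  fixes l :: "real \<Rightarrow> ennreal"
  assumes [measurable]: "l \<in> borel_measurable borel" and "(\<integral>\<^sup>+t. l t \<partial>lborel) \<le> ennreal J"
  shows "integrable lborel (\<lambda>t. enn2real (l t))" "(\<integral>\<^sup>+t. ennreal (enn2real (l t)) \<partial>lborel) \<le> ennreal J"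
    "AE t in lborel. ennreal (enn2real (l t)) = l t"
proof -
  have fin: "(\<integral>\<^sup>+t. l t \<partial>lborel) < \<infinity>"
    using assms(2) le_less_trans ennreal_less_top by (metis infinity_ennreal_def)
  then have "AE t in lborel. l t \<noteq> \<infinity>"
    by (intro nn_integral_noteq_infinite) auto
  then show *: "AE t in lborel. ennreal (enn2real (l t)) = l t"
    by eventually_elim (simp add: less_top)
  have eq: "(\<integral>\<^sup>+t. ennreal (enn2real (l t)) \<partial>lborel) = (\<integral>\<^sup>+t. l t \<partial>lborel)"
    using * by (rule nn_integral_cong_AE)
  then show "(\<integral>\<^sup>+t. ennreal (enn2real (l t)) \<partial>lborel) \<le> ennreal J" using assms(2) by simp
  show "integrable lborel (\<lambda>t. enn2real (l t))"
    using eq fin by (simp add: integrable_iff_bounded)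
qed

text \<open>The drift part of the descent is always cut at a level. The mollification error
  \<open>h\<close> is treated in the same way if \<open>p > q\<close>, and by the column bound
  otherwise. The right-hand side collects the costs of both cases: \<open>J\<close> and
  \<open>s\<close> come from the levels, the last summand from the column bound. The condition
  \<open>J \<le> 1\<close> makes the column bound independent of \<open>J\<close>.\<close>

lemma contact_estimate:
  fixes v a H b h :: "real \<times> (real ^ 'd) \<Rightarrow> real" and G :: "real \<times> (real ^ 'd) \<Rightarrow> real ^ 'd"
    and p q p0 q0 :: real
  defines "d \<equiv> real CARD('d)"
  assumes pq: "1 < q" "1 < q0" "1 < p / d" "d / p + 1 / q = 1" "d / p0 + 1 / q0 = 1" "q \<le> p0"
    and W: "compact W" "x0 \<in> W" and T: "T1 < T2"
    and dv: "\<And>z. z \<in> {T1..T2} \<times> W \<Longrightarrow> (v has_derivative (\<lambda>h. a z * fst h + G z \<bullet> snd h)) (at z)"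
    and dG: "\<And>z. z \<in> {T1..T2} \<times> W \<Longrightarrow> (G has_derivative G' z) (at z)"
    and G': "\<And>z i j. z \<in> {T1..T2} \<times> W \<Longrightarrow> \<bar>G' z (0, axis j 1) $ i\<bar> \<le> H z"
    and cont: "continuous_on UNIV a" "continuous_on UNIV H" and H0: "\<And>z. 0 \<le> H z"
    and start: "m1 \<le> v (T1, x0)"
    and top: "\<And>x. x \<in> W \<Longrightarrow> v (T2, x) \<le> m2"
    and side: "\<And>t x. t \<in> {T1..T2} \<Longrightarrow> x \<in> frontier W \<Longrightarrow> v (t, x) \<le> m2"
    and U: "\<And>z. z \<in> {T1..T2} \<times> W \<Longrightarrow> \<bar>v z\<bar> \<le> U" "0 \<le> U"
    and R: "\<And>x. x \<in> W \<Longrightarrow> norm (x - x0) \<le> R" and \<delta>: "0 < \<delta>"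
    and b: "b \<in> borel_measurable borel" "\<And>z. 0 \<le> b z" and h: "h \<in> borel_measurable borel" "\<And>z. 0 \<le> h z"
    and bound: "AE z in lborel. z \<in> {T1..T2} \<times> W \<longrightarrow> norm (G z) \<le> \<delta> \<longrightarrow> - a z \<le> 2 * \<delta> * b z + h z"
    and Nb: "mixed_lp q0 p0 (\<lambda>z. ennreal (b z)) \<le> ennreal Nb" "0 \<le> Nb"
    and NH: "ordered_mixed_lp q p (\<lambda>z. ennreal (H z)) \<le> ennreal NH" "0 \<le> NH"
    and Nh: "ordered_mixed_lp q p (\<lambda>z. ennreal (h z)) \<le> ennreal Nh" "0 \<le> Nh"
    and J: "J = 2 * \<delta> * (Nb * (NH / \<delta>) powr (q * d / p0)) + Nh * (NH / \<delta>) powr (q * d / p)" "J \<le> 1"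
    and gap: "0 < g" "m2 + J + \<delta> * R + g < m1" and s: "0 < s"
  shows "g * measure lborel (ball (0 :: real ^ 'd) \<delta>) \<le>
    fact (CARD('d) + 1) * (2 * (\<delta> powr d * J + s) + (2 * U + 2) powr (1 - p / q) * ((2 * Nh) powr (p / q) * NH powr d))"
proof -
  have d: "0 < d" unfolding d_def by simp
  have p: "0 < p" "1 < p" "d < p"
  proof -
    show "d < p" using pq(3) d by (simp add: less_divide_eq)
    then show "0 < p" using d by simp
    have "1 \<le> d" unfolding d_def by (simp add: Suc_leI)
    then show "1 < p" using \<open>d < p\<close> by simp
  qed
  have p0: "0 < p0" using pq by linarith
  note [measurable] = b(1) h(1)
  have Hm[measurable]: "H \<in> borel_measurable borel" using cont(2) by (rule borel_measurable_continuous_onI)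
  have [measurable]: "fst \<in> borel_measurable (borel :: (real \<times> (real ^ 'd)) measure)"
    by (intro borel_measurable_continuous_onI continuous_intros)
  have NH': "mixed_lp q p (\<lambda>z. ennreal (H z)) \<le> ennreal NH"
    using mixed_lp_le_ordered_mixed_lp[of "\<lambda>z. ennreal (H z)" q p] NH(1) pq p by auto
  define Jb where "Jb = Nb * (NH / \<delta>) powr (q * d / p0)"
  define Jh where "Jh = Nh * (NH / \<delta>) powr (q * d / p)"
  have J': "J = 2 * \<delta> * Jb + Jh" "0 \<le> Jb" "0 \<le> Jh" using J Nb Nh by (auto simp: Jb_def Jh_def)
  then have J0: "0 \<le> J" using \<delta> by simp
  obtain lb where lb[measurable]: "lb \<in> borel_measurable borel" and lbJ: "(\<integral>\<^sup>+t. lb t \<partial>lborel) \<le> ennreal Jb"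
    and lbH: "(\<integral>\<^sup>+z. (if lb (fst z) < ennreal (b z) then ennreal (b z) else 0) * ennreal_powr (ennreal (H z)) d \<partial>lborel) \<le> ennreal (\<delta> powr d * Jb)"
    unfolding Jb_def
    by (rule nn_integral_level_split_le[OF _ _ d pq \<delta> Nb NH' NH(2)]) auto
  define b1 where "b1 z = (if lb (fst z) < ennreal (b z) then ennreal (b z) else 0)" for z
  have [measurable]: "b1 \<in> borel_measurable borel" unfolding b1_def by measurable
  have b1: "ennreal (b z) \<le> lb (fst z) + b1 z" for z
    by (auto simp: b1_def not_less)
  have Hd: "ennreal (H z ^ CARD('d)) = ennreal_powr (ennreal (H z)) d" for z
    unfolding d_def using H0 by (intro ennreal_power_eq_powr) auto
  define \<omega> where "\<omega> = measure lborel (ball (0 :: real ^ 'd) \<delta>)"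
  have \<omega>: "emeasure lborel (ball (0 :: real ^ 'd) \<delta>) = ennreal \<omega>" "0 \<le> \<omega>"
    using emeasure_eq_ennreal_measure[of lborel "ball (0 :: real ^ 'd) \<delta>"] emeasure_bounded_finite[OF bounded_ball, of "0 :: real ^ 'd" \<delta>]
    by (auto simp: \<omega>_def)
  define c :: real where "c = fact (CARD('d) + 1)"
  have c: "0 < c" by (simp add: c_def)
  define E where "E = (2 * U + 2) powr (1 - p / q) * ((2 * Nh) powr (p / q) * NH powr d)"
  have E: "0 \<le> E" by (simp add: E_def)
  have "ennreal g * ennreal \<omega> \<le> ennreal c * ennreal (2 * (\<delta> powr d * J + s) + E)"
  proof (cases "p > q")
    case True
    have Nh': "mixed_lp q p (\<lambda>z. ennreal (h z)) \<le> ennreal Nh"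
      using Nh(1) True by (simp add: ordered_mixed_lp_def)
    \<comment> \<open>For \<open>h\<close> the pair (q, p) takes the place of (q0, p0). The split
      requires the first of these to be at most the second, which is the case
      \<open>p > q\<close>.\<close>
    obtain lh where lh[measurable]: "lh \<in> borel_measurable borel" and lhJ: "(\<integral>\<^sup>+t. lh t \<partial>lborel) \<le> ennreal Jh"
      and lhH: "(\<integral>\<^sup>+z. (if lh (fst z) < ennreal (h z) then ennreal (h z) else 0) * ennreal_powr (ennreal (H z)) d \<partial>lborel) \<le> ennreal (\<delta> powr d * Jh)"
      unfolding Jh_def
      by (rule nn_integral_level_split_le[OF _ _ d pq(1,1,3,4,4) _ \<delta> Nh' Nh(2) NH' NH(2)]) (use True in auto)
    define h1 where "h1 z = (if lh (fst z) < ennreal (h z) then ennreal (h z) else 0)" for z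
    have [measurable]: "h1 \<in> borel_measurable borel" unfolding h1_def by measurable
    have h1: "ennreal (h z) \<le> lh (fst z) + h1 z" for z
      by (auto simp: h1_def not_less)
    define l where "l t = ennreal (2 * \<delta>) * lb t + lh t" for t
    have [measurable]: "l \<in> borel_measurable borel" unfolding l_def by measurable
    have lJ: "(\<integral>\<^sup>+t. l t \<partial>lborel) \<le> ennreal J"
    proof -
      have "(\<integral>\<^sup>+t. l t \<partial>lborel) = ennreal (2 * \<delta>) * (\<integral>\<^sup>+t. lb t \<partial>lborel) + (\<integral>\<^sup>+t. lh t \<partial>lborel)"
        unfolding l_def by (simp add: nn_integral_add nn_integral_cmult)
      also have "\<dots> \<le> ennreal (2 * \<delta>) * ennreal Jb + ennreal Jh"
        using lbJ lhJ by (intro add_mono mult_left_mono) auto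
      also have "\<dots> = ennreal J" using J' \<delta> by (simp add: ennreal_mult)
      finally show ?thesis .
    qed
    note rep = enn2real_representative[OF \<open>l \<in> borel_measurable borel\<close> lJ]
    define X where "X z = ennreal (2 * \<delta>) * b1 z + h1 z" for z
    have Xm[measurable]: "X \<in> borel_measurable borel" unfolding X_def by measurable
    have bd: "AE z in lborel. z \<in> {T1..T2} \<times> W \<longrightarrow> norm (G z) \<le> \<delta> \<longrightarrow> ennreal (- a z) \<le> ennreal (enn2real (l (fst z))) + X z"
      using bound AE_lborel_fst[OF rep(3), where 'b = "real ^ 'd"]
    proof eventually_elim
      case (elim z)
      show ?case
      proof (intro impI)
        assume "z \<in> {T1..T2} \<times> W" "norm (G z) \<le> \<delta>"
        then have "ennreal (- a z) \<le> ennreal (2 * \<delta> * b z + h z)" using elim by (intro ennreal_leI) auto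
        also have "\<dots> = ennreal (2 * \<delta>) * ennreal (b z) + ennreal (h z)" using b h \<delta> by (simp add: ennreal_mult)
        also have "\<dots> \<le> ennreal (2 * \<delta>) * (lb (fst z) + b1 z) + (lh (fst z) + h1 z)"
          by (intro add_mono mult_left_mono b1 h1) auto
        also have "\<dots> = l (fst z) + X z" by (simp add: l_def X_def algebra_simps)
        finally show "ennreal (- a z) \<le> ennreal (enn2real (l (fst z))) + X z" using elim by simp
      qed
    qed
    obtain A D where AD: "A \<in> borel_measurable borel" "D \<in> borel_measurable borel"
      "AE z in lborel. A z \<le> X z + D z" "(\<integral>\<^sup>+z. D z * ennreal (H z ^ CARD('d)) \<partial>lborel) \<le> ennreal s"
      "ennreal g * emeasure lborel (ball (0 :: real ^ 'd) \<delta>) \<le> ennreal (fact (CARD('d) + 1)) * (\<integral>\<^sup>+z. A z * ennreal (H z ^ CARD('d)) \<partial>lborel)"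
      by (rule contact_core[OF W T dv dG G' cont H0 start top side U(1) R \<delta> rep(1) enn2real_nonneg rep(2) J0 gap Xm bd s]; (assumption | (rule that; assumption)))
    note [measurable] = AD(1,2)
    have "(\<integral>\<^sup>+z. A z * ennreal (H z ^ CARD('d)) \<partial>lborel) \<le> (\<integral>\<^sup>+z. (X z + D z) * ennreal (H z ^ CARD('d)) \<partial>lborel)"
      using AD(3) by (intro nn_integral_mono_AE) (auto elim!: eventually_mono intro: mult_right_mono)
    also have "\<dots> = ennreal (2 * \<delta>) * (\<integral>\<^sup>+z. b1 z * ennreal_powr (ennreal (H z)) d \<partial>lborel) +
        (\<integral>\<^sup>+z. h1 z * ennreal_powr (ennreal (H z)) d \<partial>lborel) + (\<integral>\<^sup>+z. D z * ennreal (H z ^ CARD('d)) \<partial>lborel)"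
      by (simp add: X_def Hd distrib_right nn_integral_add nn_integral_cmult mult.assoc)
    also have "\<dots> \<le> ennreal (2 * \<delta>) * ennreal (\<delta> powr d * Jb) + ennreal (\<delta> powr d * Jh) + ennreal s"
      using lbH lhH AD(4) unfolding b1_def h1_def by (intro add_mono mult_left_mono) auto
    also have "\<dots> = ennreal (\<delta> powr d * J + s)"
      using J' \<delta> s by (simp add: algebra_simps flip: ennreal_mult ennreal_plus)
    also have "\<dots> \<le> ennreal (2 * (\<delta> powr d * J + s) + E)"
      using J0 s E by (intro ennreal_leI) auto
    finally have "(\<integral>\<^sup>+z. A z * ennreal (H z ^ CARD('d)) \<partial>lborel) \<le> ennreal (2 * (\<delta> powr d * J + s) + E)" .
    then have "ennreal c * (\<integral>\<^sup>+z. A z * ennreal (H z ^ CARD('d)) \<partial>lborel) \<le> ennreal c * ennreal (2 * (\<delta> powr d * J + s) + E)"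
      by (rule mult_left_mono) simp
    then show ?thesis using AD(5) unfolding \<omega> c_def[symmetric] by (rule order_trans[rotated])
  next
    case False
    define l where "l t = ennreal (2 * \<delta>) * lb t" for t
    have [measurable]: "l \<in> borel_measurable borel" unfolding l_def by measurable
    have lJ: "(\<integral>\<^sup>+t. l t \<partial>lborel) \<le> ennreal J"
    proof -
      have "(\<integral>\<^sup>+t. l t \<partial>lborel) = ennreal (2 * \<delta>) * (\<integral>\<^sup>+t. lb t \<partial>lborel)"
        unfolding l_def by (simp add: nn_integral_cmult)
      also have "\<dots> \<le> ennreal (2 * \<delta>) * ennreal Jb"
        using lbJ by (intro mult_left_mono) auto
      also have "\<dots> \<le> ennreal J" using J' \<delta> by (simp add: ennreal_leI flip: ennreal_mult)
      finally show ?thesis .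
    qed
    note rep = enn2real_representative[OF \<open>l \<in> borel_measurable borel\<close> lJ]
    define X where "X z = ennreal (2 * \<delta>) * b1 z + ennreal (h z)" for z
    have Xm[measurable]: "X \<in> borel_measurable borel" unfolding X_def by measurable
    have bd: "AE z in lborel. z \<in> {T1..T2} \<times> W \<longrightarrow> norm (G z) \<le> \<delta> \<longrightarrow> ennreal (- a z) \<le> ennreal (enn2real (l (fst z))) + X z"
      using bound AE_lborel_fst[OF rep(3), where 'b = "real ^ 'd"]
    proof eventually_elim
      case (elim z)
      show ?case
      proof (intro impI)
        assume "z \<in> {T1..T2} \<times> W" "norm (G z) \<le> \<delta>"
        then have "ennreal (- a z) \<le> ennreal (2 * \<delta> * b z + h z)" using elim by (intro ennreal_leI) auto
        also have "\<dots> = ennreal (2 * \<delta>) * ennreal (b z) + ennreal (h z)" using b h \<delta> by (simp add: ennreal_mult)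
        also have "\<dots> \<le> ennreal (2 * \<delta>) * (lb (fst z) + b1 z) + ennreal (h z)"
          by (intro add_mono mult_left_mono b1) auto
        also have "\<dots> = l (fst z) + X z" by (simp add: l_def X_def algebra_simps)
        finally show "ennreal (- a z) \<le> ennreal (enn2real (l (fst z))) + X z" using elim by simp
      qed
    qed
    obtain A D where AD: "A \<in> borel_measurable borel" "D \<in> borel_measurable borel"
      "AE z in lborel. A z \<le> X z + D z" "(\<integral>\<^sup>+z. D z * ennreal (H z ^ CARD('d)) \<partial>lborel) \<le> ennreal s"
      "\<And>x. (\<integral>\<^sup>+t. A (t, x) \<partial>lborel) \<le> ennreal (2 * U + J + 1)"
      "ennreal g * emeasure lborel (ball (0 :: real ^ 'd) \<delta>) \<le> ennreal (fact (CARD('d) + 1)) * (\<integral>\<^sup>+z. A z * ennreal (H z ^ CARD('d)) \<partial>lborel)"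
      by (rule contact_core[OF W T dv dG G' cont H0 start top side U(1) R \<delta> rep(1) enn2real_nonneg rep(2) J0 gap Xm bd s]; (assumption | (rule that; assumption)))
    note [measurable] = AD(1,2)
    \<comment> \<open>Where A > 2 h, the bound A \<le> Y + h gives A \<le> 2 Y. The remaining part
      \<open>A'\<close> is dominated by 2 h and inherits the column bound of \<open>A\<close>;
      interpolation needs both at once.\<close>
    define A' where "A' z = (if A z \<le> ennreal (2 * h z) then A z else 0)" for z
    have A'm[measurable]: "A' \<in> borel_measurable borel" unfolding A'_def by measurable
    define Y where "Y z = ennreal (2 * \<delta>) * b1 z + D z" for z
    have [measurable]: "Y \<in> borel_measurable borel" unfolding Y_def by measurable
    have split: "AE z in lborel. A z \<le> 2 * Y z + A' z"
      using AD(3)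
    proof eventually_elim
      case (elim z)
      then have le: "A z \<le> Y z + ennreal (h z)" by (simp add: X_def Y_def ac_simps)
      show ?case
      proof (cases "A z \<le> ennreal (2 * h z)")
        case False
        have "A z \<le> 2 * Y z"
        proof (cases "Y z")
          case (real y)
          then have "A z \<le> ennreal (y + h z)" using le h by simp
          then obtain \<alpha> where \<alpha>: "A z = ennreal \<alpha>" "0 \<le> \<alpha>" by (cases "A z") (auto simp: top_unique)
          have "ennreal \<alpha> \<le> ennreal (y + h z)" using \<open>A z \<le> ennreal (y + h z)\<close> \<alpha> by simp
          moreover have "0 \<le> y + h z" using real h(2)[of z] by simp
          ultimately have "\<alpha> \<le> y + h z" by (subst (asm) ennreal_le_iff)
          moreover have "2 * h z < \<alpha>"
            using False \<alpha> h(2)[of z] by (auto simp: ennreal_le_iff not_le)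
          ultimately have "\<alpha> \<le> y + h z" "2 * h z < \<alpha>" by auto
          then have "\<alpha> \<le> 2 * y" by simp
          then have "ennreal \<alpha> \<le> ennreal (2 * y)" by (rule ennreal_leI)
          then show ?thesis using \<alpha> real by (simp add: ennreal_mult)
        qed (simp add: ennreal_mult_top)
        then show ?thesis by (simp add: add_increasing2)
      qed (simp add: A'_def)
    qed
    have A'bound: "(\<integral>\<^sup>+z. A' z * ennreal (H z ^ CARD('d)) \<partial>lborel) \<le> ennreal E"
    proof -
      have "(\<integral>\<^sup>+z. A' z * ennreal (H z ^ CARD('d)) \<partial>lborel) = (\<integral>\<^sup>+z. A' (snd z, fst z) * ennreal_powr (ennreal (H (snd z, fst z))) d \<partial>lborel)"
        by (subst nn_integral_swap[symmetric]) (auto simp: Hd)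
      also have "\<dots> \<le> ennreal_powr (ennreal (2 * U + 2)) (1 - p / q) *
         (ennreal_powr (mixed_lp p q (\<lambda>z. ennreal (2 * h (snd z, fst z)))) (p / q) * ennreal_powr (mixed_lp p q (\<lambda>z. ennreal (H (snd z, fst z)))) d)"
      proof (rule nn_integral_column_bound)
        show "(\<integral>\<^sup>+t. A' (snd (x, t), fst (x, t)) \<partial>lborel) \<le> ennreal (2 * U + 2)" for x
        proof -
          have "(\<integral>\<^sup>+t. A' (t, x) \<partial>lborel) \<le> (\<integral>\<^sup>+t. A (t, x) \<partial>lborel)"
            by (intro nn_integral_mono) (simp add: A'_def)
          also have "\<dots> \<le> ennreal (2 * U + J + 1)" by (rule AD(5))
          also have "\<dots> \<le> ennreal (2 * U + 2)" using J(2) by (intro ennreal_leI) simp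
          finally show ?thesis by simp
        qed
        show "A' (snd z, fst z) \<le> ennreal (2 * h (snd z, fst z))" for z
          by (simp add: A'_def)
      qed (use d p pq False in auto)
      also have "\<dots> \<le> ennreal_powr (ennreal (2 * U + 2)) (1 - p / q) *
         (ennreal_powr (ennreal (2 * Nh)) (p / q) * ennreal_powr (ennreal NH) d)"
      proof (intro mult_left_mono mult_mono ennreal_powr_mono)
        have "mixed_lp p q (\<lambda>z. ennreal (2 * h (snd z, fst z))) = mixed_lp p q (\<lambda>z. ennreal 2 * ennreal (h (snd z, fst z)))"
          using h by (simp add: ennreal_mult)
        also have "\<dots> = ennreal 2 * mixed_lp p q (\<lambda>z. ennreal (h (snd z, fst z)))"
          using p pq by (intro mixed_lp_cmult) auto
        also have "\<dots> \<le> ennreal 2 * ennreal Nh"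
          using Nh(1) False by (intro mult_left_mono) (auto simp: ordered_mixed_lp_def)
        finally show "mixed_lp p q (\<lambda>z. ennreal (2 * h (snd z, fst z))) \<le> ennreal (2 * Nh)"
          using Nh by (simp add: ennreal_mult)
        show "mixed_lp p q (\<lambda>z. ennreal (H (snd z, fst z))) \<le> ennreal NH"
          using NH(1) False by (simp add: ordered_mixed_lp_def)
      qed (use p pq d in auto)
      also have "\<dots> = ennreal E"
      proof -
        have gen: "ennreal_powr (ennreal x) r * (ennreal_powr (ennreal y) r' * ennreal_powr (ennreal w) d) =
          ennreal (x powr r * (y powr r' * w powr d))" if "0 \<le> x" "0 \<le> y" "0 \<le> w" for x y w r r' :: real
          using that by (simp add: ennreal_powr_ennreal ennreal_mult)
        show ?thesis
          unfolding E_def using U(2) Nh(2) NH(2) by (intro gen) auto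
      qed
      finally show ?thesis .
    qed
    have "(\<integral>\<^sup>+z. A z * ennreal (H z ^ CARD('d)) \<partial>lborel) \<le> (\<integral>\<^sup>+z. (2 * Y z + A' z) * ennreal (H z ^ CARD('d)) \<partial>lborel)"
      using split by (intro nn_integral_mono_AE) (auto elim!: eventually_mono intro: mult_right_mono)
    also have "\<dots> = 2 * (ennreal (2 * \<delta>) * (\<integral>\<^sup>+z. b1 z * ennreal_powr (ennreal (H z)) d \<partial>lborel) +
        (\<integral>\<^sup>+z. D z * ennreal (H z ^ CARD('d)) \<partial>lborel)) + (\<integral>\<^sup>+z. A' z * ennreal (H z ^ CARD('d)) \<partial>lborel)"
      by (simp add: Y_def Hd distrib_right distrib_left nn_integral_add nn_integral_cmult mult.assoc)
    also have "\<dots> \<le> 2 * (ennreal (2 * \<delta>) * ennreal (\<delta> powr d * Jb) + ennreal s) + ennreal E"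
      using lbH AD(4) A'bound unfolding b1_def by (intro add_mono mult_left_mono) auto
    also have "\<dots> = ennreal (2 * (2 * \<delta> * (\<delta> powr d * Jb) + s) + E)"
    proof -
      have gen: "2 * (ennreal x + ennreal y) + ennreal w = ennreal (2 * (x + y) + w)" if "0 \<le> x" "0 \<le> y" "0 \<le> w" for x y w :: real
        using that by (simp add: ennreal_mult)
      have "ennreal (2 * \<delta>) * ennreal (\<delta> powr d * Jb) = ennreal (2 * \<delta> * (\<delta> powr d * Jb))"
        using J' \<delta> by (intro ennreal_mult[symmetric]) auto
      then show ?thesis
        using J' \<delta> s E by (simp only:) (intro gen, auto)
    qed
    also have "\<dots> \<le> ennreal (2 * (\<delta> powr d * J + s) + E)"
      using J' by (intro ennreal_leI) (simp add: algebra_simps)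
    finally have "(\<integral>\<^sup>+z. A z * ennreal (H z ^ CARD('d)) \<partial>lborel) \<le> ennreal (2 * (\<delta> powr d * J + s) + E)" .
    then have "ennreal c * (\<integral>\<^sup>+z. A z * ennreal (H z ^ CARD('d)) \<partial>lborel) \<le> ennreal c * ennreal (2 * (\<delta> powr d * J + s) + E)"
      by (rule mult_left_mono) simp
    then show ?thesis using AD(6) unfolding \<omega> c_def[symmetric] by (rule order_trans[rotated])
  qed
  then have "ennreal (g * \<omega>) \<le> ennreal (c * (2 * (\<delta> powr d * J + s) + E))"
    using c gap \<omega> J0 s E by (simp add: ennreal_mult)
  then have "g * \<omega> \<le> c * (2 * (\<delta> powr d * J + s) + E)"
    using c J0 s E by (subst (asm) ennreal_le_iff) auto
  then show ?thesis by (simp add: \<omega>_def c_def E_def)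
qed

section \<open>Constants, representatives and exponents for the theorem\<close>

lemma small_powr:
  fixes A B K \<alpha> :: real
  assumes "0 < A" "0 < B" "0 \<le> K" "0 < \<alpha>"
  shows "\<exists>\<delta>>0. \<delta> \<le> A \<and> K * \<delta> powr \<alpha> < B"
proof -
  define \<delta> where "\<delta> = min A ((B / (K + 1)) powr (1 / \<alpha>))"
  have pos: "0 < \<delta>" using assms by (simp add: \<delta>_def)
  have "\<delta> powr \<alpha> \<le> ((B / (K + 1)) powr (1 / \<alpha>)) powr \<alpha>"
    using pos assms by (intro powr_mono2) (auto simp: \<delta>_def)
  also have "\<dots> = B / (K + 1)" using assms by (simp add: powr_powr)
  finally have "K * \<delta> powr \<alpha> \<le> K * (B / (K + 1))" using assms by (intro mult_left_mono) auto
  also have "\<dots> < B" using assms by (simp add: field_simps)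
  finally show ?thesis using pos by (intro exI[of _ \<delta>]) (auto simp: \<delta>_def)
qed

lemma linear_time_space:
  fixes D :: "real \<times> (real ^ 'd) \<Rightarrow> real"
  assumes "linear D"
  shows "D h = D (1, 0) * fst h + (\<chi> i. D (0, axis i 1)) \<bullet> snd h"
proof -
  have "h = fst h *\<^sub>R (1, 0) + (\<Sum>i\<in>UNIV. snd h $ i *\<^sub>R (0, axis i 1))"
  proof (rule prod_eqI)
    have "snd h = (\<Sum>i\<in>UNIV. snd h $ i *\<^sub>R axis i 1)"
      using basis_expansion[of "snd h"] by (simp add: scalar_mult_eq_scaleR)
    then show "snd h = snd (fst h *\<^sub>R (1, 0) + (\<Sum>i\<in>UNIV. snd h $ i *\<^sub>R (0 :: real, axis i 1)))"
      by (simp add: snd_sum)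
  qed (simp add: fst_sum)
  then have "D h = D (fst h *\<^sub>R (1, 0) + (\<Sum>i\<in>UNIV. snd h $ i *\<^sub>R (0, axis i 1)))" by simp
  also have "\<dots> = fst h * D (1, 0) + (\<Sum>i\<in>UNIV. snd h $ i * D (0, axis i 1))"
    by (simp only: linear_add[OF assms] linear_cmul[OF assms] linear_sum[OF assms] real_scaleR_def)
  finally show ?thesis by (simp add: inner_vec_def mult.commute)
qed

lemma has_derivative_vec_lambda:
  fixes f :: "'a::euclidean_space \<Rightarrow> 'd::finite \<Rightarrow> real"
  assumes "\<And>i. ((\<lambda>z. f z i) has_derivative (\<lambda>h. f' h i)) (at z)"
  shows "((\<lambda>z. \<chi> i. f z i) has_derivative (\<lambda>h. \<chi> i. f' h i)) (at z)"
  using assms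
  by (subst has_derivative_componentwise_within) (auto simp: Basis_vec_def inner_axis)

lemma borel_version:
  fixes f :: "'a::euclidean_space \<Rightarrow> real"
  assumes "set_borel_measurable lebesgue Q f" and Q: "open Q"
  obtains g where "g \<in> borel_measurable borel" "\<And>z. z \<notin> Q \<Longrightarrow> g z = 0" "AE z in lborel. z \<in> Q \<longrightarrow> g z = f z"
proof -
  have "\<exists>g'\<in>borel_measurable lborel. AE z in lborel. indicator Q z *\<^sub>R f z = g' z"
    using assms(1) unfolding set_borel_measurable_def by (rule completion_ex_borel_measurable_real)
  then obtain g' where g': "g' \<in> borel_measurable borel" "AE z in lborel. indicator Q z *\<^sub>R f z = g' z"
    by auto
  have [measurable]: "Q \<in> sets borel" using Q by simp
  note [measurable] = g'(1)
  show ?thesis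
  proof (rule that[of "\<lambda>z. indicator Q z * g' z"])
    show "AE z in lborel. z \<in> Q \<longrightarrow> indicator Q z * g' z = f z"
      using g'(2) by eventually_elim auto
  qed auto
qed

text \<open>Stated for a real \<open>f\<close> dominated by the norm of \<open>F\<close>, so that it
  covers the components as well as the norms of vector- and matrix-valued functions. Integrability
  follows because Q is bounded and both exponents exceed 1.\<close>

lemma borel_version_mixed_L:
  fixes F :: "real \<times> 'a::euclidean_space \<Rightarrow> 'b::real_normed_vector" and f :: "real \<times> 'a \<Rightarrow> real"
  assumes F: "F \<in> mixed_L q p Q" and f: "set_borel_measurable lebesgue Q f" "\<And>z. \<bar>f z\<bar> \<le> norm (F z)"
    and Q: "open Q" "bounded Q" and pq: "1 < q" "1 < p"
  shows "\<exists>g. g \<in> borel_measurable borel \<and> (\<forall>z. z \<notin> Q \<longrightarrow> g z = 0) \<and> (AE z in lborel. z \<in> Q \<longrightarrow> g z = f z) \<and>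
    ordered_mixed_lp q p (\<lambda>z. ennreal \<bar>g z\<bar>) < \<infinity> \<and> integrable lborel g"
proof -
  obtain g where g[measurable]: "g \<in> borel_measurable borel" and g0: "\<And>z. z \<notin> Q \<Longrightarrow> g z = 0"
    and gf: "AE z in lborel. z \<in> Q \<longrightarrow> g z = f z"
    using borel_version[OF f(1) Q(1)] by blast
  have "ordered_mixed_lp q p (\<lambda>z. ennreal \<bar>g z\<bar>) \<le> ordered_mixed_lp q p (\<lambda>z. ennreal (norm (indicator Q z *\<^sub>R F z)))"
  proof (rule ordered_mixed_lp_mono_AE)
    show "AE z in lborel. ennreal \<bar>g z\<bar> \<le> ennreal (norm (indicator Q z *\<^sub>R F z))"
      using gf
    proof eventually_elim
      case (elim z)
      then show ?case
        using f(2)[of z] g0[of z] by (cases "z \<in> Q") (auto intro: ennreal_leI)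
    qed
  qed (use pq in auto)
  also have "\<dots> = mixed_norm q p (\<lambda>z. indicator Q z *\<^sub>R F z)"
    using pq by (intro mixed_norm_eq_ordered_mixed_lp[symmetric]) auto
  also have "\<dots> < \<infinity>" using F by (simp add: mixed_L_def)
  finally have fin: "ordered_mixed_lp q p (\<lambda>z. ennreal \<bar>g z\<bar>) < \<infinity>" .
  then have "(\<integral>\<^sup>+z. ennreal \<bar>g z\<bar> \<partial>lborel) < \<infinity>"
    using pq Q g0 by (intro nn_integral_finite_of_ordered_mixed_lp[where B = Q]) auto
  then have "integrable lborel g" by (simp add: integrable_iff_bounded)
  then show ?thesis using g g0 gf fin by (intro exI[of _ g] conjI allI impI)
qed

lemma integrable_mollify:
  fixes f :: "'a::euclidean_space \<times> 'b::euclidean_space \<Rightarrow> real"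
  assumes r: "0 < r" and f: "integrable lborel f"
  shows "integrable lborel (mollify r f)"
proof -
  have m[measurable]: "mollify r f \<in> borel_measurable borel"
    using continuous_on_mollify[OF r f] by (rule borel_measurable_continuous_onI)
  have [measurable]: "f \<in> borel_measurable borel" using f by simp
  have "mixed_lp 1 1 (\<lambda>z. ennreal \<bar>mollify r f z\<bar>) \<le> mixed_lp 1 1 (\<lambda>z. ennreal \<bar>f z\<bar>)"
    by (rule mixed_lp_mollify_le[OF r f]) auto
  then have "(\<integral>\<^sup>+z. ennreal \<bar>mollify r f z\<bar> \<partial>lborel) \<le> (\<integral>\<^sup>+z. ennreal \<bar>f z\<bar> \<partial>lborel)"
    by (simp add: mixed_lp_one)
  also have "\<dots> < \<infinity>" using f by (simp add: integrable_iff_bounded)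
  finally show ?thesis by (simp add: integrable_iff_bounded)
qed

text \<open>Convergence in L1 of the sum of all component errors gives one subsequence for all
  components. Pointwise convergence is needed to compare the gradient with its mollification at the
  points where the latter is small.\<close>

lemma mollify_AE_subseq:
  fixes f :: "'d::finite \<Rightarrow> 'a::euclidean_space \<times> 'b::euclidean_space \<Rightarrow> real"
  assumes f: "\<And>i. integrable lborel (f i)" and r: "\<And>n. 0 < r n" "r \<longlonglongrightarrow> 0"
  obtains \<sigma> :: "nat \<Rightarrow> nat" where "strict_mono \<sigma>"
    "AE z in lborel. (\<lambda>n. norm ((\<chi> i. mollify (r (\<sigma> n)) (f i) z) - (\<chi> i. f i z))) \<longlonglongrightarrow> 0"
proof -
  define S where "S n z = (\<Sum>i\<in>UNIV. \<bar>mollify (r n) (f i) z - f i z\<bar>)" for n z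
  have Si: "integrable lborel (S n)" for n
    unfolding S_def using f integrable_mollify[OF r(1) f] by simp
  have lim1: "(\<lambda>n. \<integral>z. \<bar>mollify (r n) (f i) z - f i z\<bar> \<partial>lborel) \<longlonglongrightarrow> 0" for i
  proof -
    have "ennreal (\<integral>z. \<bar>mollify (r n) (f i) z - f i z\<bar> \<partial>lborel) = (\<integral>\<^sup>+z. ennreal \<bar>mollify (r n) (f i) z - f i z\<bar> \<partial>lborel)" for n
      using f[of i] integrable_mollify[OF r(1) f[of i]] by (intro nn_integral_eq_integral[symmetric]) auto
    then have "(\<lambda>n. ennreal (\<integral>z. \<bar>mollify (r n) (f i) z - f i z\<bar> \<partial>lborel)) \<longlonglongrightarrow> ennreal 0"
      using mollify_tendsto_L1[OF f[of i] r] by simp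
    then show ?thesis
      by (subst (asm) tendsto_ennreal_iff) auto
  qed
  have "(\<lambda>n. \<integral>z. S n z \<partial>lborel) \<longlonglongrightarrow> (\<Sum>i\<in>(UNIV :: 'd set). 0)"
  proof -
    have eq: "(\<integral>z. S n z \<partial>lborel) = (\<Sum>i\<in>UNIV. \<integral>z. \<bar>mollify (r n) (f i) z - f i z\<bar> \<partial>lborel)" for n
      unfolding S_def using f integrable_mollify[OF r(1) f] by (intro Bochner_Integration.integral_sum) auto
    show ?thesis unfolding eq by (intro tendsto_sum lim1)
  qed
  then have "(\<lambda>n. \<integral>z. norm (S n z) \<partial>lborel) \<longlonglongrightarrow> 0"
    by (simp add: S_def sum_nonneg)
  then obtain \<sigma> :: "nat \<Rightarrow> nat" where \<sigma>: "strict_mono \<sigma>" "AE z in lborel. (\<lambda>n. S (\<sigma> n) z) \<longlonglongrightarrow> 0"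
    using tendsto_L1_AE_subseq[of lborel S, OF Si] by blast
  have "AE z in lborel. (\<lambda>n. norm ((\<chi> i. mollify (r (\<sigma> n)) (f i) z) - (\<chi> i. f i z))) \<longlonglongrightarrow> 0"
    using \<sigma>(2)
  proof eventually_elim
    case (elim z)
    have "norm ((\<chi> i. mollify (r (\<sigma> n)) (f i) z) - (\<chi> i. f i z)) \<le> S (\<sigma> n) z" for n
      using norm_le_l1_cart[of "(\<chi> i. mollify (r (\<sigma> n)) (f i) z) - (\<chi> i. f i z)"] by (simp add: S_def)
    then show ?case
      using elim by (intro Lim_null_comparison[OF always_eventually elim]) auto
  qed
  then show ?thesis using \<sigma>(1) by (rule that[rotated])
qed

text \<open>Extended by zero, \<open>u\<close> may jump at the boundary of Q. For small radii,
  however, the averages at points of \<open>C\<close> only see a compact neighbourhood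
  \<open>N\<close> of \<open>C\<close> inside Q, where \<open>u\<close> is uniformly
  continuous.\<close>

lemma mollify_uniformly_close:
  fixes u :: "'a::euclidean_space \<Rightarrow> real"
  assumes Q: "open Q" and u: "continuous_on Q u" and int: "integrable lborel (\<lambda>z. indicator Q z * u z)"
    and C: "compact C" "C \<subseteq> Q" and e: "0 < e"
  shows "\<exists>\<rho>>0. \<forall>r z. 0 < r \<longrightarrow> r < \<rho> \<longrightarrow> z \<in> C \<longrightarrow> \<bar>mollify r (\<lambda>z. indicator Q z * u z) z - u z\<bar> \<le> e"
proof -
  obtain \<epsilon> where \<epsilon>: "0 < \<epsilon>" "(\<Union>z\<in>C. cball z \<epsilon>) \<subseteq> Q"
    using compact_subset_open_imp_cball_epsilon_subset[OF C(1) Q C(2)] by metis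
  define N where "N = {x + y |x y. x \<in> C \<and> y \<in> cball 0 \<epsilon>}"
  have N: "compact N" unfolding N_def using C(1) compact_cball by (rule compact_sums)
  have NQ: "N \<subseteq> Q"
  proof
    fix w assume "w \<in> N"
    then obtain x y where "w = x + y" "x \<in> C" "norm y \<le> \<epsilon>" by (auto simp: N_def)
    then have "w \<in> cball x \<epsilon>" by (simp add: dist_norm)
    then show "w \<in> Q" using \<epsilon> \<open>x \<in> C\<close> by blast
  qed
  have inN: "w \<in> N" if "z \<in> C" "norm (z - w) \<le> \<epsilon>" for z w
    unfolding N_def using that
    by (intro CollectI exI[of _ z] exI[of _ "w - z"]) (auto simp: norm_minus_commute)
  have "uniformly_continuous_on N u"
    using continuous_on_subset[OF u NQ] N by (rule compact_uniformly_continuous)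
  then obtain d where d: "0 < d" "\<And>x x'. x \<in> N \<Longrightarrow> x' \<in> N \<Longrightarrow> dist x' x < d \<Longrightarrow> \<bar>u x' - u x\<bar> < e"
    using e unfolding uniformly_continuous_on_def dist_real_def by metis
  show ?thesis
  proof (intro exI[of _ "min \<epsilon> d"] conjI allI impI)
    show "0 < min \<epsilon> d" using \<epsilon> d by simp
    fix r z assume r: "0 < r" "r < min \<epsilon> d" and z: "z \<in> C"
    show "\<bar>mollify r (\<lambda>z. indicator Q z * u z) z - u z\<bar> \<le> e"
    proof (rule mollify_close[OF r(1) int])
      fix w assume w: "norm (z - w) \<le> r"
      have "z \<in> N" "w \<in> N" using inN[OF z] w r \<epsilon> by auto
      moreover have "dist w z < d" using w r by (simp add: dist_norm norm_minus_commute)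
      ultimately show "\<bar>indicator Q w * u w - u z\<bar> \<le> e" using d(2)[of z w] NQ by auto
    qed
  qed
qed

text \<open>The hypothesis p > q0 d reads d / p < 1 / q0; subtracting both sides from 1 gives d / p0
  < 1 / q, the last relation. With d > 1 it also yields \<open>q \<le> p0\<close>, which the split
  at a level needs.\<close>

lemma exponent_relations:
  fixes p q p0 q0 d :: real
  assumes "1 < d" "1 \<le> p0" "1 \<le> q0" "1 \<le> p" "1 \<le> q" and r: "d / p0 + 1 / q0 = 1" "d / p + 1 / q = 1" "q0 * d < p"
  shows "1 < q" "1 < q0" "1 < p / d" "q \<le> p0" "1 < p" "1 < p0" "q * d / p0 < 1"
proof -
  have "0 < d / p0" using assms by simp
  then have "1 / q0 < 1" using r by linarith
  then show q0: "1 < q0" using assms by simp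
  have "d < q0 * d" using q0 assms by simp
  then have "d < p" using r by linarith
  then show pd: "1 < p / d" using assms by simp
  show "1 < p" using \<open>d < p\<close> assms by simp
  have "0 < d / p" using assms by simp
  then have "1 / q < 1" using r by linarith
  then show q: "1 < q" using assms by simp
  have "d / p < 1 / q0" using r assms by (simp add: field_simps)
  then have "d / p0 < 1 / q" using r by linarith
  then show lt: "q * d / p0 < 1" using q by (simp add: field_simps)
  have "0 < 1 / q0" using q0 by simp
  then have "d / p0 < 1" using r by linarith
  then show "1 < p0" using assms by (simp add: field_simps)
  have "q * d < p0" using lt \<open>1 < p0\<close> by (simp add: field_simps)
  moreover have "q * 1 \<le> q * d" using q assms by (intro mult_left_mono) auto
  ultimately show "q \<le> p0" by simp
qed

theorem theorem1p4p1:
  fixes Q :: "(real \<times> (real ^ 'd)) set"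
    and u ut :: "real \<times> (real ^ 'd) \<Rightarrow> real"
    and Du b :: "real \<times> (real ^ 'd) \<Rightarrow> real ^ 'd"
    and p0 q0 p q :: real
  assumes "CARD('d) \<ge> 2"
    and "p0 \<ge> 1" and "q0 \<ge> 1" and "p \<ge> 1" and "q \<ge> 1"
    and "real CARD('d) / p0 + 1 / q0 = 1"
    and "real CARD('d) / p + 1 / q = 1"
    and "p > q0 * real CARD('d)"
    and "bounded Q" and "open Q" and "connected Q" and "Q \<noteq> {}"
    and "u \<in> W12 q p Q" and "continuous_on (closure Q) u"
    and "weak_dt Q u ut" and "weak_gradient Q u Du"
    and "\<forall>z\<in>parabolic_boundary Q. u z \<le> 0"
    and "b \<in> mixed_L q0 p0 Q"
    and "AE z in lebesgue_on Q. ut z + (\<Sum>i\<in>UNIV. b z $ i * Du z $ i) \<ge> 0"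
  shows "\<forall>z\<in>Q. u z \<le> 0"
proof (rule ccontr)
  assume "\<not> (\<forall>z\<in>Q. u z \<le> 0)"
  then obtain z1 where z1: "z1 \<in> Q" "0 < u z1" by (auto simp: not_le)
  define d where "d = real CARD('d)"
  note Qb = \<open>bounded Q\<close> and Qo = \<open>open Q\<close> and ucont = \<open>continuous_on (closure Q) u\<close>
  have d1: "1 < d" using assms(1) by (simp add: d_def)
  have rel: "1 < q" "1 < q0" "1 < p / d" "q \<le> p0" "1 < p" "1 < p0" "q * d / p0 < 1"
    using exponent_relations[of d p0 q0 p q] assms(2-8) d1 by (auto simp: d_def)
  have rel2: "d / p + 1 / q = 1" "d / p0 + 1 / q0 = 1" using assms(6,7) by (simp_all add: d_def)
  obtain T1 T2 W x0 m \<kappa> where T: "T1 < T2" and W: "compact W" "x0 \<in> W" and WQ: "{T1..T2} \<times> W \<subseteq> Q"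
    and start: "m \<le> u (T1, x0)" and \<kappa>: "0 < \<kappa>" and top: "\<And>x. x \<in> W \<Longrightarrow> u (T2, x) \<le> m - \<kappa>"
    and side: "\<And>t x. t \<in> {T1..T2} \<Longrightarrow> x \<in> frontier W \<Longrightarrow> u (t, x) \<le> m - \<kappa>"
    by (rule positive_cylinder[OF Qo Qb ucont assms(17) z1]) (rule that)
  let ?C = "{T1..T2} \<times> W"
  have C: "compact ?C" using W by (intro compact_Times) auto
  have Qm[measurable]: "Q \<in> sets borel" using Qo by simp

  \<comment> \<open>Borel representatives of the derivatives and of the drift\<close>
  obtain ut' Du' D2u where w: "weak_dt Q u ut'" "weak_gradient Q u Du'"
    "\<And>i. weak_gradient Q (\<lambda>z. Du' z $ i) (\<lambda>z. D2u z $ i)"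
    and wL: "ut' \<in> mixed_L q p Q" "Du' \<in> mixed_L q p Q" "D2u \<in> mixed_L q p Q"
    using assms(13) unfolding W12_def by blast
  have ut_eq: "AE z in lborel. z \<in> Q \<longrightarrow> ut z = ut' z"
    using weak_derivative_unique[OF Qo] assms(15) w(1) unfolding weak_dt_def by blast
  have Du_eq: "AE z in lborel. z \<in> Q \<longrightarrow> Du z $ i = Du' z $ i" for i
    using weak_derivative_unique[OF Qo] assms(16) w(2) unfolding weak_gradient_def by blast

  have comp: "set_borel_measurable lebesgue Q (\<lambda>z. F z $ i)"
    if "set_borel_measurable lebesgue Q F" for F :: "real \<times> (real ^ 'd) \<Rightarrow> ('x::euclidean_space) ^ 'd" and i
  proof -
    have "(\<lambda>z. (indicator Q z *\<^sub>R F z) $ i) \<in> borel_measurable lebesgue"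
      using that unfolding set_borel_measurable_def
      by (rule borel_measurable_continuous_on[OF continuous_on_component[OF continuous_on_id]])
    then show ?thesis unfolding set_borel_measurable_def by simp
  qed
  define uB where "uB z = indicator Q z * u z" for z
  have uBm[measurable]: "uB \<in> borel_measurable borel"
    using borel_measurable_continuous_on_indicator[OF Qm continuous_on_subset[OF ucont closure_subset]]
    unfolding uB_def by simp
  have normmeas: "set_borel_measurable lebesgue Q (\<lambda>z. norm (F z))"
    if "set_borel_measurable lebesgue Q F" for F :: "real \<times> (real ^ 'd) \<Rightarrow> 'x::euclidean_space"
  proof -
    have "(\<lambda>z. norm (indicator Q z *\<^sub>R F z)) \<in> borel_measurable lebesgue"
      using that unfolding set_borel_measurable_def by measurable
    then show ?thesis unfolding set_borel_measurable_def by simp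
  qed
  have meas: "set_borel_measurable lebesgue Q ut'" "set_borel_measurable lebesgue Q Du'" "set_borel_measurable lebesgue Q D2u"
    "set_borel_measurable lebesgue Q b"
    using wL assms(18) by (simp_all add: mixed_L_def)
  obtain utB where utB[measurable]: "utB \<in> borel_measurable borel" and utB': "AE z in lborel. z \<in> Q \<longrightarrow> utB z = ut' z"
    "ordered_mixed_lp q p (\<lambda>z. ennreal \<bar>utB z\<bar>) < \<infinity>" "integrable lborel utB"
    using borel_version_mixed_L[OF wL(1) meas(1) _ Qo Qb rel(1,5)] by auto
  have "\<forall>i. \<exists>g. g \<in> borel_measurable borel \<and> (\<forall>z. z \<notin> Q \<longrightarrow> g z = 0) \<and> (AE z in lborel. z \<in> Q \<longrightarrow> g z = Du' z $ i) \<and>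
    ordered_mixed_lp q p (\<lambda>z. ennreal \<bar>g z\<bar>) < \<infinity> \<and> integrable lborel g"
    by (intro allI borel_version_mixed_L[OF wL(2) comp[OF meas(2)] component_le_norm_cart Qo Qb rel(1,5)])
  from choice[OF this] obtain gB where gB_all: "\<forall>i. gB i \<in> borel_measurable borel \<and> (\<forall>z. z \<notin> Q \<longrightarrow> gB i z = 0) \<and>
    (AE z in lborel. z \<in> Q \<longrightarrow> gB i z = Du' z $ i) \<and> ordered_mixed_lp q p (\<lambda>z. ennreal \<bar>gB i z\<bar>) < \<infinity> \<and> integrable lborel (gB i)" ..
  have gB: "gB i \<in> borel_measurable borel" "AE z in lborel. z \<in> Q \<longrightarrow> gB i z = Du' z $ i" "integrable lborel (gB i)" for i
    using gB_all[rule_format, of i] by (simp_all only:)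
  have D2le: "\<bar>D2u z $ i $ j\<bar> \<le> norm (D2u z)" for z i j
    by (meson Finite_Cartesian_Product.norm_nth_le component_le_norm_cart order_trans)
  have "\<forall>k. \<exists>g. g \<in> borel_measurable borel \<and> (\<forall>z. z \<notin> Q \<longrightarrow> g z = 0) \<and> (AE z in lborel. z \<in> Q \<longrightarrow> g z = D2u z $ fst k $ snd k) \<and>
    ordered_mixed_lp q p (\<lambda>z. ennreal \<bar>g z\<bar>) < \<infinity> \<and> integrable lborel g"
    by (intro allI borel_version_mixed_L[OF wL(3) comp[OF comp[OF meas(3)]] D2le Qo Qb rel(1,5)])
  from choice[OF this] obtain hB where hB_all: "\<forall>k. hB k \<in> borel_measurable borel \<and> (\<forall>z. z \<notin> Q \<longrightarrow> hB k z = 0) \<and>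
    (AE z in lborel. z \<in> Q \<longrightarrow> hB k z = D2u z $ fst k $ snd k) \<and> ordered_mixed_lp q p (\<lambda>z. ennreal \<bar>hB k z\<bar>) < \<infinity> \<and> integrable lborel (hB k)" ..
  have hB: "hB (i, j) \<in> borel_measurable borel" "AE z in lborel. z \<in> Q \<longrightarrow> hB (i, j) z = D2u z $ i $ j"
    "integrable lborel (hB (i, j))" "z \<notin> Q \<Longrightarrow> hB (i, j) z = 0" for i j z
    using hB_all[rule_format, of "(i, j)"] by (simp_all only: fst_conv snd_conv not_False_eq_True simp_thms)
  obtain HB where HB: "HB \<in> borel_measurable borel" and HB': "AE z in lborel. z \<in> Q \<longrightarrow> HB z = norm (D2u z)"
    "ordered_mixed_lp q p (\<lambda>z. ennreal \<bar>HB z\<bar>) < \<infinity>" "integrable lborel HB" "\<And>z. z \<notin> Q \<Longrightarrow> HB z = 0"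
    using borel_version_mixed_L[OF wL(3) normmeas[OF meas(3)] _ Qo Qb rel(1,5)] by auto
  obtain bB where bB: "bB \<in> borel_measurable borel" and bB': "AE z in lborel. z \<in> Q \<longrightarrow> bB z = norm (b z)"
    "ordered_mixed_lp q0 p0 (\<lambda>z. ennreal \<bar>bB z\<bar>) < \<infinity>"
    using borel_version_mixed_L[OF assms(18) normmeas[OF meas(4)] _ Qo Qb rel(2,6)] by auto

  \<comment> \<open>Mollified data on the cylinder\<close>
  obtain U0 where U0: "\<And>z. z \<in> closure Q \<Longrightarrow> \<bar>u z\<bar> \<le> U0"
  proof -
    have "bounded (u ` closure Q)"
      using Qb ucont by (intro compact_imp_bounded compact_continuous_image) (auto simp: compact_closure)
    then obtain B where "\<forall>z\<in>closure Q. \<bar>u z\<bar> \<le> B" unfolding bounded_iff by auto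
    then show ?thesis by (intro that[of B]) blast
  qed
  have uBint: "integrable lborel uB"
  proof (rule Bochner_Integration.integrable_bound)
    have "emeasure lborel Q < \<infinity>" using emeasure_bounded_finite[OF Qb] by simp
    then show "integrable lborel (\<lambda>z. U0 * indicator Q z)" by simp
    show "AE z in lborel. norm (uB z) \<le> norm (U0 * indicator Q z)"
    proof (rule AE_I2)
      fix z show "norm (uB z) \<le> norm (U0 * indicator Q z)"
        using U0[of z] closure_subset[of Q] by (cases "z \<in> Q") (auto simp: uB_def)
    qed
  qed simp
  obtain \<epsilon> where \<epsilon>: "0 < \<epsilon>" "(\<Union>z\<in>?C. cball z \<epsilon>) \<subseteq> Q"
    using compact_subset_open_imp_cball_epsilon_subset[OF C Qo WQ] by metis
  \<comment> \<open>Radii at most \<epsilon> keep the supports of the kernels at points of the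
    cylinder inside Q, where the weak derivatives live.\<close>
  define \<rho> where "\<rho> n = \<epsilon> / (real n + 1)" for n
  have \<rho>: "0 < \<rho> n" "\<rho> n \<le> \<epsilon>" for n using \<epsilon> by (auto simp: \<rho>_def field_simps)
  have \<rho>lim: "\<rho> \<longlonglongrightarrow> 0" unfolding \<rho>_def by real_asymp
  define gv where "gv z = (\<chi> i. gB i z)" for z
  obtain \<sigma> :: "nat \<Rightarrow> nat" where \<sigma>: "strict_mono \<sigma>"
    "AE z in lborel. (\<lambda>n. norm ((\<chi> i. mollify (\<rho> (\<sigma> n)) (gB i) z) - (\<chi> i. gB i z))) \<longlonglongrightarrow> 0"
    by (rule mollify_AE_subseq[where f = gB, OF gB(3) \<rho>(1) \<rho>lim]) (rule that)
  define r where "r n = \<rho> (\<sigma> n)" for n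
  have r: "0 < r n" "r n \<le> \<epsilon>" for n using \<rho> by (auto simp: r_def)
  have rlim: "r \<longlonglongrightarrow> 0"
    using LIMSEQ_subseq_LIMSEQ[OF \<rho>lim \<sigma>(1)] by (simp add: r_def[abs_def] o_def)
  have rQ: "cball z (r n) \<subseteq> Q" if "z \<in> ?C" for z n
  proof -
    have "cball z (r n) \<subseteq> cball z \<epsilon>" using r(2) by (intro subset_cball)
    then show ?thesis using \<epsilon>(2) that by blast
  qed
  define v where "v n = mollify (r n) uB" for n
  define a where "a n = mollify (r n) utB" for n
  define G where "G n z = (\<chi> i. mollify (r n) (gB i) z)" for n z
  \<comment> \<open>Mollifying the norm of the Hessian, instead of taking the norm of the mollified
    Hessian, gives a continuous function that dominates all spatial entries of \<open>DG\<close> and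
    whose mixed norm is at most that of the Hessian.\<close>
  define H where "H n = mollify (r n) (\<lambda>z. \<bar>HB z\<bar>)" for n
  define DG where "DG n z h = (\<chi> i. \<integral>w. frechet_derivative (kernel (r n)) (at (z - w)) h * gB i w \<partial>lborel)" for n z and h :: "real \<times> (real ^ 'd)"
  have Glim: "AE z in lborel. (\<lambda>n. norm (G n z - gv z)) \<longlonglongrightarrow> 0"
    using \<sigma>(2) by (simp add: G_def gv_def r_def)
  have uBw: "AE w in lborel. w \<in> cball z (r n) \<longrightarrow> uB w = u w" if "z \<in> ?C" for z n
  proof (intro AE_I2 impI)
    fix w assume "w \<in> cball z (r n)"
    then have "w \<in> Q" using rQ[OF that, of n] by blast
    then show "uB w = u w" by (simp add: uB_def)
  qed
  have local: "AE w in lborel. w \<in> cball z (r n) \<longrightarrow> f w = g w"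
    if "z \<in> ?C" "AE w in lborel. w \<in> Q \<longrightarrow> f w = g w" for z n and f g :: "real \<times> (real ^ 'd) \<Rightarrow> real"
    using that(2) rQ[OF that(1), of n] by (elim eventually_mono) blast
  have dv: "(v n has_derivative (\<lambda>h. a n z * fst h + G n z \<bullet> snd h)) (at z)" if z: "z \<in> ?C" for n z
  proof -
    let ?D = "\<lambda>h. \<integral>w. frechet_derivative (kernel (r n)) (at (z - w)) h * uB w \<partial>lborel"
    have D: "(v n has_derivative ?D) (at z)"
      unfolding v_def by (rule mollify_has_derivative[OF r(1) uBint])
    have "?D (1, 0) = a n z"
      unfolding a_def
      by (rule mollify_weak_derivative[OF w(1)[unfolded weak_dt_def] r(1) rQ[OF z] uBm uBw[OF z] utB local[OF z utB'(1)]])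
    moreover have "?D (0, axis i 1) = mollify (r n) (gB i) z" for i
      by (rule mollify_weak_derivative[OF w(2)[unfolded weak_gradient_def, rule_format] r(1) rQ[OF z] uBm uBw[OF z] gB(1) local[OF z gB(2)]])
    ultimately have "?D h = a n z * fst h + G n z \<bullet> snd h" for h
      using linear_time_space[OF has_derivative_linear[OF D], of h] by (simp add: G_def)
    then show ?thesis using D by simp
  qed
  have dG: "(G n has_derivative DG n z) (at z)" for n z
    unfolding G_def[abs_def] DG_def[abs_def]
    by (rule has_derivative_vec_lambda) (rule mollify_has_derivative[OF r(1) gB(3)])
  have absHB: "integrable lborel (\<lambda>z. \<bar>HB z\<bar>)" using HB'(3) by (rule integrable_abs)
  have G': "\<bar>DG n z (0, axis j 1) $ i\<bar> \<le> H n z" if z: "z \<in> ?C" for n z i j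
  proof -
    have "DG n z (0, axis j 1) $ i = mollify (r n) (hB (i, j)) z"
      unfolding DG_def
      by (simp, rule mollify_weak_derivative[OF w(3)[unfolded weak_gradient_def, rule_format] r(1) rQ[OF z] gB(1) local[OF z gB(2)] hB(1) local[OF z hB(2)]])
    also have "\<bar>\<dots>\<bar> \<le> mollify (r n) (\<lambda>w. \<bar>hB (i, j) w\<bar>) z"
      by (rule abs_mollify_le[OF r(1) hB(3)])
    also have "\<dots> \<le> H n z"
      unfolding H_def
    proof (rule mollify_mono[OF r(1) integrable_abs[OF hB(3)] absHB])
      show "AE w in lborel. \<bar>hB (i, j) w\<bar> \<le> \<bar>HB w\<bar>"
        using hB(2)[of i j] HB'(1)
      proof eventually_elim
        case (elim w)
        then show ?case using D2le[of w i j] hB(4)[of w i j] by (cases "w \<in> Q") auto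
      qed
    qed
    finally show ?thesis .
  qed
  have cont: "continuous_on UNIV (a n)" "continuous_on UNIV (H n)" for n
    unfolding a_def H_def by (intro continuous_on_mollify r utB' absHB)+
  have H0: "0 \<le> H n z" for n z
    unfolding H_def mollify_def by (intro integral_nonneg_AE AE_I2) (simp add: kernel_nonneg)
  have Gm: "(\<lambda>z. norm (G n z - gv z)) \<in> borel_measurable borel" for n
  proof -
    have [measurable]: "mollify (r n) (gB i) \<in> borel_measurable borel" for i
      using continuous_on_mollify[OF r(1) gB(3)] by (rule borel_measurable_continuous_onI)
    note gB(1)[measurable]
    have "(\<lambda>z. L2_set (\<lambda>i. mollify (r n) (gB i) z - gB i z) UNIV) \<in> borel_measurable borel"
      unfolding L2_set_def by measurable
    then show ?thesis by (simp add: norm_vec_def G_def gv_def L2_set_def)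
  qed

  \<comment> \<open>The differential inequality and the norms of the data\<close>
  have drift: "AE z in lborel. z \<in> Q \<longrightarrow> - utB z \<le> \<bar>bB z\<bar> * norm (gv z)"
  proof -
    have "AE z in lebesgue. z \<in> Q \<longrightarrow> 0 \<le> ut z + (\<Sum>i\<in>UNIV. b z $ i * Du z $ i)"
      using assms(19) Qm by (subst (asm) AE_restrict_space_iff) auto
    then have "AE z in lborel. z \<in> Q \<longrightarrow> 0 \<le> ut z + (\<Sum>i\<in>UNIV. b z $ i * Du z $ i)"
      by (simp only: AE_completion_iff)
    moreover have "AE z in lborel. \<forall>i\<in>UNIV. z \<in> Q \<longrightarrow> Du z $ i = Du' z $ i"
      using Du_eq by (subst AE_finite_all) auto
    moreover have "AE z in lborel. \<forall>i\<in>UNIV. z \<in> Q \<longrightarrow> gB i z = Du' z $ i"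
      using gB(2) by (subst AE_finite_all) auto
    ultimately show ?thesis
      using ut_eq utB'(1) bB'(1)
    proof eventually_elim
      case (elim z)
      show ?case
      proof
        assume z: "z \<in> Q"
        have "gv z = Du z" using elim z by (simp add: gv_def vec_eq_iff)
        moreover have "- ut z \<le> b z \<bullet> Du z" using elim z by (simp add: inner_vec_def)
        moreover have "b z \<bullet> Du z \<le> norm (b z) * norm (Du z)" by (rule norm_cauchy_schwarz)
        ultimately show "- utB z \<le> \<bar>bB z\<bar> * norm (gv z)" using elim z by simp
      qed
    qed
  qed
  define NH where "NH = enn2real (ordered_mixed_lp q p (\<lambda>z. ennreal \<bar>HB z\<bar>))"
  define Nb where "Nb = enn2real (ordered_mixed_lp q0 p0 (\<lambda>z. ennreal \<bar>bB z\<bar>))"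
  have N0: "0 \<le> NH" "0 \<le> Nb" by (simp_all add: NH_def Nb_def)
  have NbB: "mixed_lp q0 p0 (\<lambda>z. ennreal \<bar>bB z\<bar>) \<le> ennreal Nb"
  proof -
    have "(\<lambda>z. ennreal \<bar>bB z\<bar>) \<in> borel_measurable borel" using bB by measurable
    then have "mixed_lp q0 p0 (\<lambda>z. ennreal \<bar>bB z\<bar>) \<le> ordered_mixed_lp q0 p0 (\<lambda>z. ennreal \<bar>bB z\<bar>)"
      using rel by (intro mixed_lp_le_ordered_mixed_lp) auto
    also have "\<dots> = ennreal Nb" using bB'(2) by (simp add: Nb_def less_top)
    finally show ?thesis .
  qed
  have NHH: "ordered_mixed_lp q p (\<lambda>z. ennreal (H n z)) \<le> ennreal NH" for n
  proof -
    have "ordered_mixed_lp q p (\<lambda>z. ennreal \<bar>H n z\<bar>) \<le> ordered_mixed_lp q p (\<lambda>z. ennreal \<bar>\<bar>HB z\<bar>\<bar>)"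
      unfolding H_def using rel by (intro ordered_mixed_lp_mollify_le r absHB) auto
    then show ?thesis using HB'(2) H0 by (simp add: NH_def less_top)
  qed

  \<comment> \<open>Choice of the constants\<close>
  obtain R where R: "0 < R" "\<And>x. x \<in> W \<Longrightarrow> norm (x - x0) \<le> R"
  proof -
    have "bounded ((\<lambda>x. x - x0) ` W)"
      using W by (intro compact_imp_bounded compact_continuous_image continuous_intros)
    then obtain B where B: "0 < B" "\<forall>y\<in>(\<lambda>x. x - x0) ` W. norm y \<le> B" unfolding bounded_pos by blast
    show ?thesis by (rule that[OF B(1)]) (use B(2) in blast)
  qed
  define \<omega> where "\<omega> = measure lborel (ball (0 :: real ^ 'd) 1)"
  have \<omega>: "0 < \<omega>" unfolding \<omega>_def by (intro content_ball_pos) simp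
  define c :: real where "c = fact (CARD('d) + 1)"
  have c: "0 < c" by (simp add: c_def)
  \<comment> \<open>After losing \<kappa> / 8 to mollification at the bottom and again at the top
    and side, the gap is 3 \<kappa> / 4. It has to accommodate J < \<kappa> / 4, \<delta> R \<le>
    \<kappa> / 8 and this \<open>g\<close>, together less than 5 \<kappa> / 8 and \<kappa> / 4 as
    separate limits require: their sum is below 3 \<kappa> / 4.\<close>
  define g where "g = \<kappa> / 4"
  \<comment> \<open>\<open>J\<close> will be less than 2 B0. The three bounds serve the gap, the
    condition \<open>J \<le> 1\<close>, and the final comparison, where \<open>J\<close> must stay
    below \<open>g * \<omega> / (8 * c)\<close>.\<close>
  define B0 where "B0 = min (\<kappa> / 8) (min (1 / 2) (g * \<omega> / (16 * c)))"
  have B0: "0 < B0" "B0 \<le> \<kappa> / 8" "B0 \<le> 1 / 2" "B0 \<le> g * \<omega> / (16 * c)"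
    using \<kappa> \<omega> c by (auto simp: B0_def g_def)
  define \<theta> where "\<theta> = q * d / p0"
  have \<theta>: "0 < 1 - \<theta>" using rel by (simp add: \<theta>_def)
  \<comment> \<open>The cost of the drift is a constant times \<delta>^(1 - \<theta>), and it can be
    made small because \<theta> < 1.\<close>
  obtain \<delta> where \<delta>: "0 < \<delta>" "\<delta> \<le> \<kappa> / (8 * R)" "2 * Nb * NH powr \<theta> * \<delta> powr (1 - \<theta>) < B0"
    using small_powr[of "\<kappa> / (8 * R)" B0 "2 * Nb * NH powr \<theta>" "1 - \<theta>"] \<kappa> R B0 N0 \<theta> by auto
  have drift_small: "2 * \<delta> * (Nb * (NH / \<delta>) powr \<theta>) < B0"
  proof -
    have "(NH / \<delta>) powr \<theta> = NH powr \<theta> / \<delta> powr \<theta>"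
      using \<delta> N0 by (simp add: powr_divide)
    moreover have "\<delta> powr (1 - \<theta>) = \<delta> / \<delta> powr \<theta>"
      using \<delta>(1) by (simp add: powr_diff)
    ultimately show ?thesis using \<delta>(3) by (simp add: mult_ac)
  qed
  have \<delta>R: "\<delta> * R \<le> \<kappa> / 8" using \<delta>(2) R(1) by (simp add: field_simps)
  define U where "U = \<bar>U0\<bar> + \<kappa>"
  have U: "0 \<le> U" using \<kappa> by (simp add: U_def)
  \<comment> \<open>With \<delta> now fixed, \<open>K2\<close> and \<open>K3\<close> are the
    factors, depending on \<delta> and on the data, that multiply \<nu> in \<open>J\<close> and the
    power \<nu>^(p / q) in the column bound. The tolerance \<nu> for the mollification error is
    chosen after them.\<close>
  define K2 where "K2 = (NH / \<delta>) powr (q * d / p)"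
  define K3 where "K3 = (2 * U + 2) powr (1 - p / q) * (2 powr (p / q) * NH powr d)"
  define B3 where "B3 = \<delta> powr d * (g * \<omega> / (4 * c))"
  have B3: "0 < B3" using \<delta> \<omega> c \<kappa> by (simp add: B3_def g_def)
  obtain \<nu>1 where \<nu>1: "0 < \<nu>1" "K2 * \<nu>1 powr 1 < B0"
    using small_powr[of 1 B0 K2 1] B0 by (auto simp: K2_def)
  obtain \<nu> where \<nu>: "0 < \<nu>" "\<nu> \<le> \<nu>1" "K3 * \<nu> powr (p / q) < B3"
    using small_powr[of \<nu>1 B3 K3 "p / q"] \<nu>1 B3 rel by (auto simp: K3_def)
  have K2\<nu>: "\<nu> * K2 < B0"
  proof -
    have "\<nu> * K2 \<le> \<nu>1 * K2" using \<nu>(2) by (intro mult_right_mono) (simp_all add: K2_def)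
    then show ?thesis using \<nu>1 by (simp add: mult.commute)
  qed
  have E3: "(2 * U + 2) powr (1 - p / q) * ((2 * \<nu>) powr (p / q) * NH powr d) < B3"
    using \<nu> by (simp add: K3_def powr_mult mult_ac)

  define h where "h n z = \<bar>a n z - utB z\<bar> + (if \<delta> < norm (G n z - gv z) then \<bar>utB z\<bar> else 0)" for n z
  have am: "a n \<in> borel_measurable borel" for n
    using cont(1) by (rule borel_measurable_continuous_onI)
  note am[measurable] Gm[measurable]
  have hm: "h n \<in> borel_measurable borel" for n
    unfolding h_def by measurable
  have h0: "0 \<le> h n z" for n z by (simp add: h_def)
  have "(\<lambda>n. ordered_mixed_lp q p (\<lambda>z. ennreal \<bar>a n z - utB z\<bar>)) \<longlonglongrightarrow> 0"
    unfolding a_def using rel by (intro mollify_tendsto_ordered_mixed_lp utB' r rlim) auto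
  then have ev1: "eventually (\<lambda>n. ordered_mixed_lp q p (\<lambda>z. ennreal \<bar>a n z - utB z\<bar>) < ennreal (\<nu> / 2)) sequentially"
    using \<nu> by (intro order_tendstoD(2)) auto
  \<comment> \<open>By a.e. convergence of the gradients along the subsequence, almost every point
    leaves the exceptional set eventually, and \<bar>utB\<bar> is a dominating function of finite
    mixed norm.\<close>
  have "(\<lambda>n. ordered_mixed_lp q p (\<lambda>z. ennreal (if \<delta> < norm (G n z - gv z) then \<bar>utB z\<bar> else 0))) \<longlonglongrightarrow> 0"
  proof (rule ordered_mixed_lp_dominated_convergence[where G = "\<lambda>z. ennreal \<bar>utB z\<bar>"])
    show "AE z in lborel. (\<lambda>n. ennreal (if \<delta> < norm (G n z - gv z) then \<bar>utB z\<bar> else 0)) \<longlonglongrightarrow> 0"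
      using Glim
    proof eventually_elim
      case (elim z)
      then have "eventually (\<lambda>n. norm (G n z - gv z) < \<delta>) sequentially"
        using \<delta>(1) by (rule order_tendstoD(2))
      then have "eventually (\<lambda>n. 0 = ennreal (if \<delta> < norm (G n z - gv z) then \<bar>utB z\<bar> else 0)) sequentially"
        by eventually_elim simp
      then show ?case by (rule Lim_transform_eventually[OF tendsto_const])
    qed
  qed (use rel utB' in \<open>auto intro!: AE_I2 ennreal_leI\<close>)
  then have ev2: "eventually (\<lambda>n. ordered_mixed_lp q p (\<lambda>z. ennreal (if \<delta> < norm (G n z - gv z) then \<bar>utB z\<bar> else 0)) < ennreal (\<nu> / 2)) sequentially"
    using \<nu> by (intro order_tendstoD(2)) auto
  obtain \<rho>0 where \<rho>0: "0 < \<rho>0" "\<And>s z. 0 < s \<Longrightarrow> s < \<rho>0 \<Longrightarrow> z \<in> ?C \<Longrightarrow> \<bar>mollify s uB z - u z\<bar> \<le> \<kappa> / 8"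
    using mollify_uniformly_close[OF Qo continuous_on_subset[OF ucont closure_subset] uBint[unfolded uB_def] C WQ, of "\<kappa> / 8"] \<kappa>
    unfolding uB_def[abs_def] by auto
  have ev3: "eventually (\<lambda>n. r n < \<rho>0) sequentially"
    using rlim \<rho>0(1) by (rule order_tendstoD(2))
  obtain n where n: "ordered_mixed_lp q p (\<lambda>z. ennreal \<bar>a n z - utB z\<bar>) < ennreal (\<nu> / 2)"
    "ordered_mixed_lp q p (\<lambda>z. ennreal (if \<delta> < norm (G n z - gv z) then \<bar>utB z\<bar> else 0)) < ennreal (\<nu> / 2)" "r n < \<rho>0"
    using eventually_conj[OF ev1 eventually_conj[OF ev2 ev3]] by (auto simp: eventually_sequentially)
  have vu: "\<bar>v n z - u z\<bar> \<le> \<kappa> / 8" if "z \<in> ?C" for z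
    unfolding v_def by (rule \<rho>0(2)[OF r(1) n(3) that])
  have Nh: "ordered_mixed_lp q p (\<lambda>z. ennreal (h n z)) \<le> ennreal \<nu>"
  proof -
    have m1: "(\<lambda>z. ennreal \<bar>a n z - utB z\<bar>) \<in> borel_measurable borel" by measurable
    have m2: "(\<lambda>z. ennreal (if \<delta> < norm (G n z - gv z) then \<bar>utB z\<bar> else 0)) \<in> borel_measurable borel"
      by measurable
    have "ordered_mixed_lp q p (\<lambda>z. ennreal (h n z)) =
        ordered_mixed_lp q p (\<lambda>z. ennreal \<bar>a n z - utB z\<bar> + ennreal (if \<delta> < norm (G n z - gv z) then \<bar>utB z\<bar> else 0))"
      unfolding h_def by (simp flip: ennreal_plus)
    also have "\<dots> \<le> ordered_mixed_lp q p (\<lambda>z. ennreal \<bar>a n z - utB z\<bar>) +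
        ordered_mixed_lp q p (\<lambda>z. ennreal (if \<delta> < norm (G n z - gv z) then \<bar>utB z\<bar> else 0))"
      by (rule ordered_mixed_lp_add_le[OF m1 m2]) (use rel in simp_all)
    also have "\<dots> \<le> ennreal (\<nu> / 2) + ennreal (\<nu> / 2)"
      by (rule add_mono[OF less_imp_le[OF n(1)] less_imp_le[OF n(2)]])
    also have "\<dots> = ennreal \<nu>" using \<nu> by (simp flip: ennreal_plus)
    finally show ?thesis .
  qed
  have bound: "AE z in lborel. z \<in> ?C \<longrightarrow> norm (G n z) \<le> \<delta> \<longrightarrow> - a n z \<le> 2 * \<delta> * \<bar>bB z\<bar> + h n z"
    using drift
  proof eventually_elim
    case (elim z)
    show ?case
    proof (intro impI)
      assume z: "z \<in> ?C" and Gz: "norm (G n z) \<le> \<delta>"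
      have "- utB z \<le> \<bar>bB z\<bar> * norm (gv z)" using elim subsetD[OF WQ z] by simp
      moreover have "norm (gv z) \<le> norm (G n z) + norm (G n z - gv z)"
        by (metis norm_minus_commute norm_triangle_sub)
      then have "\<bar>bB z\<bar> * norm (gv z) \<le> \<bar>bB z\<bar> * (2 * \<delta>)" if "norm (G n z - gv z) \<le> \<delta>"
        using that Gz by (intro mult_left_mono) auto
      moreover have "0 \<le> 2 * \<delta> * \<bar>bB z\<bar>" using \<delta> by simp
      ultimately show "- a n z \<le> 2 * \<delta> * \<bar>bB z\<bar> + h n z"
        unfolding h_def by (cases "\<delta> < norm (G n z - gv z)") (auto simp: mult_ac not_less)
    qed
  qed

  \<comment> \<open>The contact estimate and the contradiction\<close>
  define J where "J = 2 * \<delta> * (Nb * (NH / \<delta>) powr (q * real CARD('d) / p0)) + \<nu> * (NH / \<delta>) powr (q * real CARD('d) / p)"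
  have J: "J < 2 * B0" using drift_small K2\<nu> by (simp add: J_def K2_def \<theta>_def d_def)
  define s where "s = \<delta> powr d * (g * \<omega> / (8 * c))"
  have s: "0 < s" using \<delta> \<omega> c \<kappa> by (simp add: s_def g_def)
  have est: "g * measure lborel (ball (0 :: real ^ 'd) \<delta>) \<le>
    fact (CARD('d) + 1) * (2 * (\<delta> powr real CARD('d) * J + s) + (2 * U + 2) powr (1 - p / q) * ((2 * \<nu>) powr (p / q) * NH powr real CARD('d)))"
  proof (rule contact_estimate[where v = "v n" and a = "a n" and G = "G n" and G' = "DG n" and H = "H n" and b = "\<lambda>z. \<bar>bB z\<bar>" and h = "h n"
        and W = W and ?x0.0 = x0 and ?T1.0 = T1 and ?T2.0 = T2 and ?q0.0 = q0 and ?p0.0 = p0 and Nb = Nb and R = R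
        and ?m1.0 = "m - \<kappa> / 8" and ?m2.0 = "m - \<kappa> + \<kappa> / 8"])
    show "m - \<kappa> / 8 \<le> v n (T1, x0)"
    proof -
      have "\<bar>v n (T1, x0) - u (T1, x0)\<bar> \<le> \<kappa> / 8" by (rule vu) (use W T in simp)
      then show ?thesis using start by linarith
    qed
    show "v n (T2, x) \<le> m - \<kappa> + \<kappa> / 8" if "x \<in> W" for x
    proof -
      have "\<bar>v n (T2, x) - u (T2, x)\<bar> \<le> \<kappa> / 8" by (rule vu) (use that T in simp)
      then show ?thesis using top[OF that] by linarith
    qed
    show "v n (t, x) \<le> m - \<kappa> + \<kappa> / 8" if "t \<in> {T1..T2}" "x \<in> frontier W" for t x
    proof -
      have "x \<in> W" using that(2) frontier_subset_closed[OF compact_imp_closed[OF W(1)]] by (rule subsetD[rotated])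
      then have "\<bar>v n (t, x) - u (t, x)\<bar> \<le> \<kappa> / 8" by (intro vu) (use that in simp)
      then show ?thesis using side[OF that] by linarith
    qed
    show "\<bar>v n z\<bar> \<le> U" if "z \<in> ?C" for z
    proof -
      have "\<bar>u z\<bar> \<le> U0" by (rule U0[OF subsetD[OF closure_subset subsetD[OF WQ that]]])
      then show ?thesis using vu[OF that] \<kappa> unfolding U_def by linarith
    qed
    show "J = 2 * \<delta> * (Nb * (NH / \<delta>) powr (q * real CARD('d) / p0)) + \<nu> * (NH / \<delta>) powr (q * real CARD('d) / p)"
      by (rule J_def)
    show "J \<le> 1" using J B0 by simp
    show "m - \<kappa> + \<kappa> / 8 + J + \<delta> * R + g < m - \<kappa> / 8"
      using J B0 \<delta>R \<kappa> by (simp add: g_def)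
    show "(\<lambda>z. \<bar>bB z\<bar>) \<in> borel_measurable borel" using bB by measurable
    show "0 < g" using \<kappa> by (simp add: g_def)
    show "1 < p / real CARD('d)" "real CARD('d) / p + 1 / q = 1" "real CARD('d) / p0 + 1 / q0 = 1"
      using rel rel2 by (simp_all add: d_def)
    show "(v n has_derivative (\<lambda>h. a n z * fst h + G n z \<bullet> snd h)) (at z)" if "z \<in> ?C" for z
      by (rule dv[OF that])
    show "(G n has_derivative DG n z) (at z)" for z by (rule dG)
    show "\<bar>DG n z (0, axis j 1) $ i\<bar> \<le> H n z" if "z \<in> ?C" for z i j by (rule G'[OF that])
    show "norm (x - x0) \<le> R" if "x \<in> W" for x by (rule R(2)[OF that])
    show "AE z in lborel. z \<in> ?C \<longrightarrow> norm (G n z) \<le> \<delta> \<longrightarrow> - a n z \<le> 2 * \<delta> * \<bar>bB z\<bar> + h n z" by (rule bound)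
    show "0 \<le> \<nu>" using \<nu> by simp
    show "0 \<le> \<bar>bB z\<bar>" for z by simp
  qed (fact rel W T cont H0 U \<delta> hm h0 NbB N0 NHH Nh s)+
  have "measure lborel (ball (0 :: real ^ 'd) \<delta>) = \<delta> powr d * \<omega>"
    using content_ball_conv_unit_ball[of \<delta> "0 :: real ^ 'd"] \<delta> by (simp add: \<omega>_def d_def powr_realpow)
  then have "g * (\<delta> powr d * \<omega>) \<le> c * (2 * (\<delta> powr d * J + s) + (2 * U + 2) powr (1 - p / q) * ((2 * \<nu>) powr (p / q) * NH powr d))"
    using est by (simp add: c_def d_def)
  \<comment> \<open>The bound for \<open>J\<close>, the choice of \<open>s\<close> and that of
    \<open>B3\<close> each account for one quarter of the left-hand side, which is therefore less
    than three quarters of itself.\<close>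
  also have "\<dots> < c * (2 * (\<delta> powr d * (g * \<omega> / (8 * c)) + s) + B3)"
  proof -
    have "\<delta> powr d * J < \<delta> powr d * (g * \<omega> / (8 * c))"
      using J B0 \<delta> by (intro mult_strict_left_mono) auto
    then have "2 * (\<delta> powr d * J + s) + (2 * U + 2) powr (1 - p / q) * ((2 * \<nu>) powr (p / q) * NH powr d) <
      2 * (\<delta> powr d * (g * \<omega> / (8 * c)) + s) + B3"
      by (intro add_strict_mono[OF mult_strict_left_mono[OF add_strict_right_mono] E3] zero_less_numeral)
    then show ?thesis using c by (rule mult_strict_left_mono)
  qed
  also have "\<dots> = 3 / 4 * (g * (\<delta> powr d * \<omega>))"
    using c by (simp add: s_def B3_def field_simps)
  finally have "g * (\<delta> powr d * \<omega>) < 3 / 4 * (g * (\<delta> powr d * \<omega>))" .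
  moreover have "0 < g * (\<delta> powr d * \<omega>)" using \<kappa> \<delta> \<omega> by (simp add: g_def)
  ultimately show False by linarith
qed

end
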